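(* There is an algorithm which, given a lattice $N$, a system $S$ of $N$-cones and a primitive sublattice $L$ of $N$, constructs the quotient fan $\widetilde{\Delta}$ of $S$ by $L$ (in particular, this quotient fan exists).
   Context: A lattice is a free $\mathbb{Z}$-module of finite rank; for a lattice $N$ put $N^{\mathbb{R}}:=N\otimes_{\mathbb{Z}}\mathbb{R}$, and for a homomorphism $F:N\to N'$ of lattices let $F^{\mathbb{R}}:N^{\mathbb{R}}\to N'^{\mathbb{R}}$ be its scalar extension. A sublattice $L\subset N$ is primitive if $N/L$ is torsion-free. A system $S$ of $N$-cones is a finite set of convex cones in $N^{\mathbb{R}}$ such that every $\sigma\in S$ is generated by finitely many vectors of $N$ (the cones need not be strictly convex, nor intersect in common faces). As input to an algorithm, each cone is given by finitely many generators in $N$. A map $F:(N,S)\to(N',S')$ from a system $S$ of $N$-cones to a system $S'$ of $N'$-cones is a lattice homomorphism $F:N\to N'$ such that for every $\sigma\in S$ there is a cone $\tau\in S'$ with $F^{\mathbb{R}}(\sigma)\subset\tau$. A system $\Sigma$ of $N$-cones is a quasifan in $N$ if for each $\sigma\in\Sigma$ all faces of $\sigma$ belong to $\Sigma$ and for any two cones $\sigma,\sigma'\in\Sigma$ the intersection $\sigma\cap\sigma'$ is a face of $\sigma$. A fan is a quasifan all of whose cones are strictly convex (contain no nonzero linear subspace). A map of fans is a map of the underlying systems of cones. Quotient fan: let $S$ be a system of $N$-cones and let $L\subset\widehat{L}\subset N$ be primitive sublattices. A fan $\widetilde{\Delta}$ in $\widetilde{N}:=N/\widehat{L}$ is called a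 quotient fan of $S$ by $L$ if: (i) the projection $P:N\to\widetilde{N}$ defines a map of the systems of cones $S$ and $\widetilde{\Delta}$; (ii) for every map $F:(N,S)\to(N',\Delta')$ from $S$ to a fan $\Delta'$ in a lattice $N'$ with $F(L)=0$ there is a map of fans $\widetilde{F}:(\widetilde{N},\widetilde{\Delta})\to(N',\Delta')$ with $F=\widetilde{F}\circ P$. (The sublattice $\widehat{L}$ is part of what is to be constructed; the quotient fan is uniquely determined by $S$ and $L$.) *)

theory Defs
  imports "Jordan_Normal_Form.Matrix_Kernel" "HOL-Algebra.AbelCoset" "HOL-Library.Nat_Bijection"
begin

section \<open>Lattices\<close>

text \<open>A lattice is given by a basis, i.e. it is \<open>\<int>\<^sup>n\<close> = \<^term>\<open>carrier_vec n :: int vec set\<close> and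
  its real extension is \<^term>\<open>carrier_vec n :: real vec set\<close>. A homomorphism from
  \<open>\<int>\<^sup>n\<close> to \<open>\<int>\<^sup>m\<close> is an integer \<open>m \<times> n\<close> matrix, and its scalar extension is the
  same matrix read over the reals.\<close>

definition lattice_hom :: "nat \<Rightarrow> nat \<Rightarrow> int mat \<Rightarrow> bool" where
  "lattice_hom n m F \<longleftrightarrow> F \<in> carrier_mat m n"

definition real_ext :: "int mat \<Rightarrow> real vec \<Rightarrow> real vec" where
  "real_ext F x = map_mat real_of_int F *\<^sub>v x"

definition sublattice :: "nat \<Rightarrow> int vec set \<Rightarrow> bool" where
  "sublattice n L \<longleftrightarrow> additive_subgroup L (module_vec TYPE(int) n)"

text \<open>The second conjunct says that \<open>\<int>\<^sup>n/L\<close> is torsion-free.\<close>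

definition primitive_sublattice :: "nat \<Rightarrow> int vec set \<Rightarrow> bool" where
  "primitive_sublattice n L \<longleftrightarrow> sublattice n L \<and>
     (\<forall>k. \<forall>v\<in>carrier_vec n. k \<noteq> 0 \<longrightarrow> k \<cdot>\<^sub>v v \<in> L \<longrightarrow> v \<in> L)"

definition generated_sublattice :: "nat \<Rightarrow> int vec list \<Rightarrow> int vec set" where
  "generated_sublattice n vs = {mat_of_cols n vs *\<^sub>v c |c. c \<in> carrier_vec (length vs)}"

text \<open>\<open>P\<close> is the projection \<open>\<int>\<^sup>n \<rightarrow> \<int>\<^sup>n/L\<close>, where the torsion-free quotient \<open>\<int>\<^sup>n/L\<close> is
  identified with \<open>\<int>\<^sup>m\<close> by some choice of a basis; thus \<open>P\<close> is determined by \<open>L\<close> up to an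
  automorphism of \<open>\<int>\<^sup>m\<close>.\<close>

definition quotient_projection :: "nat \<Rightarrow> int vec set \<Rightarrow> nat \<Rightarrow> int mat \<Rightarrow> bool" where
  "quotient_projection n L m P \<longleftrightarrow> lattice_hom n m P \<and>
     (\<lambda>v. P *\<^sub>v v) ` carrier_vec n = carrier_vec m \<and> mat_kernel P = L"


section \<open>Systems of cones, quasifans and fans\<close>

definition generated_cone :: "nat \<Rightarrow> int vec list \<Rightarrow> real vec set" where
  "generated_cone n vs =
     {map_mat real_of_int (mat_of_cols n vs) *\<^sub>v c |c.
        c \<in> carrier_vec (length vs) \<and> (\<forall>i<length vs. 0 \<le> c $ i)}"

definition cone_system :: "nat \<Rightarrow> real vec set set \<Rightarrow> bool" where
  "cone_system n S \<longleftrightarrow> finite S \<and>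
     (\<forall>\<sigma>\<in>S. \<exists>vs. set vs \<subseteq> carrier_vec n \<and> \<sigma> = generated_cone n vs)"

definition map_of_systems ::
  "nat \<Rightarrow> real vec set set \<Rightarrow> nat \<Rightarrow> real vec set set \<Rightarrow> int mat \<Rightarrow> bool" where
  "map_of_systems n S m S' F \<longleftrightarrow> lattice_hom n m F \<and>
     (\<forall>\<sigma>\<in>S. \<exists>\<tau>\<in>S'. real_ext F ` \<sigma> \<subseteq> \<tau>)"

text \<open>Faces are the intersections \<open>\<sigma> \<inter> u\<^sup>\<bottom>\<close> with \<open>u\<close> in the dual cone of \<open>\<sigma>\<close>. So \<open>\<sigma>\<close> is a face
  of itself (\<open>u = 0\<close>), and the empty set is not a face.\<close>

definition cone_face :: "nat \<Rightarrow> real vec set \<Rightarrow> real vec set \<Rightarrow> bool" where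
  "cone_face n \<tau> \<sigma> \<longleftrightarrow>
     (\<exists>u\<in>carrier_vec n. (\<forall>x\<in>\<sigma>. 0 \<le> u \<bullet> x) \<and> \<tau> = {x\<in>\<sigma>. u \<bullet> x = 0})"

definition quasifan :: "nat \<Rightarrow> real vec set set \<Rightarrow> bool" where
  "quasifan n \<Sigma> \<longleftrightarrow> cone_system n \<Sigma> \<and>
     (\<forall>\<sigma>\<in>\<Sigma>. \<forall>\<tau>. cone_face n \<tau> \<sigma> \<longrightarrow> \<tau> \<in> \<Sigma>) \<and>
     (\<forall>\<sigma>\<in>\<Sigma>. \<forall>\<sigma>'\<in>\<Sigma>. cone_face n (\<sigma> \<inter> \<sigma>') \<sigma>)"

definition strictly_convex :: "nat \<Rightarrow> real vec set \<Rightarrow> bool" where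
  "strictly_convex n \<sigma> \<longleftrightarrow>
     (\<forall>W. VectorSpace.subspace class_ring W (module_vec TYPE(real) n) \<and> W \<subseteq> \<sigma> \<longrightarrow> W = {0\<^sub>v n})"

definition fan :: "nat \<Rightarrow> real vec set set \<Rightarrow> bool" where
  "fan n \<Sigma> \<longleftrightarrow> quasifan n \<Sigma> \<and> (\<forall>\<sigma>\<in>\<Sigma>. strictly_convex n \<sigma>)"


section \<open>Quotient fans\<close>

text \<open>\<open>D\<close> is a quotient fan of \<open>S\<close> by \<open>L\<close>; it lives in \<open>\<int>\<^sup>n/Lh\<close>, which is identified with \<open>\<int>\<^sup>m\<close>
  via \<open>P\<close>. Since every lattice is isomorphic to some \<open>\<int>\<^sup>k\<close>, the universal property below ranges
  over fans in all lattices.\<close>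

definition quotient_fan ::
  "nat \<Rightarrow> real vec set set \<Rightarrow> int vec set \<Rightarrow> int vec set \<Rightarrow> nat \<Rightarrow> int mat \<Rightarrow> real vec set set \<Rightarrow> bool"
where
  "quotient_fan n S L Lh m P D \<longleftrightarrow>
     cone_system n S \<and> primitive_sublattice n L \<and> primitive_sublattice n Lh \<and> L \<subseteq> Lh \<and>
     quotient_projection n Lh m P \<and> fan m D \<and>
     map_of_systems n S m D P \<and>
     (\<forall>k D' F. fan k D' \<longrightarrow> map_of_systems n S k D' F \<longrightarrow> (\<forall>v\<in>L. F *\<^sub>v v = 0\<^sub>v k) \<longrightarrow>
        (\<exists>F'. map_of_systems m D k D' F' \<and> F = F' * P))"


section \<open>Algorithms\<close>

text \<open>Total recursive functions: \<^term>\<open>f :: nat list \<Rightarrow> nat\<close> is considered as an \<open>n\<close>-ary function,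
  only its values on lists of length \<open>n\<close> are relevant (rule \<open>ext\<close>). Minimization is applied to regular
  functions only, so that all functions in the class are total.\<close>

inductive recursive :: "nat \<Rightarrow> (nat list \<Rightarrow> nat) \<Rightarrow> bool" where
  zero: "recursive n (\<lambda>xs. 0)"
| succ: "recursive 1 (\<lambda>xs. Suc (xs ! 0))"
| proj: "i < n \<Longrightarrow> recursive n (\<lambda>xs. xs ! i)"
| comp: "recursive (length gs) f \<Longrightarrow> (\<forall>g\<in>set gs. recursive n g) \<Longrightarrow>
    recursive n (\<lambda>xs. f (map (\<lambda>g. g xs) gs))"
| prec: "recursive n f \<Longrightarrow> recursive (Suc (Suc n)) g \<Longrightarrow>
    recursive (Suc n) (\<lambda>xs. rec_nat (f (tl xs)) (\<lambda>k r. g (k # r # tl xs)) (hd xs))"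
| mini: "recursive (Suc n) f \<Longrightarrow> (\<forall>xs. length xs = n \<longrightarrow> (\<exists>y. f (y # xs) = 0)) \<Longrightarrow>
    recursive n (\<lambda>xs. LEAST y. f (y # xs) = 0)"
| ext: "recursive n f \<Longrightarrow> (\<forall>xs. length xs = n \<longrightarrow> g xs = f xs) \<Longrightarrow> recursive n g"

definition encode_vec :: "int vec \<Rightarrow> nat" where
  "encode_vec v = list_encode (map int_encode (list_of_vec v))"

definition encode_vecs :: "int vec list \<Rightarrow> nat" where
  "encode_vecs vs = list_encode (map encode_vec vs)"

definition encode_cones :: "int vec list list \<Rightarrow> nat" where
  "encode_cones gss = list_encode (map encode_vecs gss)"

definition encode_output :: "nat \<Rightarrow> int mat \<Rightarrow> int vec list \<Rightarrow> int vec list list \<Rightarrow> nat" where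
  "encode_output m P hs dss =
     list_encode [m, encode_vecs (rows P), encode_vecs hs, encode_cones dss]"

definition presents_system :: "nat \<Rightarrow> int vec list list \<Rightarrow> real vec set set \<Rightarrow> bool" where
  "presents_system n gss S \<longleftrightarrow>
     (\<forall>gs\<in>set gss. set gs \<subseteq> carrier_vec n) \<and> S = generated_cone n ` set gss"

definition presents_sublattice :: "nat \<Rightarrow> int vec list \<Rightarrow> int vec set \<Rightarrow> bool" where
  "presents_sublattice n ls L \<longleftrightarrow> set ls \<subseteq> carrier_vec n \<and> L = generated_sublattice n ls"

text \<open>The input is the rank \<open>n\<close>, generators of the cones in \<open>S\<close> and generators of \<open>L\<close>; the output
  is \<open>m\<close> and \<open>P\<close>, generators of \<open>Lh\<close>, and generators of the cones in the quotient fan.\<close>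

definition computes_quotient_fans :: "(nat list \<Rightarrow> nat) \<Rightarrow> bool" where
  "computes_quotient_fans f \<longleftrightarrow>
     (\<forall>n S L gss ls.
        cone_system n S \<longrightarrow> primitive_sublattice n L \<longrightarrow>
        presents_system n gss S \<longrightarrow> presents_sublattice n ls L \<longrightarrow>
        (\<exists>m P Lh D hs dss.
           quotient_fan n S L Lh m P D \<and>
           presents_sublattice n hs Lh \<and> presents_system m dss D \<and>
           f [n, encode_cones gss, encode_vecs ls] = encode_output m P hs dss))"

end

theory Submission
  imports Defs
begin

text \<open>
  Let \<open>F\<close> map \<open>S\<close> to a fan and kill \<open>L\<close>, and let \<open>F\<close> send \<open>\<sigma>\<^sub>i\<close> into the cone \<open>\<tau>\<^sub>i\<close>. Since \<open>\<tau>\<^sub>i \<inter> \<tau>\<^sub>j\<close>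
  is a face of \<open>\<tau>\<^sub>j\<close>, the smallest face of \<open>\<sigma>\<^sub>j\<close> that contains \<open>\<sigma>\<^sub>i \<inter> \<sigma>\<^sub>j\<close> is sent into \<open>\<tau>\<^sub>i\<close> as well. So
  each \<open>\<sigma>\<^sub>i\<close> may be enlarged by \<open>L\<close> and by these faces; all cones that arise are generated by subsets
  of one finite set, hence the process stops. Then any two cones meet in a common face, and they share
  one lineality space, which \<open>F\<close> has to kill because the target is a fan. Dividing by it gives the
  quotient fan.

  Every step of this construction is witnessed by integer vectors: nonnegative relations for the steps
  of the enlargement, and, by Farkas' lemma, linear forms that separate cones and expose faces. So it
  is semidecidable whether an output is correct with a certificate, and since each input has
  such an output, an unbounded search for it is a total recursive function.
\<close>

section \<open>Recursive functions on coded types\<close>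

text \<open>That no enlargement step applies any more is the absence of relations, which a search
  cannot confirm, and faces are cut out by arbitrary real forms. So each clause of a certificate has
  a positive shape over \<open>int\<close>: a search for coded data, a bounded quantifier or a
  decidable relation. Completeness of the enlargement is never tested; it is used only to prove that
  a certificate exists. Soundness uses that each step is forced on every map to a fan.

  The lineality spaces agree because 0 lies in every cone and the smallest face of a cone that
  contains 0 is its lineality space; its generators are therefore passed on to all other cones. As
  the common space lies in every cone, a relation between projected generators lifts, up to a
  positive multiple, to a relation between the enlarged cones, and completeness upstairs makes the
  projected cones meet in common faces.

  Integers suffice because Farkas' lemma holds over an ordered domain up to a positive factor, and
  such a factor can be absorbed: k copies of a generator are one copy plus k - 1 copies that stay in
  the cone.\<close>

lemma recursive_comp1:
  assumes "recursive 1 (\<lambda>xs. f (xs ! 0))" and "recursive n g"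
  shows "recursive n (\<lambda>xs. f (g xs))"
  using recursive.comp[of "[g]" "\<lambda>xs. f (xs ! 0)" n] assms by simp

lemma recursive_comp2:
  assumes "recursive 2 (\<lambda>xs. f (xs ! 0) (xs ! 1))" and "recursive n g" and "recursive n h"
  shows "recursive n (\<lambda>xs. f (g xs) (h xs))"
  using recursive.comp[of "[g, h]" "\<lambda>xs. f (xs ! 0) (xs ! 1)" n] assms by (simp add: numeral_2_eq_2)

text \<open>The scheme \<open>prec\<close> is brought to fixed arity with a single parameter.
  Several parameters are later coded into that one number, see
  \<open>computable_rec_nat\<close>.\<close>

lemma recursive_rec_nat:
  assumes f: "recursive 1 (\<lambda>xs. f (xs ! 0))"
    and g: "recursive 3 (\<lambda>xs. g (xs ! 0) (xs ! 1) (xs ! 2))"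
  shows "recursive 2 (\<lambda>xs. rec_nat (f (xs ! 1)) (\<lambda>k r. g k r (xs ! 1)) (xs ! 0))"
proof -
  have "recursive (Suc 1) (\<lambda>xs. rec_nat (f (tl xs ! 0))
      (\<lambda>k r. g ((k # r # tl xs) ! 0) ((k # r # tl xs) ! 1) ((k # r # tl xs) ! 2)) (hd xs))"
    using recursive.prec[OF f, of "\<lambda>xs. g (xs ! 0) (xs ! 1) (xs ! 2)"] g
    by (simp add: numeral_3_eq_3)
  then have "recursive 2 (\<lambda>xs. rec_nat (f (tl xs ! 0))
      (\<lambda>k r. g ((k # r # tl xs) ! 0) ((k # r # tl xs) ! 1) ((k # r # tl xs) ! 2)) (hd xs))"
    by (simp add: numeral_2_eq_2)
  then show ?thesis
    by (rule recursive.ext) (auto simp: numeral_2_eq_2 length_Suc_conv)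
qed

lemma recursive_Suc: "recursive n f \<Longrightarrow> recursive n (\<lambda>xs. Suc (f xs))"
  by (rule recursive_comp1[OF recursive.succ])

lemma recursive_nth [simp]:
  "recursive (Suc n) (\<lambda>xs. xs ! 0)" "recursive 1 (\<lambda>xs. xs ! 0)"
  "recursive 2 (\<lambda>xs. xs ! 0)" "recursive 2 (\<lambda>xs. xs ! 1)"
  "recursive 3 (\<lambda>xs. xs ! 0)" "recursive 3 (\<lambda>xs. xs ! 1)" "recursive 3 (\<lambda>xs. xs ! 2)"
  by (auto intro: recursive.proj)

section \<open>Arithmetic of natural numbers\<close>

lemma recursive_add: "recursive 2 (\<lambda>xs. xs ! 0 + xs ! 1)"
proof -
  have "rec_nat b (\<lambda>k r. Suc r) a = a + b" for a b :: nat
    by (induction a) auto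
  then show ?thesis
    using recursive_rec_nat[of "\<lambda>x. x" "\<lambda>k r x. Suc r"] by (simp del: One_nat_def add: recursive_Suc)
qed

lemma recursive_mult: "recursive 2 (\<lambda>xs. xs ! 0 * xs ! 1)"
proof -
  have "rec_nat 0 (\<lambda>k r. r + b) a = a * b" for a b :: nat
    by (induction a) auto
  then show ?thesis
    using recursive_rec_nat[of "\<lambda>x. 0" "\<lambda>k r x. r + x"]
    by (simp del: One_nat_def add: recursive.zero recursive_comp2[OF recursive_add])
qed

lemma recursive_pred: "recursive 1 (\<lambda>xs. xs ! 0 - 1)"
proof -
  have "rec_nat 0 (\<lambda>k r. k) a = a - 1" for a :: nat
    by (induction a) auto
  then have "recursive 2 (\<lambda>xs. xs ! 0 - 1)"
    using recursive_rec_nat[of "\<lambda>x. 0" "\<lambda>k r x. k"] by (simp del: One_nat_def add: recursive.zero)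
  \<comment> \<open>The recursion scheme carries a dummy parameter; feeding the same argument twice
    brings the arity back to one.\<close>
  from recursive_comp2[where f = "\<lambda>x y. x - 1", OF this recursive_nth(2) recursive_nth(2)]
  show ?thesis .
qed

lemma recursive_diff: "recursive 2 (\<lambda>xs. xs ! 0 - xs ! 1)"
proof -
  have "rec_nat b (\<lambda>k r. r - 1) a = b - a" for a b :: nat
    by (induction a) auto
  then have "recursive 2 (\<lambda>xs. xs ! 1 - xs ! 0)"
    using recursive_rec_nat[of "\<lambda>x. x" "\<lambda>k r x. r - 1"] by (simp del: One_nat_def add: recursive_comp1[OF recursive_pred, simplified])
  \<comment> \<open>The recursion runs on the subtrahend, so the arguments come out swapped.\<close>
  from recursive_comp2[where f = "\<lambda>x y. y - x", OF this recursive_nth(4) recursive_nth(3)]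
  show ?thesis .
qed

lemma recursive_triangle: "recursive 1 (\<lambda>xs. triangle (xs ! 0))"
proof -
  have "rec_nat 0 (\<lambda>k r. r + Suc k) a = triangle a" for a :: nat
    by (induction a) auto
  then have "recursive 2 (\<lambda>xs. triangle (xs ! 0))"
    using recursive_rec_nat[of "\<lambda>x. 0" "\<lambda>k r x. r + Suc k"]
      recursive_comp2[OF recursive_add recursive_nth(6) recursive_Suc[OF recursive_nth(5)]]
    by (simp del: One_nat_def add: recursive.zero)
  from recursive_comp2[where f = "\<lambda>x y. triangle x", OF this recursive_nth(2) recursive_nth(2)]
  show ?thesis .
qed

section \<open>Cantor's pairing function and its inverse\<close>

lemma recursive_prod_encode: "recursive 2 (\<lambda>xs. prod_encode (xs ! 0, xs ! 1))"
  using recursive_comp2[OF recursive_add recursive_comp1[OF recursive_triangle recursive_add] recursive_nth(3)]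
  by (simp del: One_nat_def add: prod_encode_def)

text \<open>The pair (a, b) has the code \<open>triangle (a + b) + a\<close>, so its diagonal a + b
  is the least s with z < \<open>triangle (Suc s)\<close>. With truncated subtraction this
  inequality becomes an equation with 0, the shape that the rule \<open>mini\<close>
  expects.\<close>

lemma prod_decode_eq_LEAST:
  fixes z :: nat
  defines "s \<equiv> LEAST s. Suc z - triangle (Suc s) = 0"
  shows "prod_decode z = (z - triangle s, s - (z - triangle s))"
proof -
  obtain a b where ab: "prod_decode z = (a, b)" by fastforce
  then have z: "z = triangle (a + b) + a"
    using prod_decode_inverse[of z] by (simp add: prod_encode_def)
  have mono: "triangle i \<le> triangle j" if "i \<le> j" for i j
    using that by (induction j) (auto simp: le_Suc_eq)
  have "s = a + b"
    unfolding s_def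
  proof (rule Least_equality)
    show "Suc z - triangle (Suc (a + b)) = 0" using z by simp
    fix t assume t: "Suc z - triangle (Suc t) = 0"
    show "a + b \<le> t"
    proof (rule ccontr)
      assume "\<not> a + b \<le> t"
      then have "triangle (Suc t) \<le> triangle (a + b)" by (intro mono) auto
      then show False using t z by simp
    qed
  qed
  then show ?thesis using ab z by simp
qed

lemma recursive_prod_decode:
  "recursive 1 (\<lambda>xs. fst (prod_decode (xs ! 0)))" "recursive 1 (\<lambda>xs. snd (prod_decode (xs ! 0)))"
proof -
  define s where "s z = (LEAST s. Suc z - triangle (Suc s) = 0)" for z
  have d: "recursive 2 (\<lambda>xs. Suc (xs ! 1) - triangle (Suc (xs ! 0)))"
    by (intro recursive_comp2[OF recursive_diff] recursive_comp1[OF recursive_triangle] recursive_Suc recursive_nth)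
  have "\<exists>y. Suc z - triangle (Suc y) = 0" for z
    by (rule exI[of _ z]) (induction z, auto)
  then have "recursive 1 (\<lambda>xs. LEAST y. Suc ((y # xs) ! 1) - triangle (Suc ((y # xs) ! 0)) = 0)"
    using d by (intro recursive.mini) (auto simp: numeral_2_eq_2)
  then have s: "recursive 1 (\<lambda>xs. s (xs ! 0))" by (simp add: s_def)
  have f: "recursive 1 (\<lambda>xs. xs ! 0 - triangle (s (xs ! 0)))"
    by (intro recursive_comp2[OF recursive_diff] recursive_comp1[OF recursive_triangle] s recursive_nth)
  then show "recursive 1 (\<lambda>xs. fst (prod_decode (xs ! 0)))"
    by (simp add: prod_decode_eq_LEAST s_def)
  have "recursive 1 (\<lambda>xs. s (xs ! 0) - (xs ! 0 - triangle (s (xs ! 0))))"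
    by (intro recursive_comp2[OF recursive_diff] f s)
  then show "recursive 1 (\<lambda>xs. snd (prod_decode (xs ! 0)))"
    by (simp add: prod_decode_eq_LEAST s_def)
qed

text \<open>Encodings are bijective, so that every number is the code of an input.\<close>

class coded =
  fixes enc :: "'a \<Rightarrow> nat"
  assumes bij_enc: "bij enc"

definition dec :: "nat \<Rightarrow> 'a::coded" where
  "dec = inv_into UNIV enc"

lemma dec_enc [simp]: "dec (enc x) = x"
  by (simp add: dec_def bij_enc bij_is_inj)

lemma enc_dec [simp]: "enc (dec n :: 'a::coded) = n"
  by (simp add: dec_def bij_enc bij_is_surj surj_f_inv_f)

lemma enc_eq_iff: "enc x = enc y \<longleftrightarrow> x = y"
  by (metis dec_enc)

instantiation nat :: coded
begin
definition enc_nat :: "nat \<Rightarrow> nat" where "enc_nat n = n"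
instance by standard (simp add: enc_nat_def[abs_def] bij_id[unfolded id_def])
end

instantiation int :: coded
begin
definition enc_int :: "int \<Rightarrow> nat" where "enc_int = int_encode"
instance by standard (simp add: enc_int_def bij_int_encode)
end

instantiation prod :: (coded, coded) coded
begin
definition enc_prod :: "'a \<times> 'b \<Rightarrow> nat" where "enc_prod p = prod_encode (enc (fst p), enc (snd p))"
instance
  by standard (rule o_bij[where g = "\<lambda>n. map_prod dec dec (prod_decode n)"],
    auto simp: enc_prod_def fun_eq_iff map_prod_def split: prod.splits intro: prod_decode_inverse[THEN subst])
end

instantiation list :: (coded) coded
begin
definition enc_list :: "'a list \<Rightarrow> nat" where "enc_list xs = list_encode (map enc xs)"
instance
  by standard (rule o_bij[where g = "\<lambda>n. map dec (list_decode n)"], auto simp: enc_list_def fun_eq_iff o_def)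
end

instantiation vec :: (coded) coded
begin
definition enc_vec :: "'a vec \<Rightarrow> nat" where "enc_vec v = enc (list_of_vec v)"
instance
  by standard (rule o_bij[where g = "\<lambda>n. vec_of_list (dec n)"], auto simp: enc_vec_def fun_eq_iff vec_list list_vec)
end

lemma enc_nat [simp]: "enc (n :: nat) = n"
  by (simp add: enc_nat_def)

lemma dec_nat [simp]: "dec n = (n :: nat)"
  by (metis enc_nat enc_dec)

lemma dec_prod_encode: "dec (prod_encode (a, b)) = (dec a, dec b)"
  by (rule enc_eq_iff[THEN iffD1], subst enc_dec) (simp add: enc_prod_def)

text \<open>Arity one is enough because products are coded. Rules about functions with parameters
  therefore state their hypothesis for the uncurried function, in terms of \<open>fst p\<close> and
  \<open>snd p\<close>.\<close>

definition computable :: "('a::coded \<Rightarrow> 'b::coded) \<Rightarrow> bool" where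
  "computable f \<longleftrightarrow> recursive 1 (\<lambda>xs. enc (f (dec (xs ! 0))))"

named_theorems computable_intros

lemma computable_recursive1:
  assumes "recursive 1 (\<lambda>xs. F (xs ! 0))" and "computable f" and "\<And>x. enc (g x) = F (enc (f x))"
  shows "computable g"
  using recursive_comp1[OF assms(1) assms(2)[unfolded computable_def]] assms(3)
  by (simp add: computable_def)

lemma computable_recursive2:
  assumes "recursive 2 (\<lambda>xs. F (xs ! 0) (xs ! 1))" and "computable f" and "computable g"
    and "\<And>x. enc (h x) = F (enc (f x)) (enc (g x))"
  shows "computable h"
  using recursive_comp2[OF assms(1) assms(2,3)[unfolded computable_def]] assms(4)
  by (simp add: computable_def)

lemma computable_id [computable_intros]: "computable (\<lambda>x. x)"
  by (simp add: computable_def)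

lemma recursive_const: "recursive n (\<lambda>xs. c)"
  by (induction c) (simp_all add: recursive.zero recursive_Suc)

lemma computable_const [computable_intros]: "computable (\<lambda>x. c)"
  by (simp add: computable_def recursive_const)

lemma computable_comp: "computable g \<Longrightarrow> computable f \<Longrightarrow> computable (\<lambda>x. g (f x))"
  by (rule computable_recursive1[of "\<lambda>n. enc (g (dec n))" f]) (simp_all add: computable_def)

lemma computable_fst [computable_intros]: "computable f \<Longrightarrow> computable (\<lambda>x. fst (f x))"
  by (rule computable_recursive1[OF recursive_prod_decode(1)], assumption) (simp add: enc_prod_def)

lemma computable_snd [computable_intros]: "computable f \<Longrightarrow> computable (\<lambda>x. snd (f x))"
  by (rule computable_recursive1[OF recursive_prod_decode(2)], assumption) (simp add: enc_prod_def)

lemma computable_Pair [computable_intros]: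
  "computable f \<Longrightarrow> computable g \<Longrightarrow> computable (\<lambda>x. (f x, g x))"
  by (rule computable_recursive2[OF recursive_prod_encode], assumption+) (simp add: enc_prod_def)

lemma computable_uncurry:
  assumes "computable (\<lambda>p. h (fst p) (snd p))" and "computable f" and "computable g"
  shows "computable (\<lambda>x. h (f x) (g x))"
  using computable_comp[OF assms(1) computable_Pair[OF assms(2,3)]] by simp

lemma computable_Suc [computable_intros]: "computable f \<Longrightarrow> computable (\<lambda>x. Suc (f x))"
  by (rule computable_recursive1[OF recursive.succ]) auto

lemma computable_arith_nat [computable_intros]:
  fixes f g :: "'a::coded \<Rightarrow> nat"
  assumes "computable f" and "computable g"
  shows "computable (\<lambda>x. f x + g x)" and "computable (\<lambda>x. f x * g x)" and "computable (\<lambda>x. f x - g x)"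
  by (rule computable_recursive2[OF recursive_add assms] computable_recursive2[OF recursive_mult assms]
      computable_recursive2[OF recursive_diff assms], simp)+

lemma computable_rec_nat [computable_intros]:
  fixes f :: "'a::coded \<Rightarrow> 'b::coded"
  assumes f: "computable f" and g: "computable (\<lambda>p. g (fst p) (fst (snd p)) (snd (snd p)))"
    and n: "computable n"
  shows "computable (\<lambda>x. rec_nat (f x) (g x) (n x))"
proof -
  let ?G = "\<lambda>n. enc ((\<lambda>p. g (fst p) (fst (snd p)) (snd (snd p))) (dec n))"
  have "recursive 3 (\<lambda>xs. prod_encode (xs ! 2, prod_encode (xs ! 0, xs ! 1)))"
    by (intro recursive_comp2[OF recursive_prod_encode] recursive_nth)
  from recursive_comp1[where f = ?G, OF g[unfolded computable_def] this]
  have g': "recursive 3 (\<lambda>xs. enc (g (dec (xs ! 2)) (xs ! 0) (dec (xs ! 1))))"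
    by (simp add: dec_prod_encode)
  have rec_enc: "rec_nat (enc (f x)) (\<lambda>k r. enc (g x k (dec r))) m = enc (rec_nat (f x) (g x) m)" for x m
    by (induction m) auto
  have "recursive 2 (\<lambda>xs. enc (rec_nat (f (dec (xs ! 1))) (g (dec (xs ! 1))) (xs ! 0)))"
    using recursive_rec_nat[where f = "\<lambda>n. enc (f (dec n))" and g = "\<lambda>k r x. enc (g (dec x) k (dec r))",
        OF f[unfolded computable_def] g']
    unfolding rec_enc .
  then show ?thesis
    by (rule computable_recursive2[where F = "\<lambda>k x. enc (rec_nat (f (dec x)) (g (dec x)) k)", OF _ n computable_id])
      simp
qed

lemma computable_LEAST [computable_intros]:
  fixes f :: "'a::coded \<Rightarrow> nat \<Rightarrow> nat"
  assumes f: "computable (\<lambda>p. f (fst p) (snd p))" and ex: "\<And>x. \<exists>y. f x y = 0"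
  shows "computable (\<lambda>x. LEAST y. f x y = 0)"
proof -
  let ?F = "\<lambda>n. enc ((\<lambda>p. f (fst p) (snd p)) (dec n))"
  have "recursive 2 (\<lambda>xs. prod_encode (xs ! 1, xs ! 0))"
    by (intro recursive_comp2[OF recursive_prod_encode] recursive_nth)
  from recursive_comp1[where f = ?F, OF f[unfolded computable_def] this]
  have "recursive (Suc 1) (\<lambda>xs. f (dec (xs ! 1)) (xs ! 0))"
    by (simp add: numeral_2_eq_2 dec_prod_encode)
  from recursive.mini[OF this] show ?thesis
    using ex by (simp add: computable_def)
qed

text \<open>\<open>enc\<close> is the identity on \<open>nat\<close>, so computability of a function
  into any coded type can be argued for its code as a number.\<close>

lemma computable_enc_iff: "computable (\<lambda>x. enc (f x)) \<longleftrightarrow> computable f"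
  by (simp add: computable_def)

lemma computable_encI [computable_intros]: "computable f \<Longrightarrow> computable (\<lambda>x. enc (f x))"
  by (simp add: computable_enc_iff)

lemma computable_dec [computable_intros]: "computable f \<Longrightarrow> computable (\<lambda>x. dec (f x))"
  by (simp add: computable_def)

section \<open>Decidable predicates\<close>

definition decidable :: "('a::coded \<Rightarrow> bool) \<Rightarrow> bool" where
  "decidable P \<longleftrightarrow> computable (\<lambda>x. of_bool (P x) :: nat)"

lemma decidable_computable:
  fixes f :: "'a::coded \<Rightarrow> nat"
  assumes "computable f" and "\<And>x. f x = of_bool (P x)"
  shows "decidable P"
  using assms(1) unfolding assms(2) decidable_def .

lemma decidable_comp: "decidable P \<Longrightarrow> computable f \<Longrightarrow> decidable (\<lambda>x. P (f x))"
  unfolding decidable_def by (rule computable_comp)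

lemma decidable_not [computable_intros]: "decidable P \<Longrightarrow> decidable (\<lambda>x. \<not> P x)"
  by (rule decidable_computable[of "\<lambda>x. 1 - of_bool (P x)"], unfold decidable_def)
    (intro computable_intros, auto)

lemma decidable_conj [computable_intros]:
  "decidable P \<Longrightarrow> decidable Q \<Longrightarrow> decidable (\<lambda>x. P x \<and> Q x)"
  by (rule decidable_computable[of "\<lambda>x. of_bool (P x) * of_bool (Q x)"], unfold decidable_def)
    (intro computable_intros, auto)

lemma decidable_disj [computable_intros]:
  "decidable P \<Longrightarrow> decidable Q \<Longrightarrow> decidable (\<lambda>x. P x \<or> Q x)"
  using decidable_not[OF decidable_conj[OF decidable_not decidable_not, of P Q]] by simp

lemma decidable_le_nat [computable_intros]:
  fixes f g :: "'a::coded \<Rightarrow> nat"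
  assumes "computable f" and "computable g"
  shows "decidable (\<lambda>x. f x \<le> g x)"
  by (rule decidable_computable[of "\<lambda>x. 1 - (f x - g x)"]) (intro computable_intros assms, auto)

lemma decidable_less_nat [computable_intros]:
  fixes f g :: "'a::coded \<Rightarrow> nat"
  assumes "computable f" and "computable g"
  shows "decidable (\<lambda>x. f x < g x)"
  unfolding Suc_le_eq[symmetric] by (intro computable_intros assms)

lemma decidable_eq [computable_intros]:
  fixes f g :: "'a::coded \<Rightarrow> 'b::coded"
  assumes "computable f" and "computable g"
  shows "decidable (\<lambda>x. f x = g x)"
proof -
  have "decidable (\<lambda>x. enc (f x) \<le> enc (g x) \<and> enc (g x) \<le> enc (f x))"
    by (intro computable_intros assms)
  then show ?thesis by (simp only: order_eq_iff[symmetric] enc_eq_iff)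
qed

lemma computable_If [computable_intros]:
  assumes "decidable P" and "computable f" and "computable g"
  shows "computable (\<lambda>x. if P x then f x else g x)"
proof -
  \<comment> \<open>Recursion along a counter that is 0 or 1 is a case distinction.\<close>
  have "computable (\<lambda>x. rec_nat (g x) (\<lambda>_ _. f x) (of_bool (P x)))"
    using assms(1) unfolding decidable_def
    by (intro computable_rec_nat assms(3)) (intro computable_comp[OF assms(2)] computable_intros, assumption)
  moreover have "rec_nat (g x) (\<lambda>_ _. f x) (of_bool (P x)) = (if P x then f x else g x)" for x
    by auto
  ultimately show ?thesis by simp
qed

lemma decidable_All_less [computable_intros]:
  fixes P :: "'a::coded \<Rightarrow> nat \<Rightarrow> bool"
  assumes P: "decidable (\<lambda>p. P (fst p) (snd p))" and n: "computable n"
  shows "decidable (\<lambda>x. \<forall>i<n x. P x i)"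
proof -
  have "computable (\<lambda>x. rec_nat (1::nat) (\<lambda>i r. if P x i then r else 0) (n x))"
    using decidable_comp[OF P computable_Pair[OF computable_fst[OF computable_id]
        computable_fst[OF computable_snd[OF computable_id]]]]
    by (intro computable_intros n) simp
  moreover have "rec_nat (1::nat) (\<lambda>i r. if P x i then r else 0) m = of_bool (\<forall>i<m. P x i)" for x m
    by (induction m) (auto simp: less_Suc_eq)
  ultimately show ?thesis by (simp add: decidable_def)
qed

lemma decidable_Ex_less [computable_intros]:
  fixes P :: "'a::coded \<Rightarrow> nat \<Rightarrow> bool"
  assumes P: "decidable (\<lambda>p. P (fst p) (snd p))" and n: "computable n"
  shows "decidable (\<lambda>x. \<exists>i<n x. P x i)"
  using decidable_not[OF decidable_All_less[OF decidable_not[OF P] n]] by simp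

lemma computable_Least [computable_intros]:
  fixes P :: "'a::coded \<Rightarrow> nat \<Rightarrow> bool"
  assumes P: "decidable (\<lambda>p. P (fst p) (snd p))" and ex: "\<And>x. \<exists>y. P x y"
  shows "computable (\<lambda>x. LEAST y. P x y)"
proof -
  have "computable (\<lambda>x. LEAST y. (1::nat) - of_bool (P x y) = 0)"
    by (intro computable_LEAST computable_arith_nat(3) computable_const P[unfolded decidable_def])
      (use ex in \<open>auto simp: of_bool_def\<close>)
  moreover have "(1::nat) - of_bool (P x y) = 0 \<longleftrightarrow> P x y" for x y
    by auto
  ultimately show ?thesis by (simp only:)
qed

section \<open>Computable operations on lists, integers and vectors\<close>

lemma enc_Nil [simp]: "enc [] = 0"
  by (simp add: enc_list_def)

lemma enc_Cons [simp]: "enc (x # xs) = Suc (prod_encode (enc x, enc xs))"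
  by (simp add: enc_list_def)

text \<open>Makes the list operations total: \<open>[]\<close> has code 0, and
  \<open>0 - 1 = 0\<close> decodes to a pair of zeros, so that the tail of \<open>[]\<close> is
  again \<open>[]\<close> and its head is the default \<open>dec 0\<close> of
  \<open>nth0\<close>.\<close>

lemma dec_0_prod: "dec 0 = (dec 0, dec 0)"
  using dec_prod_encode[of 0 0] by (simp add: prod_encode_def)

lemma computable_Cons [computable_intros]:
  assumes "computable f" and "computable g"
  shows "computable (\<lambda>x. f x # g x)"
proof -
  have "computable (\<lambda>x. enc (f x # g x))"
    unfolding enc_Cons by (rule computable_Suc, rule computable_recursive2[OF recursive_prod_encode assms]) simp
  then show ?thesis by (simp only: computable_enc_iff)
qed

lemma computable_tl [computable_intros]:
  assumes "computable f"
  shows "computable (\<lambda>x. tl (f x))"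
proof -
  have "enc (tl xs) = snd (dec (enc xs - 1) :: nat \<times> nat)" for xs :: "'b list"
    by (cases xs) (simp_all add: dec_prod_encode dec_0_prod)
  then have "computable (\<lambda>x. enc (tl (f x)))"
    by (simp only:) (intro computable_intros assms)
  then show ?thesis by (simp only: computable_enc_iff)
qed

lemma computable_drop [computable_intros]:
  assumes "computable f" and "computable n"
  shows "computable (\<lambda>x. drop (n x) (f x))"
proof -
  have "rec_nat xs (\<lambda>_. tl) i = drop i xs" for xs :: "'b list" and i
    by (induction i) (simp_all add: drop_Suc tl_drop)
  moreover have "computable (\<lambda>x. rec_nat (f x) (\<lambda>_. tl) (n x))"
    by (intro computable_intros assms)
  ultimately show ?thesis by simp
qed

abbreviation nth0 :: "'a::coded list \<Rightarrow> nat \<Rightarrow> 'a" where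
  "nth0 \<equiv> nth_default (dec 0)"

lemma computable_nth0 [computable_intros]:
  assumes "computable f" and "computable n"
  shows "computable (\<lambda>x. nth0 (f x) (n x))"
proof -
  have "enc (nth0 xs 0) = fst (dec (enc xs - 1) :: nat \<times> nat)" for xs :: "'b list"
    by (cases xs) (simp_all add: dec_prod_encode dec_0_prod)
  then have "enc (nth0 xs i) = fst (dec (enc (drop i xs) - 1) :: nat \<times> nat)" for xs :: "'b list" and i
    by (metis (no_types) nth_default_def hd_drop_conv_nth hd_conv_nth length_drop zero_less_diff length_greater_0_conv)
  then have "computable (\<lambda>x. enc (nth0 (f x) (n x)))"
    by (simp only:) (intro computable_intros assms)
  then show ?thesis by (simp only: computable_enc_iff)
qed

lemma computable_length [computable_intros]:
  assumes "computable f"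
  shows "computable (\<lambda>x. length (f x))"
proof -
  have "length (f x) = (LEAST i. drop i (f x) = [])" for x
    by (rule Least_equality[symmetric]) auto
  moreover have "\<exists>i. drop i (f x) = []" for x
    by (rule exI[of _ "length (f x)"]) simp
  then have "computable (\<lambda>x. LEAST i. drop i (f x) = [])"
    by (intro computable_intros computable_comp[OF assms])
  ultimately show ?thesis by simp
qed

lemma computable_map_upt [computable_intros]:
  assumes f: "computable (\<lambda>p. f (fst p) (snd p))" and n: "computable n"
  shows "computable (\<lambda>x. map (f x) [0..<n x])"
proof -
  \<comment> \<open>Lists grow at the front, so the entries are produced in reverse order: stage k
    prepends the entry with index \<open>n x - 1 - k\<close>.\<close>
  have *: "computable (\<lambda>x. rec_nat [] (\<lambda>k r. f x (n x - 1 - k) # r) (n x))"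
    by (intro computable_intros n computable_uncurry[OF f] computable_comp[OF n])
  have "rec_nat [] (\<lambda>k r. g (m - 1 - k) # r) l = map g [m - l..<m]" if "l \<le> m" for g :: "nat \<Rightarrow> 'b" and l m
    using that
  proof (induction l)
    case (Suc l)
    then have "[m - Suc l..<m] = (m - 1 - l) # [m - l..<m]"
      using upt_conv_Cons[of "m - Suc l" m] by (simp add: Suc_diff_Suc)
    with Suc show ?case by simp
  qed simp
  from this[of "n _" "n _"] * show ?thesis by simp
qed

section \<open>Arithmetic of integers through their codes\<close>

lemma computable_div2 [computable_intros]:
  fixes f :: "'a::coded \<Rightarrow> nat"
  assumes "computable f"
  shows "computable (\<lambda>x. f x div 2)"
proof -
  have "f x div 2 = (LEAST y. f x \<le> Suc (2 * y))" for x
    by (rule Least_equality[symmetric]) auto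
  moreover have "\<exists>y. f x \<le> Suc (2 * y)" for x
    by (rule exI[of _ "f x"]) simp
  then have "computable (\<lambda>x. LEAST y. f x \<le> Suc (2 * y))"
    by (intro computable_intros computable_comp[OF assms])
  ultimately show ?thesis by simp
qed

lemma decidable_even [computable_intros]:
  fixes f :: "'a::coded \<Rightarrow> nat"
  assumes "computable f"
  shows "decidable (\<lambda>x. even (f x))"
proof -
  have "even n \<longleftrightarrow> 2 * (n div 2) = n" for n :: nat by presburger
  then show ?thesis
    by (simp only:) (intro computable_intros assms)
qed

lemma computable_nat [computable_intros]:
  assumes "computable f"
  shows "computable (\<lambda>x. nat (f x))"
proof -
  \<comment> \<open>\<open>int_encode\<close> sends i \<ge> 0 to 2 i and i < 0 to 2 (- i - 1) +
    1.\<close>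
  have "nat i = (if even (enc i) then enc i div 2 else 0)" for i :: int
    unfolding enc_int_def int_encode_def sum_encode_def by (cases "0 \<le> i") simp_all
  then show ?thesis
    by (simp only:) (intro computable_intros assms)
qed

lemma computable_nat_uminus:
  assumes "computable f"
  shows "computable (\<lambda>x. nat (- f x))"
proof -
  have "nat (- i) = (if even (enc i) then 0 else Suc (enc i div 2))" for i :: int
    unfolding enc_int_def int_encode_def sum_encode_def by (cases "0 \<le> i") simp_all
  then show ?thesis
    by (simp only:) (intro computable_intros assms)
qed

text \<open>An integer is split into its positive part \<open>nat i\<close> and its negative part
  \<open>nat (- i)\<close>. Sums and products of integers then become differences of natural
  numbers, which this lemma turns back into integers.\<close>

lemma computable_int_diff:
  assumes "computable a" and "computable b"
  shows "computable (\<lambda>x. int (a x) - int (b x))"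
proof -
  have "enc (int i - int j) = (if j \<le> i then 2 * (i - j) else Suc (2 * (j - i - 1)))" for i j
  proof (cases "j \<le> i")
    case True
    then have "int i - int j = int (i - j)" by simp
    then show ?thesis using True unfolding enc_int_def int_encode_def sum_encode_def by simp
  next
    case False
    then have "int i - int j < 0" "nat (- (int i - int j) - 1) = j - i - 1" by arith+
    then show ?thesis using False unfolding enc_int_def int_encode_def sum_encode_def by simp
  qed
  then have "computable (\<lambda>x. enc (int (a x) - int (b x)))"
    by (simp only:) (intro computable_intros assms)
  then show ?thesis by (simp only: computable_enc_iff)
qed

lemma computable_add_int [computable_intros]:
  fixes f g :: "'a::coded \<Rightarrow> int"
  assumes "computable f" and "computable g"
  shows "computable (\<lambda>x. f x + g x)"
proof -
  have "i + j = int (nat i + nat j) - int (nat (- i) + nat (- j))" for i j by linarith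
  then show ?thesis
    by (simp only:) (intro computable_int_diff computable_intros computable_nat_uminus assms)
qed

lemma computable_mult_int [computable_intros]:
  fixes f g :: "'a::coded \<Rightarrow> int"
  assumes "computable f" and "computable g"
  shows "computable (\<lambda>x. f x * g x)"
proof -
  have "i * j = int (nat i * nat j + nat (- i) * nat (- j)) - int (nat i * nat (- j) + nat (- i) * nat j)" for i j
    by (cases "i \<ge> 0"; cases "j \<ge> 0") (auto simp: algebra_simps)
  then show ?thesis
    by (simp only:) (intro computable_int_diff computable_intros computable_nat_uminus assms)
qed

lemma computable_uminus_int [computable_intros]:
  fixes f :: "'a::coded \<Rightarrow> int"
  assumes "computable f"
  shows "computable (\<lambda>x. - f x)"
  using computable_mult_int[OF computable_const[of "-1"] assms] by simp

lemma decidable_le_int [computable_intros]: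
  fixes f g :: "'a::coded \<Rightarrow> int"
  assumes "computable f" and "computable g"
  shows "decidable (\<lambda>x. f x \<le> g x)"
proof -
  have "i \<le> j \<longleftrightarrow> nat (i + - j) = 0" for i j :: int by simp
  then show ?thesis
    by (simp only:) (intro computable_intros assms)
qed

lemma decidable_less_int [computable_intros]:
  fixes f g :: "'a::coded \<Rightarrow> int"
  assumes "computable f" and "computable g"
  shows "decidable (\<lambda>x. f x < g x)"
  unfolding not_le[symmetric] by (intro computable_intros assms)

lemma computable_sum_int [computable_intros]:
  fixes f :: "'a::coded \<Rightarrow> nat \<Rightarrow> int"
  assumes f: "computable (\<lambda>p. f (fst p) (snd p))" and n: "computable n"
  shows "computable (\<lambda>x. \<Sum>i<n x. f x i)"
proof -
  have "computable (\<lambda>x. rec_nat 0 (\<lambda>i r. r + f x i) (n x))"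
    by (intro computable_intros n computable_uncurry[OF f])
  moreover have "rec_nat 0 (\<lambda>i r. r + f x i) m = (\<Sum>i<m. f x i)" for x m
    by (induction m) auto
  ultimately show ?thesis by simp
qed

lemma computable_list_of_vec [computable_intros]: "computable f \<Longrightarrow> computable (\<lambda>x. list_of_vec (f x))"
  by (simp add: computable_def enc_vec_def)

lemma computable_dim_vec [computable_intros]: "computable f \<Longrightarrow> computable (\<lambda>x. dim_vec (f x))"
  unfolding length_list_of_vec[symmetric] by (intro computable_intros)

lemma computable_vec [computable_intros]:
  assumes f: "computable (\<lambda>p. f (fst p) (snd p))" and n: "computable n"
  shows "computable (\<lambda>x. vec (n x) (f x))"
proof -
  have "list_of_vec (vec m g) = map g [0..<m]" for m and g :: "nat \<Rightarrow> 'b"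
    by (rule nth_equalityI) auto
  then show ?thesis
    using computable_map_upt[OF assms] by (simp add: computable_def enc_vec_def)
qed

section \<open>Semidecidable predicates\<close>

definition semidecidable :: "('a::coded \<Rightarrow> bool) \<Rightarrow> bool" where
  "semidecidable P \<longleftrightarrow>
     (\<exists>Q. decidable (\<lambda>p. Q (fst p) (snd p)) \<and> (\<forall>x. P x \<longleftrightarrow> (\<exists>y :: nat. Q x y)))"

named_theorems semidecidable_intros

lemma decidable_uncurry:
  assumes "decidable (\<lambda>p. P (fst p) (snd p))" and "computable f" and "computable g"
  shows "decidable (\<lambda>x. P (f x) (g x))"
  using decidable_comp[OF assms(1) computable_Pair[OF assms(2,3)]] by simp

lemma semidecidable_ExI:
  fixes Q :: "'a::coded \<Rightarrow> 'b::coded \<Rightarrow> bool"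
  assumes "decidable (\<lambda>p. Q (fst p) (snd p))" and "\<And>x. P x \<longleftrightarrow> (\<exists>y. Q x y)"
  shows "semidecidable P"
  unfolding semidecidable_def
proof (intro exI conjI allI)
  show "decidable (\<lambda>p. Q (fst p) (dec (snd p)))"
    by (intro decidable_uncurry[OF assms(1)] computable_intros)
  show "P x \<longleftrightarrow> (\<exists>y. Q x (dec y))" for x
    unfolding assms(2) by (metis dec_enc)
qed

lemma semidecidableE:
  assumes "semidecidable P"
  obtains Q :: "'a::coded \<Rightarrow> nat \<Rightarrow> bool"
  where "decidable (\<lambda>p. Q (fst p) (snd p))" and "\<And>x. P x \<longleftrightarrow> (\<exists>y. Q x y)"
  using assms unfolding semidecidable_def by blast

lemma semidecidable_comp:
  assumes "semidecidable P" and "computable f"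
  shows "semidecidable (\<lambda>x. P (f x))"
  using assms(1)
proof (rule semidecidableE)
  fix Q assume Q: "decidable (\<lambda>p. Q (fst p) (snd p :: nat))" "\<And>x. P x \<longleftrightarrow> (\<exists>y. Q x y)"
  show ?thesis
    by (rule semidecidable_ExI[of "\<lambda>x. Q (f x)"])
      (intro decidable_uncurry[OF Q(1)] computable_comp[OF assms(2)] computable_intros, rule Q(2))
qed

lemma semidecidable_uncurry:
  assumes "semidecidable (\<lambda>p. P (fst p) (snd p))" and "computable f" and "computable g"
  shows "semidecidable (\<lambda>x. P (f x) (g x))"
  using semidecidable_comp[OF assms(1) computable_Pair[OF assms(2,3)]] by simp

lemma decidable_semidecidable:
  assumes "decidable P"
  shows "semidecidable P"
  by (rule semidecidable_ExI[of "\<lambda>x (y :: nat). P x"])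
    (intro decidable_comp[OF assms] computable_intros, simp)

lemma semidecidable_conj [semidecidable_intros]:
  assumes "semidecidable P" and "semidecidable Q"
  shows "semidecidable (\<lambda>x. P x \<and> Q x)"
proof -
  obtain P' where P': "decidable (\<lambda>p. P' (fst p) (snd p))" "\<And>x. P x \<longleftrightarrow> (\<exists>y :: nat. P' x y)"
    using semidecidableE[OF assms(1)] by metis
  obtain Q' where Q': "decidable (\<lambda>p. Q' (fst p) (snd p))" "\<And>x. Q x \<longleftrightarrow> (\<exists>y :: nat. Q' x y)"
    using semidecidableE[OF assms(2)] by metis
  show ?thesis
    by (rule semidecidable_ExI[of "\<lambda>x y. P' x (fst y) \<and> Q' x (snd y)"])
      (intro decidable_conj decidable_uncurry[OF P'(1)] decidable_uncurry[OF Q'(1)] computable_intros,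
        simp add: P'(2) Q'(2))
qed

lemma semidecidable_disj [semidecidable_intros]:
  assumes "semidecidable P" and "semidecidable Q"
  shows "semidecidable (\<lambda>x. P x \<or> Q x)"
proof -
  obtain P' where P': "decidable (\<lambda>p. P' (fst p) (snd p))" "\<And>x. P x \<longleftrightarrow> (\<exists>y :: nat. P' x y)"
    using semidecidableE[OF assms(1)] by metis
  obtain Q' where Q': "decidable (\<lambda>p. Q' (fst p) (snd p))" "\<And>x. Q x \<longleftrightarrow> (\<exists>y :: nat. Q' x y)"
    using semidecidableE[OF assms(2)] by metis
  show ?thesis
    by (rule semidecidable_ExI[of "\<lambda>x y. P' x y \<or> Q' x y"])
      (intro decidable_disj decidable_uncurry[OF P'(1)] decidable_uncurry[OF Q'(1)] computable_intros,
        auto simp: P'(2) Q'(2))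
qed

lemma semidecidable_Ex [semidecidable_intros]:
  fixes P :: "'a::coded \<Rightarrow> 'b::coded \<Rightarrow> bool"
  assumes "semidecidable (\<lambda>p. P (fst p) (snd p))"
  shows "semidecidable (\<lambda>x. \<exists>y. P x y)"
  using assms
proof (rule semidecidableE)
  fix Q assume Q: "decidable (\<lambda>p. Q (fst p) (snd p :: nat))" "\<And>p. P (fst p) (snd p) \<longleftrightarrow> (\<exists>z. Q p z)"
  show ?thesis
    by (rule semidecidable_ExI[of "\<lambda>x y. Q (x, fst y) (snd y)"])
      (intro decidable_uncurry[OF Q(1)] computable_intros, use Q(2) in force)
qed

text \<open>Finitely many witnesses have a common bound b, for instance one more than their sum.
  Searching for b alone leaves only bounded quantifiers over a decidable relation.\<close>

lemma semidecidable_All_less: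
  fixes P :: "'a::coded \<Rightarrow> nat \<Rightarrow> bool"
  assumes "semidecidable (\<lambda>p. P (fst p) (snd p))" and n: "computable n"
  shows "semidecidable (\<lambda>x. \<forall>i<n x. P x i)"
  using assms(1)
proof (rule semidecidableE)
  fix Q assume Q: "decidable (\<lambda>p. Q (fst p) (snd p :: nat))" "\<And>p. P (fst p) (snd p) \<longleftrightarrow> (\<exists>z. Q p z)"
  show ?thesis
  proof (rule semidecidable_ExI[of "\<lambda>x b. \<forall>i<n x. \<exists>z<b. Q (x, i) z"])
    show "decidable (\<lambda>p. \<forall>i<n (fst p). \<exists>z<snd p. Q (fst p, i) z)"
      by (intro decidable_All_less decidable_Ex_less decidable_uncurry[OF Q(1)] computable_comp[OF n] computable_intros)
    show "(\<forall>i<n x. P x i) \<longleftrightarrow> (\<exists>b. \<forall>i<n x. \<exists>z<b. Q (x, i) z)" (is "?l \<longleftrightarrow> ?r") for x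
    proof
      assume ?l
      then have "\<forall>i<n x. \<exists>z. Q (x, i) z" using Q(2)[of "(x, _)"] by simp
      then obtain z where z: "\<forall>i<n x. Q (x, i) (z i)" by metis
      have "\<forall>i<n x. z i < Suc (\<Sum>i<n x. z i)"
        by (auto simp: less_Suc_eq_le intro: member_le_sum)
      with z show ?r by blast
    qed (use Q(2)[of "(x, _)"] in auto)
  qed
qed

lemma semidecidable_Ex_less:
  fixes P :: "'a::coded \<Rightarrow> nat \<Rightarrow> bool"
  assumes "semidecidable (\<lambda>p. P (fst p) (snd p))" and n: "computable n"
  shows "semidecidable (\<lambda>x. \<exists>i<n x. P x i)"
  by (intro semidecidable_Ex semidecidable_conj assms(1)
      decidable_semidecidable[OF decidable_less_nat] computable_comp[OF n] computable_intros)

lemma semidecidable_Ball [semidecidable_intros]: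
  fixes P :: "'a::coded \<Rightarrow> 'b::coded \<Rightarrow> bool"
  assumes P: "semidecidable (\<lambda>p. P (fst p) (snd p))" and f: "computable f"
  shows "semidecidable (\<lambda>x. \<forall>y\<in>set (f x). P x y)"
proof -
  have "(\<forall>y\<in>set xs. R y) \<longleftrightarrow> (\<forall>i<length xs. R (nth0 xs i))" for xs and R :: "'b \<Rightarrow> bool"
    by (auto simp: all_set_conv_all_nth nth_default_def)
  then show ?thesis
    by (simp only:) (intro semidecidable_All_less semidecidable_uncurry[OF P] computable_comp[OF f] computable_intros)
qed

lemma semidecidable_Bex [semidecidable_intros]:
  fixes P :: "'a::coded \<Rightarrow> 'b::coded \<Rightarrow> bool"
  assumes P: "semidecidable (\<lambda>p. P (fst p) (snd p))" and f: "computable f"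
  shows "semidecidable (\<lambda>x. \<exists>y\<in>set (f x). P x y)"
proof -
  have "(\<exists>y\<in>set xs. R y) \<longleftrightarrow> (\<exists>i<length xs. R (nth0 xs i))" for xs and R :: "'b \<Rightarrow> bool"
    by (auto simp: nth_default_def Bex_def in_set_conv_nth)
  then show ?thesis
    by (simp only:) (intro semidecidable_Ex_less semidecidable_uncurry[OF P] computable_comp[OF f] computable_intros)
qed

text \<open>A finite chain is a single list T, so reachability becomes one existential quantifier
  over a coded type and a bounded universal one.\<close>

lemma rtranclp_iff_nth0:
  "r\<^sup>*\<^sup>* a b \<longleftrightarrow> (\<exists>T n. nth0 T 0 = a \<and> nth0 T n = b \<and> (\<forall>i<n. r (nth0 T i) (nth0 T (Suc i))))"
    (is "_ \<longleftrightarrow> ?r")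
proof
  assume "r\<^sup>*\<^sup>* a b"
  then obtain n g where g: "g 0 = a" "g n = b" "\<forall>i<n. r (g i) (g (Suc i))"
    unfolding rtranclp_power relpowp_fun_conv by blast
  have "nth0 (map g [0..<Suc n]) i = g i" if "i \<le> n" for i
    using that by (simp add: nth_default_def del: upt_Suc)
  with g show ?r
    by (intro exI[of _ "map g [0..<Suc n]"] exI[of _ n]) (auto simp del: upt_Suc)
next
  assume ?r
  then obtain T n where T: "nth0 T 0 = a" "nth0 T n = b" "\<forall>i<n. r (nth0 T i) (nth0 T (Suc i))"
    by blast
  have "(r ^^ n) a b" unfolding relpowp_fun_conv by (rule exI[of _ "nth0 T"]) (use T in simp)
  then show "r\<^sup>*\<^sup>* a b" by (rule relpowp_imp_rtranclp)
qed

lemma semidecidable_rtranclp [semidecidable_intros]: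
  assumes r: "semidecidable (\<lambda>p. r (fst p) (fst (snd p)) (snd (snd p)))"
    and a: "computable a" and b: "computable b"
  shows "semidecidable (\<lambda>x. (r x)\<^sup>*\<^sup>* (a x) (b x))"
proof -
  have r': "semidecidable (\<lambda>x. r (f x) (g x) (h x))" if "computable f" "computable g" "computable h" for f g h
    using semidecidable_comp[OF r computable_Pair[OF that(1) computable_Pair[OF that(2,3)]]] by simp
  show ?thesis
    unfolding rtranclp_iff_nth0
    by (intro semidecidable_Ex semidecidable_conj semidecidable_All_less r'
      decidable_semidecidable[OF decidable_eq] computable_comp[OF a] computable_comp[OF b] computable_intros)
qed

text \<open>The minimization runs over codes w of pairs of a value y and a witness z, since only
  \<open>Q\<close>, and not \<open>R\<close> itself, is known to be decidable. The hypothesis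
  \<open>ex\<close> makes the search total.\<close>

lemma computable_selection:
  fixes R :: "'a::coded \<Rightarrow> 'b::coded \<Rightarrow> bool"
  assumes "semidecidable (\<lambda>p. R (fst p) (snd p))" and ex: "\<And>x. \<exists>y. R x y"
  shows "\<exists>f. computable f \<and> (\<forall>x. R x (f x))"
  using assms(1)
proof (rule semidecidableE)
  fix Q assume Q: "decidable (\<lambda>p. Q (fst p) (snd p :: nat))" "\<And>p. R (fst p) (snd p) \<longleftrightarrow> (\<exists>z. Q p z)"
  define S where "S x w \<longleftrightarrow> (case dec w of (y, z) \<Rightarrow> Q (x, y :: 'b) z)" for x w
  have ex_S: "\<exists>w. S x w" for x
  proof -
    obtain y where "R x y" using ex by blast
    then obtain z where "Q (x, y) z" using Q(2)[of "(x, y)"] by auto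
    then have "S x (enc (y, z))" by (simp add: S_def)
    then show ?thesis by blast
  qed
  have "decidable (\<lambda>p. S (fst p) (snd p))"
    unfolding S_def case_prod_beta by (intro decidable_uncurry[OF Q(1)] computable_intros)
  then have "computable (\<lambda>x. fst (dec (LEAST w. S x w) :: 'b \<times> nat))"
    by (intro computable_fst computable_dec computable_Least ex_S)
  moreover have "R x (fst (dec (LEAST w. S x w) :: 'b \<times> nat))" for x
    using LeastI_ex[OF ex_S[of x]] Q(2)[of "(x, _)"] by (auto simp: S_def case_prod_beta)
  ultimately show ?thesis by (intro exI conjI allI)
qed

section \<open>Cones over ordered rings\<close>

text \<open>Over the integers this is the submonoid generated by \<open>A\<close>.\<close>

inductive_set cone_span :: "nat \<Rightarrow> 'a :: linordered_idom vec set \<Rightarrow> 'a vec set" for n A where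
  zero: "0\<^sub>v n \<in> cone_span n A"
| add: "v \<in> cone_span n A \<Longrightarrow> a \<in> A \<Longrightarrow> a \<in> carrier_vec n \<Longrightarrow> 0 \<le> r \<Longrightarrow> v + r \<cdot>\<^sub>v a \<in> cone_span n A"

lemma cone_span_carrier: "v \<in> cone_span n A \<Longrightarrow> v \<in> carrier_vec n"
  by (induction rule: cone_span.induct) auto

lemma cone_span_gen: "a \<in> A \<Longrightarrow> a \<in> carrier_vec n \<Longrightarrow> a \<in> cone_span n A"
  using cone_span.add[OF cone_span.zero, of a A n 1] by simp

lemma cone_span_plus:
  assumes "v \<in> cone_span n A" and "w \<in> cone_span n A"
  shows "v + w \<in> cone_span n A"
  using assms(2)
proof (induction rule: cone_span.induct)
  case zero
  then show ?case using assms(1) cone_span_carrier[OF assms(1)] by simp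
next
  case (add w a r)
  have "v + (w + r \<cdot>\<^sub>v a) = (v + w) + r \<cdot>\<^sub>v a"
    by (rule assoc_add_vec[symmetric])
      (use add cone_span_carrier[OF assms(1)] cone_span_carrier[OF add(1)] in auto)
  then show ?case using cone_span.add[OF add(5,2,3,4)] by simp
qed

lemma cone_span_smult:
  assumes "v \<in> cone_span n A" and "0 \<le> k"
  shows "k \<cdot>\<^sub>v v \<in> cone_span n A"
  using assms(1)
proof induction
  case zero
  have "k \<cdot>\<^sub>v 0\<^sub>v n = 0\<^sub>v n" by auto
  then show ?case using cone_span.zero by metis
next
  case (add v a r)
  have "k \<cdot>\<^sub>v (v + r \<cdot>\<^sub>v a) = k \<cdot>\<^sub>v v + (k * r) \<cdot>\<^sub>v a"
    using add(3) cone_span_carrier[OF add(1)] by (intro eq_vecI) (auto simp: algebra_simps)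
  then show ?case using cone_span.add[OF add(5,2,3)] add(4) assms(2) by simp
qed

lemma cone_span_least:
  assumes "B \<inter> carrier_vec n \<subseteq> cone_span n A"
  shows "cone_span n B \<subseteq> cone_span n A"
proof
  fix v assume "v \<in> cone_span n B"
  then show "v \<in> cone_span n A"
    by induction (use assms in \<open>auto intro: cone_span.zero cone_span_plus cone_span_smult\<close>)
qed

lemma cone_span_mono: "B \<subseteq> A \<Longrightarrow> cone_span n B \<subseteq> cone_span n A"
  by (rule cone_span_least) (auto intro: cone_span_gen)

lemma cone_span_union:
  assumes "v \<in> cone_span n (A \<union> B)"
  shows "\<exists>x\<in>cone_span n A. \<exists>y\<in>cone_span n B. v = x + y"
  using assms
proof induction
  case zero
  show ?case by (intro bexI[of _ "0\<^sub>v n"] cone_span.zero) auto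
next
  case (add v a r)
  then obtain x y where xy: "x \<in> cone_span n A" "y \<in> cone_span n B" "v = x + y" by blast
  note c = cone_span_carrier[OF xy(1)] cone_span_carrier[OF xy(2)]
  from add(2) show ?case
  proof
    assume "a \<in> A"
    then have "x + r \<cdot>\<^sub>v a \<in> cone_span n A" using xy add by (auto intro: cone_span.add)
    moreover have "v + r \<cdot>\<^sub>v a = (x + r \<cdot>\<^sub>v a) + y" using xy c add(3) by (auto simp: algebra_simps)
    ultimately show ?thesis using xy by blast
  next
    assume "a \<in> B"
    then have "y + r \<cdot>\<^sub>v a \<in> cone_span n B" using xy add by (auto intro: cone_span.add)
    moreover have "v + r \<cdot>\<^sub>v a = x + (y + r \<cdot>\<^sub>v a)" using xy c add(3) by (auto simp: algebra_simps)
    ultimately show ?thesis using xy by blast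
  qed
qed

lemma cone_span_uminus:
  assumes "v \<in> cone_span n A"
  shows "- v \<in> cone_span n (uminus ` A)"
  using assms
proof induction
  case zero
  then show ?case by (auto intro: cone_span.zero)
next
  case (add v a r)
  have "- (v + r \<cdot>\<^sub>v a) = - v + r \<cdot>\<^sub>v (- a)" using add(3) cone_span_carrier[OF add(1)] by auto
  then show ?case using add by (auto intro!: cone_span.add)
qed

lemma mult_mat_vec_smult:
  fixes M :: "'a :: comm_ring_1 mat"
  assumes "M \<in> carrier_mat n r" and "v \<in> carrier_vec r"
  shows "M *\<^sub>v (k \<cdot>\<^sub>v v) = k \<cdot>\<^sub>v (M *\<^sub>v v)"
  using assms by (intro eq_vecI) auto

lemma mult_mat_zero_vec: "M \<in> carrier_mat n r \<Longrightarrow> M *\<^sub>v 0\<^sub>v r = (0\<^sub>v n :: 'a :: comm_ring_1 vec)"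
  by (intro eq_vecI) auto

lemma cone_span_mult:
  assumes P: "P \<in> carrier_mat m n" and "v \<in> cone_span n A"
  shows "P *\<^sub>v v \<in> cone_span m ((\<lambda>a. P *\<^sub>v a) ` A)"
  using assms(2)
proof induction
  case zero
  then show ?case by (simp add: cone_span.zero mult_mat_zero_vec[OF P])
next
  case (add v a r)
  have "P *\<^sub>v (v + r \<cdot>\<^sub>v a) = P *\<^sub>v v + r \<cdot>\<^sub>v (P *\<^sub>v a)"
    using P add cone_span_carrier[OF add(1)] by (simp add: mult_add_distrib_mat_vec mult_mat_vec_smult)
  then show ?case using add P by (auto intro!: cone_span.add)
qed

lemma cone_span_image:
  assumes P: "P \<in> carrier_mat m n" and A: "A \<subseteq> carrier_vec n"
    and "w \<in> cone_span m ((\<lambda>a. P *\<^sub>v a) ` A)"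
  shows "\<exists>v\<in>cone_span n A. w = P *\<^sub>v v"
  using assms(3)
proof induction
  case zero
  show ?case by (rule bexI[OF _ cone_span.zero]) (simp add: mult_mat_zero_vec[OF P])
next
  case (add w b r)
  then obtain v a where va: "v \<in> cone_span n A" "w = P *\<^sub>v v" "a \<in> A" "b = P *\<^sub>v a" by blast
  have a: "a \<in> carrier_vec n" using va(3) A by blast
  then have "w + r \<cdot>\<^sub>v b = P *\<^sub>v (v + r \<cdot>\<^sub>v a)"
    using P cone_span_carrier[OF va(1)] va by (simp add: mult_add_distrib_mat_vec mult_mat_vec_smult)
  with cone_span.add[OF va(1,3) a add(4)] show ?case by (rule bexI[rotated])
qed

lemma scalar_prod_cone_span_nonneg:
  assumes "u \<in> carrier_vec n" and "\<And>a. a \<in> A \<Longrightarrow> a \<in> carrier_vec n \<Longrightarrow> 0 \<le> u \<bullet> a" and "v \<in> cone_span n A"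
  shows "0 \<le> u \<bullet> v"
  using assms(3)
proof induction
  case (add v a r)
  then show ?case
    using assms(1,2) cone_span_carrier[OF add(1)] by (simp add: scalar_prod_add_distrib[of _ n])
qed (use assms(1) in simp)

text \<open>A vanishing sum of nonnegative terms has only vanishing terms. Hence a generator off the
  hyperplane can occur only with coefficient 0, and such a term is dropped.\<close>

lemma cone_span_face:
  assumes u: "u \<in> carrier_vec n" and nonneg: "\<And>a. a \<in> A \<Longrightarrow> a \<in> carrier_vec n \<Longrightarrow> 0 \<le> u \<bullet> a"
    and "v \<in> cone_span n A" and "u \<bullet> v = 0"
  shows "v \<in> cone_span n {a \<in> A. u \<bullet> a = 0}"
  using assms(3,4)
proof induction
  case (add v a r)
  have nn: "0 \<le> u \<bullet> v" "0 \<le> r * (u \<bullet> a)"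
    using add scalar_prod_cone_span_nonneg[OF u nonneg add(1)] nonneg by auto
  moreover have "u \<bullet> v + r * (u \<bullet> a) = 0"
    using add(6) u add(3) cone_span_carrier[OF add(1)] by (simp add: scalar_prod_add_distrib[of _ n])
  ultimately have 0: "u \<bullet> v = 0" "r * (u \<bullet> a) = 0" by linarith+
  show ?case
  proof (cases "r = 0")
    case True
    then have "v + r \<cdot>\<^sub>v a = v" using add(3) cone_span_carrier[OF add(1)] by (intro eq_vecI) auto
    then show ?thesis using add(5)[OF 0(1)] by simp
  next
    case False
    then show ?thesis using 0 add by (auto intro: cone_span.add)
  qed
qed (auto intro: cone_span.zero)

text \<open>Subgroups are treated as cones that contain the negatives of their generators, so that
  all facts about \<open>cone_span\<close>, including Farkas' lemma, apply to them.\<close>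

abbreviation group_span :: "nat \<Rightarrow> int vec set \<Rightarrow> int vec set" where
  "group_span n A \<equiv> cone_span n (A \<union> uminus ` A)"

lemma group_span_uminus: "v \<in> group_span n A \<Longrightarrow> - v \<in> group_span n A"
  using cone_span_uminus[of v n "A \<union> uminus ` A"] by (simp add: image_Un image_image Un_commute)

lemma group_span_smult:
  assumes "v \<in> group_span n A"
  shows "k \<cdot>\<^sub>v v \<in> group_span n A"
proof (cases "0 \<le> k")
  case False
  have "k \<cdot>\<^sub>v v = (- k) \<cdot>\<^sub>v (- v)" by auto
  then show ?thesis using False cone_span_smult[OF group_span_uminus[OF assms], of "- k"] by simp
qed (use assms cone_span_smult in blast)

lemma group_span_induct [consumes 1, case_names zero add]:
  assumes "v \<in> group_span n A" and "Q (0\<^sub>v n)"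
    and "\<And>v a k. v \<in> carrier_vec n \<Longrightarrow> Q v \<Longrightarrow> a \<in> A \<Longrightarrow> a \<in> carrier_vec n \<Longrightarrow> Q (v + k \<cdot>\<^sub>v a)"
  shows "Q v"
  using assms(1)
proof induction
  case (add v a r)
  from add(2) obtain b k where b: "b \<in> A" "b \<in> carrier_vec n" "r \<cdot>\<^sub>v a = k \<cdot>\<^sub>v b"
  proof
    assume "a \<in> A"
    then show thesis using that add(3) by blast
  next
    assume "a \<in> uminus ` A"
    then obtain b where b: "b \<in> A" "a = - b" by blast
    have "r \<cdot>\<^sub>v (- b) = (- r) \<cdot>\<^sub>v b" by (intro eq_vecI) auto
    with b add(3) show thesis by (intro that[of b "- r"]) auto
  qed
  then show ?case using assms(3)[OF cone_span_carrier[OF add(1)] add(5)] by simp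
qed (rule assms(2))

lemma mult_group_span_eq_0:
  assumes P: "P \<in> carrier_mat m n" and A: "\<And>a. a \<in> A \<Longrightarrow> a \<in> carrier_vec n \<Longrightarrow> P *\<^sub>v a = 0\<^sub>v m"
    and "v \<in> group_span n A"
  shows "P *\<^sub>v v = 0\<^sub>v m"
  using assms(3)
proof (induction rule: group_span_induct)
  case zero
  show ?case by (rule mult_mat_zero_vec[OF P])
next
  case (add v a k)
  then have "P *\<^sub>v (v + k \<cdot>\<^sub>v a) = k \<cdot>\<^sub>v 0\<^sub>v m"
    using P A by (simp add: mult_add_distrib_mat_vec mult_mat_vec_smult)
  then show ?case by auto
qed

text \<open>Induction along the expansion of the product into multiples of columns. The vector
  \<open>d k\<close> is c with all entries from index k on replaced by 0.\<close>

lemma mult_mat_vec_induct: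
  fixes M :: "'a :: comm_ring_1 mat"
  assumes M: "M \<in> carrier_mat n r" and c: "c \<in> carrier_vec r"
    and zero: "Q (0\<^sub>v n)" and add: "\<And>x k. x \<in> carrier_vec n \<Longrightarrow> Q x \<Longrightarrow> k < r \<Longrightarrow> Q (x + c $ k \<cdot>\<^sub>v col M k)"
  shows "Q (M *\<^sub>v c)"
proof -
  define d where "d k = vec r (\<lambda>i. if i < k then c $ i else 0)" for k
  have "Q (M *\<^sub>v d k)" if "k \<le> r" for k
    using that
  proof (induction k)
    case 0
    have "M *\<^sub>v d 0 = 0\<^sub>v n" using M by (intro eq_vecI) (auto simp: d_def scalar_prod_def)
    then show ?case using zero by simp
  next
    case (Suc k)
    have "M *\<^sub>v d (Suc k) = M *\<^sub>v d k + c $ k \<cdot>\<^sub>v col M k"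
    proof (rule eq_vecI)
      fix i assume "i < dim_vec (M *\<^sub>v d k + c $ k \<cdot>\<^sub>v col M k)"
      then have i: "i < n" using M by simp
      have "(\<Sum>j = 0..<r. M $$ (i, j) * (if j < Suc k then c $ j else 0)) =
        (\<Sum>j = 0..<r. M $$ (i, j) * (if j < k then c $ j else 0) + (if j = k then c $ k * M $$ (i, k) else 0))"
        by (rule sum.cong) (auto simp: less_Suc_eq)
      then show "(M *\<^sub>v d (Suc k)) $ i = (M *\<^sub>v d k + c $ k \<cdot>\<^sub>v col M k) $ i"
        using i M Suc.prems by (simp add: scalar_prod_def d_def sum.distrib)
    qed (use M in simp)
    then show ?case using Suc add[of "M *\<^sub>v d k" k] M by (simp add: d_def)
  qed
  from this[of r] have "Q (M *\<^sub>v d r)" by simp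
  moreover have "d r = c" using c by (auto simp: d_def)
  ultimately show ?thesis by simp
qed

lemma mult_mat_unit_vec:
  fixes M :: "'a :: comm_ring_1 mat"
  assumes "M \<in> carrier_mat n r" and "k < r"
  shows "M *\<^sub>v unit_vec r k = col M k"
  using assms by (intro eq_vecI) auto

lemma generated_sublattice_eq:
  assumes "set vs \<subseteq> carrier_vec n"
  shows "generated_sublattice n vs = group_span n (set vs)"
proof
  let ?M = "mat_of_cols n vs"
  have M: "?M \<in> carrier_mat n (length vs)" by simp
  show "generated_sublattice n vs \<subseteq> group_span n (set vs)"
  proof
    fix x assume "x \<in> generated_sublattice n vs"
    then obtain c where c: "c \<in> carrier_vec (length vs)" "x = ?M *\<^sub>v c"
      by (auto simp: generated_sublattice_def)
    have "?M *\<^sub>v c \<in> group_span n (set vs)"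
    proof (rule mult_mat_vec_induct[OF M c(1)])
      show "0\<^sub>v n \<in> group_span n (set vs)" by (rule cone_span.zero)
    next
      fix x k assume x: "x \<in> group_span n (set vs)" and k: "k < length vs"
      have v: "vs ! k \<in> set vs" "vs ! k \<in> carrier_vec n" using k assms nth_mem by auto
      then have "vs ! k \<in> group_span n (set vs)" by (intro cone_span_gen) auto
      then show "x + c $ k \<cdot>\<^sub>v col ?M k \<in> group_span n (set vs)"
        using v k x by (simp add: cone_span_plus group_span_smult)
    qed
    then show "x \<in> group_span n (set vs)" using c by simp
  qed
  show "group_span n (set vs) \<subseteq> generated_sublattice n vs"
  proof
    fix x assume "x \<in> group_span n (set vs)"
    then have "\<exists>c\<in>carrier_vec (length vs). x = ?M *\<^sub>v c"
    proof (induction rule: group_span_induct)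
      case zero
      show ?case by (intro bexI[of _ "0\<^sub>v (length vs)"]) (auto simp: mult_mat_zero_vec[OF M])
    next
      case (add v b s)
      then obtain c where c: "c \<in> carrier_vec (length vs)" "v = ?M *\<^sub>v c" by blast
      obtain k where k: "k < length vs" "b = vs ! k" using add(2) by (auto simp: in_set_conv_nth)
      then have "v + s \<cdot>\<^sub>v b = ?M *\<^sub>v (c + s \<cdot>\<^sub>v unit_vec (length vs) k)"
        using c add(3) by (simp add: mult_add_distrib_mat_vec[OF M] mult_mat_vec_smult[OF M] mult_mat_unit_vec[OF M])
      then show ?case using c(1) by (intro bexI[of _ "c + s \<cdot>\<^sub>v unit_vec (length vs) k"]) auto
    qed
    then show "x \<in> generated_sublattice n vs" by (auto simp: generated_sublattice_def)
  qed
qed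

section \<open>Farkas' lemma over ordered rings\<close>

text \<open>The factor k replaces division, so the same proof covers integers and reals. The
  induction removes one generator c. If the form u that separates b from the other generators is
  negative on c, all vectors are projected along c to the hyperplane where u vanishes, and the
  induction hypothesis is applied there.\<close>

lemma farkas:
  assumes "set as \<subseteq> carrier_vec n" and "b \<in> carrier_vec n"
  shows "(\<exists>k>0. k \<cdot>\<^sub>v b \<in> cone_span n (set as)) \<or>
    (\<exists>u\<in>carrier_vec n. (\<forall>a\<in>set as. 0 \<le> u \<bullet> a) \<and> u \<bullet> b < 0)"
  using assms
proof (induction "length as" arbitrary: as b)
  case 0
  show ?case
  proof (cases "b = 0\<^sub>v n")
    case True
    then have "1 \<cdot>\<^sub>v b \<in> cone_span n (set as)" by (auto intro: cone_span.zero)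
    then show ?thesis by (intro disjI1 exI[of _ 1]) simp
  next
    case False
    have "b = 0\<^sub>v n" if "\<forall>i<n. b $ i = 0"
      using that 0 by (intro eq_vecI) auto
    with False obtain i where i: "i < n" "b $ i \<noteq> 0" by metis
    let ?u = "(- (b $ i)) \<cdot>\<^sub>v unit_vec n i"
    have "?u \<bullet> b = - (b $ i * b $ i)" using 0 i by simp
    moreover have "0 < b $ i * b $ i" using i(2) by (simp flip: power2_eq_square)
    ultimately have "?u \<bullet> b < 0" by linarith
    then show ?thesis using 0 by (intro disjI2 bexI[of _ ?u]) auto
  qed
next
  case (Suc r)
  then obtain c as' where as: "as = c # as'" "r = length as'" by (metis Suc_length_conv)
  then have c: "c \<in> carrier_vec n" and as': "set as' \<subseteq> carrier_vec n" using Suc.prems by auto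
  note b = Suc.prems(2)
  have mono: "cone_span n (set as') \<subseteq> cone_span n (set as)"
    using as by (intro cone_span_mono) auto
  from Suc.hyps(1)[OF as(2) as' b] show ?case
  proof
    assume "\<exists>u\<in>carrier_vec n. (\<forall>a\<in>set as'. 0 \<le> u \<bullet> a) \<and> u \<bullet> b < 0"
    then obtain u where u: "u \<in> carrier_vec n" "\<forall>a\<in>set as'. 0 \<le> u \<bullet> a" "u \<bullet> b < 0" by blast
    show ?thesis
    proof (cases "0 \<le> u \<bullet> c")
      case True
      then show ?thesis using u as by auto
    next
      case False
      define s where "s = - (u \<bullet> c)"
      have s: "s > 0" using False by (simp add: s_def)
      \<comment> \<open>up to the factor \<open>s\<close>, the projection along \<open>c\<close> to the hyperplane orthogonal to \<open>u\<close>\<close>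
      define f where "f a = s \<cdot>\<^sub>v a + (u \<bullet> a) \<cdot>\<^sub>v c" for a
      have f: "f a \<in> carrier_vec n" if "a \<in> carrier_vec n" for a using that c by (simp add: f_def)
      have fa: "f a \<in> cone_span n (set as)" if "a \<in> set as'" for a
        unfolding f_def using that u s as c as'
        by (intro cone_span_plus cone_span_smult cone_span_gen) auto
      have "(\<exists>k>0. k \<cdot>\<^sub>v f b \<in> cone_span n (set (map f as'))) \<or>
        (\<exists>u\<in>carrier_vec n. (\<forall>a\<in>set (map f as'). 0 \<le> u \<bullet> a) \<and> u \<bullet> f b < 0)"
        by (rule Suc.hyps(1)) (use as as' f b in auto)
      then show ?thesis
      proof
        assume "\<exists>k>0. k \<cdot>\<^sub>v f b \<in> cone_span n (set (map f as'))"
        then obtain k where k: "k > 0" "k \<cdot>\<^sub>v f b \<in> cone_span n (set (map f as'))" by blast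
        have "cone_span n (set (map f as')) \<subseteq> cone_span n (set as)"
          by (rule cone_span_least) (use fa in auto)
        then have kb: "k \<cdot>\<^sub>v f b \<in> cone_span n (set as)" using k by blast
        \<comment> \<open>In \<open>k \<cdot>\<^sub>v f b\<close> the vector c has coefficient
          \<open>k * (u \<bullet> b)\<close>, which is at most 0. Adding the opposite multiple of c
          stays in the cone and leaves \<open>(k * s) \<cdot>\<^sub>v b\<close>.\<close>
        have "0 \<le> k * - (u \<bullet> b)" using k u by (intro mult_nonneg_nonneg) auto
        then have "k \<cdot>\<^sub>v f b + (k * - (u \<bullet> b)) \<cdot>\<^sub>v c \<in> cone_span n (set as)"
          using c as by (intro cone_span_plus[OF kb] cone_span_smult cone_span_gen) auto
        also have "k \<cdot>\<^sub>v f b + (k * - (u \<bullet> b)) \<cdot>\<^sub>v c = (k * s) \<cdot>\<^sub>v b"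
          using b c by (intro eq_vecI) (auto simp: f_def algebra_simps)
        finally show ?thesis using k s by (intro disjI1 exI[of _ "k * s"]) auto
      next
        assume "\<exists>w\<in>carrier_vec n. (\<forall>a\<in>set (map f as'). 0 \<le> w \<bullet> a) \<and> w \<bullet> f b < 0"
        then obtain w where w: "w \<in> carrier_vec n" "\<forall>a\<in>set as'. 0 \<le> w \<bullet> f a" "w \<bullet> f b < 0" by auto
        \<comment> \<open>The pullback of the form w along f; it kills c because f c = 0.\<close>
        define w' where "w' = s \<cdot>\<^sub>v w + (w \<bullet> c) \<cdot>\<^sub>v u"
        have w': "w' \<in> carrier_vec n" using w u by (simp add: w'_def)
        have eq: "w' \<bullet> a = w \<bullet> f a" if a: "a \<in> carrier_vec n" for a
          using w(1) u(1) a c by (simp add: w'_def f_def add_scalar_prod_distrib[of _ n] scalar_prod_add_distrib[of _ n])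
        have "w' \<bullet> c = 0"
          using w(1) u(1) c by (simp add: w'_def s_def add_scalar_prod_distrib[of _ n])
        then have "\<forall>a\<in>set as. 0 \<le> w' \<bullet> a" using as w(2) eq as' by auto
        moreover have "w' \<bullet> b < 0" using eq b w(3) by simp
        ultimately show ?thesis using w' by blast
      qed
    qed
  qed (use mono in blast)
qed

text \<open>Strict complementarity: u lies in the relative interior of the dual cone, so it vanishes
  exactly on the generators in the lineality space. It is the sum of the forms that Farkas' lemma
  gives for those generators a for which - a is not in the cone.\<close>

lemma farkas_strict:
  fixes A :: "int vec set"
  assumes A: "finite A" "A \<subseteq> carrier_vec n"
  shows "\<exists>u\<in>carrier_vec n. \<forall>a\<in>A. u \<bullet> a > 0 \<or> (u \<bullet> a = 0 \<and> - a \<in> cone_span n A)"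
proof -
  have "\<exists>u\<in>carrier_vec n. (\<forall>a\<in>A. 0 \<le> u \<bullet> a) \<and> (\<forall>a\<in>B. u \<bullet> a > 0 \<or> - a \<in> cone_span n A)"
    if "finite B" "B \<subseteq> A" for B
    using that
  proof (induction rule: finite_induct)
    case empty
    then show ?case by (intro bexI[of _ "0\<^sub>v n"]) (use A in auto)
  next
    case (insert b B)
    then obtain u where u: "u \<in> carrier_vec n" "\<forall>a\<in>A. 0 \<le> u \<bullet> a" "\<forall>a\<in>B. u \<bullet> a > 0 \<or> - a \<in> cone_span n A"
      by auto
    have b: "b \<in> A" "b \<in> carrier_vec n" using insert A by auto
    obtain as where as: "set as = A" using A finite_list by blast
    from farkas[of as n "- b"] as A b
    consider k where "k > 0" "k \<cdot>\<^sub>v - b \<in> cone_span n A" |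
      w where "w \<in> carrier_vec n" "\<forall>a\<in>A. 0 \<le> w \<bullet> a" "w \<bullet> - b < 0" by auto
    then show ?case
    proof cases
      case 1
      \<comment> \<open>b is itself a generator, so k - 1 copies of it remove the factor k.\<close>
      have "k \<cdot>\<^sub>v - b + (k - 1) \<cdot>\<^sub>v b \<in> cone_span n A"
        using 1(1) b by (intro cone_span_plus[OF 1(2)] cone_span_smult cone_span_gen) auto
      also have "k \<cdot>\<^sub>v - b + (k - 1) \<cdot>\<^sub>v b = - b" by (intro eq_vecI) (auto simp: algebra_simps)
      finally show ?thesis using u by auto
    next
      case 2
      have sum: "(u + w) \<bullet> a = u \<bullet> a + w \<bullet> a" if "a \<in> A" for a
        using u 2 A that by (intro add_scalar_prod_distrib[of _ n]) auto
      show ?thesis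
      proof (intro bexI[of _ "u + w"] conjI ballI)
        show "u + w \<in> carrier_vec n" using u(1) 2(1) by simp
      next
        fix a assume "a \<in> A" then show "0 \<le> (u + w) \<bullet> a" using sum u 2 by auto
      next
        fix a assume a: "a \<in> insert b B"
        then have "a \<in> A" using insert by auto
        moreover have "w \<bullet> b > 0" using 2 b by simp
        ultimately show "(u + w) \<bullet> a > 0 \<or> - a \<in> cone_span n A"
          using sum u 2 a by (metis add_increasing2 add_nonneg_pos add_pos_nonneg insert_iff)
      qed
    qed
  qed
  from this[OF A(1) subset_refl] obtain u where
    u: "u \<in> carrier_vec n" "\<forall>a\<in>A. 0 \<le> u \<bullet> a" "\<forall>a\<in>A. u \<bullet> a > 0 \<or> - a \<in> cone_span n A" by blast
  have "u \<bullet> a > 0 \<or> (u \<bullet> a = 0 \<and> - a \<in> cone_span n A)" if a: "a \<in> A" for a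
  proof (cases "- a \<in> cone_span n A")
    case True
    have "0 \<le> u \<bullet> - a"
      by (rule scalar_prod_cone_span_nonneg[OF u(1) _ True]) (use u(2) in blast)
    moreover have "u \<bullet> - a = - (u \<bullet> a)" using u a A by auto
    moreover have "0 \<le> u \<bullet> a" using u a by auto
    ultimately show ?thesis using True by linarith
  next
    case False
    then show ?thesis using u(3) a by blast
  qed
  then show ?thesis using u by blast
qed

section \<open>Sublattices and projections\<close>

lemma a_inv_module_vec:
  assumes "x \<in> carrier_vec n"
  shows "inv\<^bsub>add_monoid (module_vec TYPE(int) n)\<^esub> x = - x"
  unfolding m_inv_def
proof (rule the_equality)
  fix y assume "y \<in> carrier (add_monoid (module_vec TYPE(int) n)) \<and>
    x \<otimes>\<^bsub>add_monoid (module_vec TYPE(int) n)\<^esub> y = \<one>\<^bsub>add_monoid (module_vec TYPE(int) n)\<^esub> \<and>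
    y \<otimes>\<^bsub>add_monoid (module_vec TYPE(int) n)\<^esub> x = \<one>\<^bsub>add_monoid (module_vec TYPE(int) n)\<^esub>"
  then have y: "y \<in> carrier_vec n" "x + y = 0\<^sub>v n" by (auto simp: module_vec_simps)
  have "x $ i + y $ i = 0" if "i < n" for i
    using arg_cong[OF y(2), of "\<lambda>v. v $ i"] that y(1) assms by simp
  then have "y $ i = - x $ i" if "i < n" for i using that by (metis add.commute eq_neg_iff_add_eq_0)
  then show "y = - x" using y(1) assms by (intro eq_vecI) auto
qed (use assms in \<open>auto simp: module_vec_simps\<close>)

lemma sublattice_iff:
  "sublattice n L \<longleftrightarrow> L \<subseteq> carrier_vec n \<and> 0\<^sub>v n \<in> L \<and> (\<forall>v\<in>L. \<forall>w\<in>L. v + w \<in> L) \<and> (\<forall>v\<in>L. - v \<in> L)"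
proof
  assume "sublattice n L"
  then have sub: "subgroup L (add_monoid (module_vec TYPE(int) n))"
    by (simp add: sublattice_def additive_subgroup_def)
  have L: "L \<subseteq> carrier_vec n" using subgroup.subset[OF sub] by (simp add: module_vec_simps)
  moreover have "0\<^sub>v n \<in> L" using subgroup.one_closed[OF sub] by (simp add: module_vec_simps)
  moreover have "v + w \<in> L" if "v \<in> L" "w \<in> L" for v w
    using subgroup.m_closed[OF sub that] by (simp add: module_vec_simps)
  moreover have "- v \<in> L" if "v \<in> L" for v
    using subgroup.m_inv_closed[OF sub that] that L a_inv_module_vec by auto
  ultimately show "L \<subseteq> carrier_vec n \<and> 0\<^sub>v n \<in> L \<and> (\<forall>v\<in>L. \<forall>w\<in>L. v + w \<in> L) \<and> (\<forall>v\<in>L. - v \<in> L)"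
    by blast
next
  assume L: "L \<subseteq> carrier_vec n \<and> 0\<^sub>v n \<in> L \<and> (\<forall>v\<in>L. \<forall>w\<in>L. v + w \<in> L) \<and> (\<forall>v\<in>L. - v \<in> L)"
  show "sublattice n L"
    unfolding sublattice_def
  proof (rule additive_subgroup.intro, rule subgroup.intro)
    fix x assume x: "x \<in> L"
    then have "x \<in> carrier_vec n" using L by blast
    from a_inv_module_vec[OF this] x L
    show "inv\<^bsub>add_monoid (module_vec TYPE(int) n)\<^esub> x \<in> L" by simp
  qed (use L in \<open>auto simp: module_vec_simps\<close>)
qed

lemma sublattice_smult:
  assumes "sublattice n L" and "v \<in> L"
  shows "k \<cdot>\<^sub>v v \<in> L"
proof -
  have L: "L \<subseteq> carrier_vec n" "0\<^sub>v n \<in> L" "\<And>v w. v \<in> L \<Longrightarrow> w \<in> L \<Longrightarrow> v + w \<in> L" "\<And>v. v \<in> L \<Longrightarrow> - v \<in> L"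
    using assms(1) unfolding sublattice_iff by auto
  have nonneg: "k \<cdot>\<^sub>v v \<in> L" if "0 \<le> k" "v \<in> L" for k v
    using that(1)
  proof (induction k rule: int_ge_induct)
    case base
    have "0 \<cdot>\<^sub>v v = 0\<^sub>v n" using that(2) L(1) by (intro eq_vecI) auto
    then show ?case using L(2) by simp
  next
    case (step k)
    then show ?case using L(3)[OF step.IH that(2)] by (simp add: add_smult_distrib_vec)
  qed
  show ?thesis
  proof (cases "0 \<le> k")
    case False
    have "k \<cdot>\<^sub>v v = (- k) \<cdot>\<^sub>v (- v)" by auto
    then show ?thesis using nonneg[of "- k" "- v"] False L(4) assms(2) by simp
  qed (use nonneg assms(2) in blast)
qed

lemma ex_least_positive_value:
  fixes f :: "'a \<Rightarrow> int"
  assumes "x \<in> A" and "0 < f x"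
  obtains v where "v \<in> A" "0 < f v" "\<And>w. w \<in> A \<Longrightarrow> 0 < f w \<Longrightarrow> f v \<le> f w"
proof -
  obtain v where "v \<in> A \<and> 0 < f v" "\<forall>w. w \<in> A \<and> 0 < f w \<longrightarrow> nat (f v) \<le> nat (f w)"
    using ex_has_least_nat[of "\<lambda>v. v \<in> A \<and> 0 < f v" x "\<lambda>v. nat (f v)"] assms by blast
  then show thesis by (intro that[of v]) (auto simp: nat_le_eq_zle)
qed

text \<open>Serves the bare existence of the quotient fan, where L comes without generators; the
  algorithm receives them as input.\<close>

lemma sublattice_finitely_generated:
  assumes L: "sublattice n L"
  shows "\<exists>ls. set ls \<subseteq> carrier_vec n \<and> L = group_span n (set ls)"
proof -
  have c: "L \<subseteq> carrier_vec n" "\<And>v w. v \<in> L \<Longrightarrow> w \<in> L \<Longrightarrow> v + w \<in> L"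
    using L unfolding sublattice_iff by auto
  \<comment> \<open>treat the coordinates one at a time: gcd of the values of the last coordinate in use\<close>
  have "\<exists>ls. set ls \<subseteq> L \<and> {v \<in> L. \<forall>i<n. k \<le> i \<longrightarrow> v $ i = 0} \<subseteq> group_span n (set ls)" if "k \<le> n" for k
    using that
  proof (induction k)
    case 0
    have "v = 0\<^sub>v n" if "v \<in> L" "\<forall>i<n. v $ i = 0" for v
      using that c(1) by (intro eq_vecI) auto
    then show ?case by (intro exI[of _ "[]"]) (auto intro: cone_span.zero)
  next
    case (Suc k)
    then obtain ls where ls: "set ls \<subseteq> L"
      "{v \<in> L. \<forall>i<n. k \<le> i \<longrightarrow> v $ i = 0} \<subseteq> group_span n (set ls)" by auto
    define J where "J = {v \<in> L. \<forall>i<n. Suc k \<le> i \<longrightarrow> v $ i = 0}"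
    have J: "v + w \<in> J" "t \<cdot>\<^sub>v v \<in> J" if "v \<in> J" "w \<in> J" for v w t
    proof -
      have "v \<in> carrier_vec n" "w \<in> carrier_vec n" using that c(1) by (auto simp: J_def)
      then show "v + w \<in> J" "t \<cdot>\<^sub>v v \<in> J"
        using that c(2) sublattice_smult[OF L] by (auto simp: J_def)
    qed
    have k: "k < n" using Suc.prems by simp
    show ?case
    proof (cases "\<exists>v\<in>J. v $ k \<noteq> 0")
      case False
      have "v $ i = 0" if "v \<in> J" "i < n" "k \<le> i" for v i
        using that False by (cases "i = k") (auto simp: J_def)
      then have "J \<subseteq> {v \<in> L. \<forall>i<n. k \<le> i \<longrightarrow> v $ i = 0}"
        unfolding J_def by blast
      then have "J \<subseteq> group_span n (set ls)" using ls(2) by (rule subset_trans)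
      with ls(1) show ?thesis unfolding J_def by (intro exI[of _ ls] conjI)
    next
      case True
      then obtain v0 where v0: "v0 \<in> J" "v0 $ k \<noteq> 0" by blast
      have "\<exists>v\<in>J. 0 < v $ k"
      proof (cases "0 < v0 $ k")
        case False
        have "dim_vec v0 = n" using v0 c(1) by (auto simp: J_def)
        then have "0 < (- 1 \<cdot>\<^sub>v v0) $ k" using False v0 k by simp
        then show ?thesis using J(2)[OF v0(1) v0(1)] by blast
      next
        case True
        then show ?thesis using v0(1) by blast
      qed
      then obtain v where v: "v \<in> J" "0 < v $ k"
        and min: "\<And>w. w \<in> J \<Longrightarrow> 0 < w $ k \<Longrightarrow> v $ k \<le> w $ k"
        using ex_least_positive_value[of _ J "\<lambda>v. v $ k"] by blast
      have vc: "v \<in> carrier_vec n" using v c(1) by (auto simp: J_def)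
      have "x \<in> group_span n (set (v # ls))" if x: "x \<in> J" for x
      proof -
        \<comment> \<open>Division with remainder by the least positive value of coordinate k: the
          remainder is too small to be positive, hence it is 0, and y is covered by the induction
          hypothesis.\<close>
        define q where "q = x $ k div v $ k"
        define y where "y = x + (- q) \<cdot>\<^sub>v v"
        have xc: "x \<in> carrier_vec n" using x c(1) by (auto simp: J_def)
        have y: "y \<in> J" unfolding y_def using J(1)[OF x J(2)[OF v(1) v(1)]] .
        have "y $ k = x $ k mod v $ k"
          using k xc vc by (simp add: y_def q_def minus_div_mult_eq_mod[symmetric])
        then have "0 \<le> y $ k" "y $ k < v $ k" using v by auto
        then have "y $ k = 0" using min[OF y] by linarith
        then have "y \<in> {v \<in> L. \<forall>i<n. k \<le> i \<longrightarrow> v $ i = 0}"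
          using y Suc_leI[OF le_neq_implies_less] unfolding J_def by blast
        then have y': "y \<in> group_span n (set (v # ls))"
          using ls(2) cone_span_mono[of "set ls \<union> uminus ` set ls" "set (v # ls) \<union> uminus ` set (v # ls)" n]
          by auto
        have "x = y + q \<cdot>\<^sub>v v" using xc vc by (intro eq_vecI) (auto simp: y_def)
        moreover have "q \<cdot>\<^sub>v v \<in> group_span n (set (v # ls))"
          using vc by (intro group_span_smult cone_span_gen) auto
        ultimately show ?thesis using y' cone_span_plus by metis
      qed
      then show ?thesis
        using ls v unfolding J_def by (intro exI[of _ "v # ls"]) auto
    qed
  qed
  from this[of n] obtain ls where ls: "set ls \<subseteq> L" "L \<subseteq> group_span n (set ls)" by auto
  have "group_span n (set ls) \<subseteq> L"
  proof
    fix x assume "x \<in> group_span n (set ls)"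
    then show "x \<in> L"
    proof (induction rule: group_span_induct)
      case (add v a k)
      then show ?case using ls(1) c(2) sublattice_smult[OF L] by blast
    qed (use L in \<open>auto simp: sublattice_iff\<close>)
  qed
  then show ?thesis using ls c(1) by (intro exI[of _ ls]) auto
qed

text \<open>Bounds the number of rows of a split projection; this is what stops the process in
  \<open>saturation_projection\<close>.\<close>

lemma right_inverse_dim_le:
  fixes P Q :: "int mat"
  assumes P: "P \<in> carrier_mat m n" and Q: "Q \<in> carrier_mat n m" and PQ: "P * Q = 1\<^sub>m m"
  shows "m \<le> n"
proof (rule ccontr)
  assume "\<not> m \<le> n"
  then have nm: "n < m" by simp
  \<comment> \<open>padding with zeros makes the matrices square, where right inverses are left inverses\<close>
  define P' where "P' = mat m m (\<lambda>(i, j). if j < n then rat_of_int (P $$ (i, j)) else 0)"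
  define Q' where "Q' = mat m m (\<lambda>(i, j). if i < n then rat_of_int (Q $$ (i, j)) else 0)"
  have c: "P' \<in> carrier_mat m m" "Q' \<in> carrier_mat m m" by (auto simp: P'_def Q'_def)
  have "P' * Q' = 1\<^sub>m m"
  proof (rule eq_matI)
    fix i j assume "i < dim_row (1\<^sub>m m :: rat mat)" "j < dim_col (1\<^sub>m m :: rat mat)"
    then have ij: "i < m" "j < m" by auto
    have "(P' * Q') $$ (i, j) = (\<Sum>k = 0..<m. if k < n then rat_of_int (P $$ (i, k) * Q $$ (k, j)) else 0)"
      using ij unfolding P'_def Q'_def
      by (auto simp: scalar_prod_def intro!: sum.cong)
    also have "\<dots> = (\<Sum>k = 0..<n. rat_of_int (P $$ (i, k) * Q $$ (k, j)))"
      using nm by (intro sum.mono_neutral_cong_right) auto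
    also have "\<dots> = rat_of_int ((P * Q) $$ (i, j))"
      using ij P Q by (simp add: scalar_prod_def)
    finally show "(P' * Q') $$ (i, j) = 1\<^sub>m m $$ (i, j)" using ij PQ by simp
  qed (auto simp: P'_def Q'_def)
  from mat_mult_left_right_inverse[OF c this] have "(Q' * P') $$ (m - 1, m - 1) = 1" using nm by simp
  moreover have "(Q' * P') $$ (m - 1, m - 1) = 0"
    using nm unfolding P'_def Q'_def by (auto simp: scalar_prod_def)
  ultimately show False by simp
qed

text \<open>If no positive multiple of the kernel vector x is in the span of \<open>vs\<close>,
  Farkas' lemma for \<open>vs\<close> and its negatives gives a form that vanishes on
  \<open>vs\<close> but not on x. It yields one more row. Carrying the right inverse Q along keeps
  the projection surjective over the integers, not only up to finite index.\<close>

lemma extend_projection: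
  assumes P: "P \<in> carrier_mat m n" and Q: "Q \<in> carrier_mat n m" and PQ: "P * Q = 1\<^sub>m m"
    and V: "set vs \<subseteq> carrier_vec n" "\<forall>v\<in>set vs. P *\<^sub>v v = 0\<^sub>v m"
    and x: "x \<in> carrier_vec n" "P *\<^sub>v x = 0\<^sub>v m" "\<forall>k>0. k \<cdot>\<^sub>v x \<notin> group_span n (set vs)"
  shows "\<exists>P' Q'. P' \<in> carrier_mat (Suc m) n \<and> Q' \<in> carrier_mat n (Suc m) \<and> P' * Q' = 1\<^sub>m (Suc m) \<and>
    (\<forall>v\<in>set vs. P' *\<^sub>v v = (0\<^sub>v (Suc m) :: int vec))"
proof -
  have "set (vs @ map uminus vs) \<subseteq> carrier_vec n" using V by auto
  from farkas[OF this x(1)] x(3) obtain u where u: "u \<in> carrier_vec n"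
    "\<forall>a\<in>set vs \<union> uminus ` set vs. 0 \<le> u \<bullet> a" "u \<bullet> x < 0" by auto
  have uv: "u \<bullet> v = 0" if "v \<in> set vs" for v
  proof -
    have "0 \<le> u \<bullet> v" "0 \<le> u \<bullet> - v" using u(2) that by auto
    moreover have "u \<bullet> - v = - (u \<bullet> v)" using u(1) V that by (intro scalar_prod_uminus_right) auto
    ultimately show ?thesis by linarith
  qed
  \<comment> \<open>\<open>w\<close> vanishes on \<open>vs\<close> and on the image of \<open>Q\<close>; the new row of \<open>P\<close> is \<open>w\<close> divided by its content\<close>
  define w where "w = u - P\<^sup>T *\<^sub>v (Q\<^sup>T *\<^sub>v u)"
  have Qu: "Q\<^sup>T *\<^sub>v u \<in> carrier_vec m"
    using Q u(1) by (intro mult_mat_vec_carrier[of _ _ n]) auto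
  then have PQu: "P\<^sup>T *\<^sub>v (Q\<^sup>T *\<^sub>v u) \<in> carrier_vec n"
    by (rule mult_mat_vec_carrier[rotated]) (use P in simp)
  then have w: "w \<in> carrier_vec n" using u(1) by (simp add: w_def)
  have wy: "w \<bullet> y = u \<bullet> y - u \<bullet> (Q *\<^sub>v (P *\<^sub>v y))" if y: "y \<in> carrier_vec n" for y
  proof -
    have "w \<bullet> y = u \<bullet> y - (P\<^sup>T *\<^sub>v (Q\<^sup>T *\<^sub>v u)) \<bullet> y"
      unfolding w_def by (rule minus_scalar_prod_distrib[OF u(1) PQu y])
    also have "(P\<^sup>T *\<^sub>v (Q\<^sup>T *\<^sub>v u)) \<bullet> y = (Q\<^sup>T *\<^sub>v u) \<bullet> (P *\<^sub>v y)"
      using transpose_vec_mult_scalar[OF P y, of "Q\<^sup>T *\<^sub>v u"] Q u y P by simp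
    also have "\<dots> = u \<bullet> (Q *\<^sub>v (P *\<^sub>v y))"
      using transpose_vec_mult_scalar[OF Q, of "P *\<^sub>v y" u] Q u y P by simp
    finally show ?thesis .
  qed
  have wv: "w \<bullet> v = 0" if "v \<in> set vs" for v
  proof -
    have "v \<in> carrier_vec n" "P *\<^sub>v v = 0\<^sub>v m" using that V by auto
    moreover have "Q *\<^sub>v 0\<^sub>v m = 0\<^sub>v n" using Q by auto
    ultimately show ?thesis using wy uv[OF that] u(1) by simp
  qed
  have wQ: "w \<bullet> (Q *\<^sub>v z) = 0" if z: "z \<in> carrier_vec m" for z
  proof -
    have "P *\<^sub>v (Q *\<^sub>v z) = z" using assoc_mult_mat_vec[OF P Q z] PQ z by simp
    then show ?thesis using wy[of "Q *\<^sub>v z"] Q z by simp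
  qed
  have wx: "w \<bullet> x < 0"
  proof -
    have "Q *\<^sub>v 0\<^sub>v m = 0\<^sub>v n" using Q by auto
    then show ?thesis using wy[OF x(1)] x(2) u by simp
  qed
  have "w \<bullet> - x = - (w \<bullet> x)" using w x by simp
  then have "- x \<in> carrier_vec n" "0 < w \<bullet> - x" using wx x(1) by auto
  then obtain q where q: "q \<in> carrier_vec n" "0 < w \<bullet> q"
    and min': "\<And>y. y \<in> carrier_vec n \<Longrightarrow> 0 < w \<bullet> y \<Longrightarrow> w \<bullet> q \<le> w \<bullet> y"
    using ex_least_positive_value[of "- x" "carrier_vec n" "\<lambda>y. w \<bullet> y"] by blast
  define d where "d = w \<bullet> q"
  note min = min'[folded d_def]
  \<comment> \<open>The least positive value d of w divides all its values, by division with
    remainder. Evaluated at the unit vectors this shows that d is the content of w.\<close>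
  have dvd: "d dvd w \<bullet> y" if y: "y \<in> carrier_vec n" for y
  proof -
    let ?y = "y + (- (w \<bullet> y div d)) \<cdot>\<^sub>v q"
    have "w \<bullet> ?y = w \<bullet> y mod d"
      using w y q by (simp add: scalar_prod_add_distrib[of _ n] d_def minus_div_mult_eq_mod[symmetric])
    moreover have "?y \<in> carrier_vec n" using y q by simp
    moreover have "w \<bullet> y mod d < d" "0 \<le> w \<bullet> y mod d" using q by (auto simp: d_def)
    ultimately have "w \<bullet> y mod d = 0" using min[of ?y] by linarith
    then show ?thesis by auto
  qed
  define w1 where "w1 = vec n (\<lambda>j. w $ j div d)"
  have w1: "w1 \<in> carrier_vec n" by (simp add: w1_def)
  have "w = d \<cdot>\<^sub>v w1"
  proof (rule eq_vecI)
    fix j assume "j < dim_vec (d \<cdot>\<^sub>v w1)"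
    then have j: "j < n" by (simp add: w1_def)
    have "d dvd w $ j" using dvd[of "unit_vec n j"] w j by simp
    then show "w $ j = (d \<cdot>\<^sub>v w1) $ j" using j by (simp add: w1_def)
  qed (use w in \<open>simp add: w1_def\<close>)
  then have w1y: "w \<bullet> y = d * (w1 \<bullet> y)" if "y \<in> carrier_vec n" for y
    using that w1 by simp
  have d: "d > 0" using q by (simp add: d_def)
  \<comment> \<open>q is moved into the kernel of P, so that the new column does not disturb the old
    rows. The value of w stays d because w vanishes on the image of Q.\<close>
  define q' where "q' = q - Q *\<^sub>v (P *\<^sub>v q)"
  have q': "q' \<in> carrier_vec n" using q Q P by (simp add: q'_def)
  have w1q': "w1 \<bullet> q' = 1"
  proof -
    have "w \<bullet> q' = w \<bullet> q - w \<bullet> (Q *\<^sub>v (P *\<^sub>v q))"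
      unfolding q'_def using w q P Q by (intro scalar_prod_minus_distrib[of _ n]) auto
    then have "d * (w1 \<bullet> q') = d" using wQ[of "P *\<^sub>v q"] P q w1y[OF q'] by (simp add: d_def)
    then show ?thesis using d by simp
  qed
  have Pq': "P *\<^sub>v q' = 0\<^sub>v m"
  proof -
    have "P *\<^sub>v q' = P *\<^sub>v q - P *\<^sub>v (Q *\<^sub>v (P *\<^sub>v q))"
      unfolding q'_def using P Q q by (intro mult_minus_distrib_mat_vec[of _ m n]) auto
    also have "P *\<^sub>v (Q *\<^sub>v (P *\<^sub>v q)) = P *\<^sub>v q"
      using assoc_mult_mat_vec[OF P Q, of "P *\<^sub>v q"] PQ P q by simp
    finally show ?thesis using P q by (intro eq_vecI) auto
  qed
  have w1v: "w1 \<bullet> v = 0" if "v \<in> set vs" for v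
    using wv[OF that] w1y[of v] that V d by auto
  have w1Q: "w1 \<bullet> col Q j = 0" if "j < m" for j
    using wQ[of "unit_vec m j"] w1y[of "col Q j"] d that Q mult_mat_unit_vec[OF Q that] by auto
  define P' where "P' = mat_of_rows n (rows P @ [w1])"
  define Q' where "Q' = mat_of_cols n (cols Q @ [q'])"
  have P': "P' \<in> carrier_mat (Suc m) n" and Q': "Q' \<in> carrier_mat n (Suc m)"
    using P Q by (auto simp: P'_def Q'_def)
  have rowP': "row P' i = (if i < m then row P i else w1)" if "i < Suc m" for i
    using that P w1 by (auto simp: P'_def nth_append less_Suc_eq)
  have colQ': "col Q' j = (if j < m then col Q j else q')" if "j < Suc m" for j
    using that Q q' by (auto simp: Q'_def nth_append less_Suc_eq)
  have "P' * Q' = 1\<^sub>m (Suc m)"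
  proof (rule eq_matI)
    fix i j assume "i < dim_row (1\<^sub>m (Suc m) :: int mat)" "j < dim_col (1\<^sub>m (Suc m) :: int mat)"
    then have ij: "i < Suc m" "j < Suc m" by auto
    have "row P i \<bullet> col Q j = (if i = j then 1 else 0)" if "i < m" "j < m"
      using arg_cong[OF PQ, of "\<lambda>M. M $$ (i, j)"] that P Q by simp
    moreover have "row P i \<bullet> q' = 0" if "i < m"
      using arg_cong[OF Pq', of "\<lambda>v. v $ i"] that P by simp
    ultimately show "(P' * Q') $$ (i, j) = 1\<^sub>m (Suc m) $$ (i, j)"
      using ij P' Q' rowP'[OF ij(1)] colQ'[OF ij(2)] w1Q w1q' by (auto simp: less_Suc_eq)
  qed (use P' Q' in auto)
  moreover have "P' *\<^sub>v v = 0\<^sub>v (Suc m)" if v: "v \<in> set vs" for v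
  proof (rule eq_vecI)
    fix i assume "i < dim_vec (0\<^sub>v (Suc m) :: int vec)"
    then have i: "i < Suc m" by simp
    have "row P i \<bullet> v = 0" if "i < m"
      using arg_cong[OF bspec[OF V(2) v], of "\<lambda>v. v $ i"] that P by simp
    then show "(P' *\<^sub>v v) $ i = 0\<^sub>v (Suc m) $ i" using i P' rowP'[OF i] w1v[OF v] by auto
  qed (use P' in auto)
  ultimately show ?thesis using P' Q' by blast
qed

text \<open>The last clause says that the kernel is the saturation of the span of \<open>vs\<close>.
  As long as it fails, \<open>extend_projection\<close> adds a row; if it always failed, there would
  be a projection of rank n + 1 with a right inverse.\<close>

lemma saturation_projection:
  assumes V: "set vs \<subseteq> carrier_vec n"
  shows "\<exists>m P Q. P \<in> carrier_mat m n \<and> Q \<in> carrier_mat n m \<and> P * Q = 1\<^sub>m m \<and>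
    (\<forall>v\<in>set vs. P *\<^sub>v v = 0\<^sub>v m) \<and>
    (\<forall>x\<in>carrier_vec n. P *\<^sub>v x = 0\<^sub>v m \<longrightarrow> (\<exists>k>0. k \<cdot>\<^sub>v x \<in> group_span n (set vs)))"
    (is ?goal)
proof (rule ccontr)
  assume contra: "\<not> ?goal"
  have "\<exists>P Q. P \<in> carrier_mat m n \<and> Q \<in> carrier_mat n m \<and> P * Q = 1\<^sub>m m \<and> (\<forall>v\<in>set vs. P *\<^sub>v v = 0\<^sub>v m)" for m
  proof (induction m)
    case 0
    show ?case
      by (intro exI[of _ "0\<^sub>m 0 n"] exI[of _ "0\<^sub>m n 0"]) auto
  next
    case (Suc m)
    then obtain P Q where PQ: "P \<in> carrier_mat m n" "Q \<in> carrier_mat n m" "P * Q = 1\<^sub>m m"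
      "\<forall>v\<in>set vs. P *\<^sub>v v = 0\<^sub>v m" by blast
    have "\<exists>x\<in>carrier_vec n. P *\<^sub>v x = 0\<^sub>v m \<and> (\<forall>k>0. k \<cdot>\<^sub>v x \<notin> group_span n (set vs))"
    proof (rule ccontr)
      assume no: "\<not> ?thesis"
      have "?goal"
        by (rule exI[of _ m], rule exI[of _ P], rule exI[of _ Q]) (use PQ no in simp)
      with contra show False ..
    qed
    then obtain x where "x \<in> carrier_vec n" "P *\<^sub>v x = 0\<^sub>v m" "\<forall>k>0. k \<cdot>\<^sub>v x \<notin> group_span n (set vs)"
      by (elim bexE conjE)
    from extend_projection[OF PQ(1-3) V PQ(4) this]
    show ?case by (elim exE conjE, intro exI conjI)
  qed
  from this[of "Suc n"] obtain P Q where "P \<in> carrier_mat (Suc n) n" "Q \<in> carrier_mat n (Suc n)"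
    "P * Q = (1\<^sub>m (Suc n) :: int mat)" by blast
  from right_inverse_dim_le[OF this] show False by simp
qed

section \<open>Certificates for quotient fans\<close>

text \<open>Reading a coordinate out of range gives \<open>0\<close>, so that all operations are total and computable.\<close>

definition coord :: "int vec \<Rightarrow> nat \<Rightarrow> int" where
  "coord v i = nth0 (list_of_vec v) i"

definition dot :: "nat \<Rightarrow> int vec \<Rightarrow> int vec \<Rightarrow> int" where
  "dot n u v = (\<Sum>i<n. coord u i * coord v i)"

definition vadd :: "nat \<Rightarrow> int vec \<Rightarrow> int vec \<Rightarrow> int vec" where
  "vadd n v w = vec n (\<lambda>i. coord v i + coord w i)"

definition apply_rows :: "nat \<Rightarrow> int vec list \<Rightarrow> int vec \<Rightarrow> int vec" where
  "apply_rows n rs v = vec (length rs) (\<lambda>i. dot n (nth0 rs i) v)"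

definition vectors :: "nat \<Rightarrow> int vec list \<Rightarrow> bool" where
  "vectors n vs \<longleftrightarrow> (\<forall>v\<in>set vs. dim_vec v = n)"

text \<open>A vector \<open>b\<close> from \<open>E\<close> is on the smallest face of the cone over \<open>E\<close> that contains the intersection
  with the cone over \<open>C\<close> iff \<open>k b + y\<close> is in the cone over \<open>C\<close> for some \<open>k > 0\<close> and some \<open>y\<close> in the cone
  over \<open>E\<close>; multiples of \<open>b\<close> can be moved into \<open>y\<close>.\<close>

definition extension_step :: "nat \<Rightarrow> int vec list \<Rightarrow> int vec list list \<Rightarrow> int vec list list \<Rightarrow> bool" where
  "extension_step n ls A B \<longleftrightarrow>
     list_all2 (\<lambda>C D. (\<forall>c\<in>set C. c \<in> set D) \<and>
       (\<forall>b\<in>set D. b \<in> set C \<or> b \<in> set ls \<or> - b \<in> set ls \<or>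
         (\<exists>E\<in>set A. b \<in> set E \<and> (\<exists>y. y \<in> cone_span n (set E) \<and> vadd n b y \<in> cone_span n (set C))))) A B"

text \<open>By the same argument, \<open>e\<close> lies on the smallest face of the cone over \<open>B\<close> that contains \<open>C\<close>.\<close>

definition lies_over :: "nat \<Rightarrow> int vec list \<Rightarrow> int vec list \<Rightarrow> int vec list \<Rightarrow> bool" where
  "lies_over m B C e \<longleftrightarrow> (\<forall>d\<in>set e. \<exists>y. y \<in> cone_span m (set B) \<and> vadd m d y \<in> cone_span m (set C))"

text \<open>A face is represented by all generators in B that lie on it, not by a generating set of
  its own. Hence equal faces have equal sets of representing vectors.\<close>

definition exposed_by :: "nat \<Rightarrow> int vec list \<Rightarrow> int vec list \<Rightarrow> int vec \<Rightarrow> bool" where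
  "exposed_by m B ds u \<longleftrightarrow> dim_vec u = m \<and> (\<forall>d\<in>set ds. d \<in> set B) \<and>
     (\<forall>b\<in>set B. 0 < dot m u b \<and> b \<notin> set ds \<or> dot m u b = 0 \<and> b \<in> set ds)"

text \<open>The cones are on opposite sides of the hyperplane of u and have the same generators on
  it. So they meet exactly in the cone over these generators, a face of both.\<close>

definition separated_by :: "nat \<Rightarrow> int vec list \<Rightarrow> int vec list \<Rightarrow> int vec \<Rightarrow> bool" where
  "separated_by m B C u \<longleftrightarrow> dim_vec u = m \<and>
     (\<forall>b\<in>set B. 0 < dot m u b \<or> dot m u b = 0 \<and> b \<in> set C) \<and>
     (\<forall>c\<in>set C. dot m u c < 0 \<or> dot m u c = 0 \<and> c \<in> set B)"

text \<open>Every face arises from the smallest one by adding generators one at a time and passing to the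
  smallest face each time.\<close>

definition face_lattice :: "nat \<Rightarrow> int vec list \<Rightarrow> int vec list list \<Rightarrow> bool" where
  "face_lattice m B es \<longleftrightarrow> (\<forall>e\<in>set es. \<forall>d\<in>set e. d \<in> set B) \<and>
     (\<exists>e\<in>set es. lies_over m B [] e) \<and>
     (\<forall>e\<in>set es. \<forall>b\<in>set B. \<exists>e'\<in>set es. b \<in> set e' \<and> (\<forall>d\<in>set e. d \<in> set e') \<and> lies_over m B (b # e) e')"

definition fan_certificate :: "nat \<Rightarrow> int vec list list \<Rightarrow> int vec list list \<Rightarrow> bool" where
  "fan_certificate m Bs dss \<longleftrightarrow>
     (\<forall>B\<in>set Bs. vectors m B) \<and>
     (\<forall>B\<in>set Bs. \<exists>u. dim_vec u = m \<and> (\<forall>b\<in>set B. b = 0\<^sub>v m \<or> 0 < dot m u b)) \<and>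
     (\<forall>B\<in>set Bs. \<forall>C\<in>set Bs. \<exists>u. separated_by m B C u) \<and>
     (\<forall>ds\<in>set dss. \<exists>B\<in>set Bs. \<exists>u. exposed_by m B ds u) \<and>
     (\<forall>B\<in>set Bs. \<exists>es. (\<forall>e\<in>set es. e \<in> set dss) \<and> face_lattice m B es)"

text \<open>The vectors \<open>qs\<close> form a right inverse, which witnesses surjectivity. The
  last clause says that the kernel is no larger than the span of \<open>hs\<close>: modulo
  \<open>hs\<close> every vector is a combination of \<open>qs\<close>, and on such combinations the
  projection is injective.\<close>

definition projection_certificate ::
  "nat \<Rightarrow> int vec list \<Rightarrow> int vec list \<Rightarrow> int vec list \<Rightarrow> bool" where
  "projection_certificate n rs qs hs \<longleftrightarrow> vectors n rs \<and> vectors n qs \<and> vectors n hs \<and>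
     length qs = length rs \<and>
     (\<forall>i<length rs. \<forall>j<length rs. dot n (nth0 rs i) (nth0 qs j) = (if i = j then 1 else 0)) \<and>
     (\<forall>r\<in>set rs. \<forall>h\<in>set hs. dot n r h = 0) \<and>
     (\<forall>j<n. unit_vec n j \<in> group_span n (set (hs @ qs)))"

text \<open>\<open>A\<close> is the enlarged system, \<open>vs\<close> spans its lineality space together with \<open>L\<close>, and \<open>Bs\<close> is the
  image of \<open>A\<close> under the projection with rows \<open>rs\<close>. That the enlargement is complete shows in the
  existence of the linear forms in the fan certificate.\<close>

definition quotient_certificate ::
  "nat \<Rightarrow> int vec list list \<Rightarrow> int vec list \<Rightarrow>
   int vec list \<Rightarrow> int vec list \<Rightarrow> int vec list list \<Rightarrow> bool" where
  "quotient_certificate n gss ls rs hs dss \<longleftrightarrow>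
     (\<exists>A vs qs Bs. (extension_step n ls)\<^sup>*\<^sup>* gss A \<and> projection_certificate n rs qs hs \<and>
       (\<forall>r\<in>set rs. \<forall>l\<in>set ls. dot n r l = 0) \<and>
       (\<forall>v\<in>set vs. v \<in> set ls \<or> (\<exists>C\<in>set A. v \<in> cone_span n (set C) \<and> - v \<in> cone_span n (set C))) \<and>
       (\<forall>h\<in>set hs. \<exists>k::int. 0 < k \<and> k \<cdot>\<^sub>v h \<in> group_span n (set vs)) \<and>
       list_all2 (\<lambda>C B. (\<forall>c\<in>set C. apply_rows n rs c \<in> set B) \<and> (\<forall>b\<in>set B. \<exists>c\<in>set C. b = apply_rows n rs c)) A Bs \<and>
       fan_certificate (length rs) Bs dss)"

lemma coord_eq: "i < dim_vec v \<Longrightarrow> coord v i = v $ i"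
  by (simp add: coord_def nth_default_def list_of_vec_index)

lemma dot_eq [simp]: "u \<in> carrier_vec n \<Longrightarrow> v \<in> carrier_vec n \<Longrightarrow> dot n u v = u \<bullet> v"
  by (simp add: dot_def scalar_prod_def coord_eq lessThan_atLeast0)

lemma vadd_eq [simp]: "v \<in> carrier_vec n \<Longrightarrow> w \<in> carrier_vec n \<Longrightarrow> vadd n v w = v + w"
  by (intro eq_vecI) (auto simp: vadd_def coord_eq)

lemma vectors_iff: "vectors n vs \<longleftrightarrow> set vs \<subseteq> carrier_vec n"
  unfolding vectors_def carrier_vec_def by blast

lemma apply_rows_eq:
  assumes "set rs \<subseteq> carrier_vec n" and "v \<in> carrier_vec n"
  shows "apply_rows n rs v = mat_of_rows n rs *\<^sub>v v"
proof (rule eq_vecI)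
  fix i assume "i < dim_vec (mat_of_rows n rs *\<^sub>v v)"
  then have i: "i < length rs" by simp
  then have "rs ! i \<in> carrier_vec n" using assms(1) by auto
  then show "apply_rows n rs v $ i = (mat_of_rows n rs *\<^sub>v v) $ i"
    using i assms(2) by (simp add: apply_rows_def nth_default_def)
qed (simp add: apply_rows_def)

lemma exposed_byD:
  assumes "exposed_by m B ds w" and B: "set B \<subseteq> carrier_vec m"
  shows "w \<in> carrier_vec m" and "set ds \<subseteq> set B"
    and "\<And>b. b \<in> set B \<Longrightarrow> 0 < w \<bullet> b \<and> b \<notin> set ds \<or> w \<bullet> b = 0 \<and> b \<in> set ds"
proof -
  show w: "w \<in> carrier_vec m" using assms(1) carrier_vec_dim_vec[of w] unfolding exposed_by_def by metis
  show "set ds \<subseteq> set B" using assms(1) unfolding exposed_by_def by blast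
  fix b assume b: "b \<in> set B"
  then have "b \<in> carrier_vec m" using B by blast
  moreover have "0 < dot m w b \<and> b \<notin> set ds \<or> dot m w b = 0 \<and> b \<in> set ds"
    using assms(1) b unfolding exposed_by_def by blast
  ultimately show "0 < w \<bullet> b \<and> b \<notin> set ds \<or> w \<bullet> b = 0 \<and> b \<in> set ds" by (simp only: dot_eq[OF w])
qed

section \<open>Semidecidability of the certificates\<close>

lemma computable_coord [computable_intros]:
  "computable f \<Longrightarrow> computable i \<Longrightarrow> computable (\<lambda>x. coord (f x) (i x))"
  unfolding coord_def by (intro computable_intros)

lemma computable_dot [computable_intros]:
  assumes "computable n" "computable f" "computable g"
  shows "computable (\<lambda>x. dot (n x) (f x) (g x))"
  unfolding dot_def by (intro computable_intros assms assms[THEN computable_comp])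

lemma computable_vadd [computable_intros]:
  assumes "computable n" "computable f" "computable g"
  shows "computable (\<lambda>x. vadd (n x) (f x) (g x))"
  unfolding vadd_def by (intro computable_intros assms assms[THEN computable_comp])

lemma computable_apply_rows [computable_intros]:
  assumes "computable n" "computable f" "computable g"
  shows "computable (\<lambda>x. apply_rows (n x) (f x) (g x))"
  unfolding apply_rows_def
  by (intro computable_intros assms assms[THEN computable_comp])

lemma computable_smult_vec [computable_intros]:
  fixes f :: "'a::coded \<Rightarrow> int vec"
  assumes "computable k" "computable f"
  shows "computable (\<lambda>x. k x \<cdot>\<^sub>v f x)"
proof -
  have "k \<cdot>\<^sub>v v = vec (dim_vec v) (\<lambda>i. k * coord v i)" for k and v :: "int vec"
    by (intro eq_vecI) (auto simp: coord_eq)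
  then show ?thesis
    by (simp only:) (intro computable_intros assms assms[THEN computable_comp])
qed

lemma computable_uminus_vec [computable_intros]:
  fixes f :: "'a::coded \<Rightarrow> int vec"
  assumes "computable f"
  shows "computable (\<lambda>x. - f x)"
proof -
  have "- v = (- 1) \<cdot>\<^sub>v v" for v :: "int vec" by (intro eq_vecI) auto
  then show ?thesis by (simp only:) (intro computable_intros assms)
qed

lemma computable_zero_vec [computable_intros]: "computable n \<Longrightarrow> computable (\<lambda>x. 0\<^sub>v (n x) :: int vec)"
  unfolding zero_vec_def by (intro computable_intros)

lemma computable_unit_vec [computable_intros]:
  assumes "computable n" "computable i"
  shows "computable (\<lambda>x. unit_vec (n x) (i x) :: int vec)"
  unfolding unit_vec_def by (intro computable_intros assms computable_comp[OF assms(2)])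

lemma computable_append [computable_intros]:
  assumes "computable f" "computable g"
  shows "computable (\<lambda>x. f x @ g x)"
proof -
  have "xs @ ys = map (\<lambda>i. if i < length xs then nth0 xs i else nth0 ys (i - length xs)) [0..<length xs + length ys]"
    for xs ys :: "'b list"
    by (rule nth_equalityI) (auto simp: nth_default_def nth_append)
  then show ?thesis
    by (simp only:) (intro computable_intros assms assms[THEN computable_comp])
qed

lemmas semidecidable_decidable = decidable_semidecidable[OF decidable_eq]
  decidable_semidecidable[OF decidable_less_nat] decidable_semidecidable[OF decidable_less_int]

lemma decidable_mem [computable_intros]:
  assumes "computable f" "computable g"
  shows "decidable (\<lambda>x. f x \<in> set (g x))"
proof -
  have "y \<in> set ys \<longleftrightarrow> (\<exists>i<length ys. nth0 ys i = y)" for y :: 'b and ys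
    by (auto simp: in_set_conv_nth nth_default_def)
  then show ?thesis
    by (simp only:) (intro computable_intros assms assms[THEN computable_comp])
qed

lemmas semidecidable_mem [semidecidable_intros] = decidable_semidecidable[OF decidable_mem]

lemma semidecidable_list_all2 [semidecidable_intros]:
  fixes f :: "'a::coded \<Rightarrow> 'b::coded list" and g :: "'a \<Rightarrow> 'c::coded list"
  assumes R: "semidecidable (\<lambda>p. R (fst p) (fst (snd p)) (snd (snd p)))" and f: "computable f" and g: "computable g"
  shows "semidecidable (\<lambda>x. list_all2 (R x) (f x) (g x))"
proof -
  have R': "semidecidable (\<lambda>x. R (a x) (b x) (c x))" if "computable a" "computable b" "computable c" for a b c
    using semidecidable_comp[OF R computable_Pair[OF that(1) computable_Pair[OF that(2,3)]]] by simp
  have "list_all2 S xs ys \<longleftrightarrow> length xs = length ys \<and> (\<forall>i<length xs. S (nth0 xs i) (nth0 ys i))"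
    for S and xs :: "'b list" and ys :: "'c list"
    by (auto simp: list_all2_conv_all_nth nth_default_def)
  then show ?thesis
    by (simp only:) (intro semidecidable_conj semidecidable_All_less semidecidable_decidable R' computable_intros
      f g computable_comp[OF f] computable_comp[OF g])
qed

text \<open>The inductive definition is read as reachability from 0, where one step adds a
  nonnegative multiple of one generator.\<close>

lemma semidecidable_cone_span [semidecidable_intros]:
  fixes v :: "'a::coded \<Rightarrow> int vec"
  assumes n: "computable n" and v: "computable v" and xs: "computable xs"
  shows "semidecidable (\<lambda>p. v p \<in> cone_span (n p) (set (xs p)))"
proof -
  define step where "step n xs x y \<longleftrightarrow> (\<exists>a\<in>set xs. dim_vec a = n \<and> (\<exists>r::int. 0 \<le> r \<and> y = vadd n x (r \<cdot>\<^sub>v a)))"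
    for n xs x y
  have "v \<in> cone_span n (set xs) \<longleftrightarrow> (step n xs)\<^sup>*\<^sup>* (0\<^sub>v n) v" for v n xs
  proof
    assume "v \<in> cone_span n (set xs)"
    then show "(step n xs)\<^sup>*\<^sup>* (0\<^sub>v n) v"
    proof induction
      case (add v a r)
      then have "step n xs v (v + r \<cdot>\<^sub>v a)"
        unfolding step_def using cone_span_carrier[OF add(1)]
        by (intro bexI[of _ a] conjI exI[of _ r]) auto
      with add(5) show ?case by (rule rtranclp.rtrancl_into_rtrancl)
    qed simp
  next
    assume "(step n xs)\<^sup>*\<^sup>* (0\<^sub>v n) v"
    then show "v \<in> cone_span n (set xs)"
    proof induction
      case (step x y)
      then obtain a r where a: "a \<in> set xs" "dim_vec a = n" "0 \<le> r" "y = vadd n x (r \<cdot>\<^sub>v a)"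
        unfolding step_def by blast
      then have "a \<in> carrier_vec n" by (metis carrier_vec_dim_vec)
      then show ?case using a step(3) cone_span.add[OF step(3) a(1)] cone_span_carrier[OF step(3)] by simp
    qed (rule cone_span.zero)
  qed
  then show ?thesis
    unfolding step_def
    by (simp only:) (intro semidecidable_intros semidecidable_decidable decidable_semidecidable[OF decidable_le_int]
        computable_intros v computable_comp[OF n] computable_comp[OF xs])
qed

lemma semidecidable_group_span [semidecidable_intros]:
  assumes n: "computable n" and v: "computable v" and xs: "computable xs"
  shows "semidecidable (\<lambda>p. v p \<in> group_span (n p) (set (xs p)))"
proof -
  have "map uminus xs = map (\<lambda>i. - nth0 xs i) [0..<length xs]" for xs :: "int vec list"
    by (rule nth_equalityI) (auto simp: nth_default_def)
  then have "group_span n (set xs) = cone_span n (set (xs @ map (\<lambda>i. - nth0 xs i) [0..<length xs]))" for n xs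
    by (metis set_append set_map)
  then show ?thesis
    by (simp only:) (intro semidecidable_cone_span computable_intros n v xs computable_comp[OF xs])
qed

lemma semidecidable_extension_step:
  "semidecidable (\<lambda>p. extension_step (fst (fst p)) (snd (fst p)) (fst (snd p)) (snd (snd p)))"
  unfolding extension_step_def by (intro semidecidable_intros computable_intros)

lemma semidecidable_lies_over [semidecidable_intros]:
  assumes "computable m" "computable B" "computable C" "computable e"
  shows "semidecidable (\<lambda>x. lies_over (m x) (B x) (C x) (e x))"
  unfolding lies_over_def
  by (intro semidecidable_intros computable_intros assms computable_comp[OF assms(1)]
      assms[THEN computable_comp])

lemma semidecidable_exposed_by [semidecidable_intros]:
  assumes "computable m" "computable B" "computable ds" "computable u"
  shows "semidecidable (\<lambda>x. exposed_by (m x) (B x) (ds x) (u x))"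
  unfolding exposed_by_def
  by (intro semidecidable_intros semidecidable_decidable decidable_semidecidable[OF decidable_not] computable_intros
      assms assms[THEN computable_comp])

lemma semidecidable_separated_by [semidecidable_intros]:
  assumes "computable m" "computable B" "computable C" "computable u"
  shows "semidecidable (\<lambda>x. separated_by (m x) (B x) (C x) (u x))"
  unfolding separated_by_def
  by (intro semidecidable_intros semidecidable_decidable computable_intros assms assms[THEN computable_comp])

lemma semidecidable_face_lattice [semidecidable_intros]:
  assumes "computable m" "computable B" "computable es"
  shows "semidecidable (\<lambda>x. face_lattice (m x) (B x) (es x))"
  unfolding face_lattice_def
  by (intro semidecidable_intros computable_intros assms assms[THEN computable_comp])

lemma semidecidable_vectors [semidecidable_intros]:
  assumes "computable n" "computable vs"
  shows "semidecidable (\<lambda>x. vectors (n x) (vs x))"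
  unfolding vectors_def
  by (intro semidecidable_intros semidecidable_decidable computable_intros assms assms[THEN computable_comp])

lemma semidecidable_fan_certificate [semidecidable_intros]:
  assumes "computable m" "computable Bs" "computable dss"
  shows "semidecidable (\<lambda>x. fan_certificate (m x) (Bs x) (dss x))"
  unfolding fan_certificate_def
  by (intro semidecidable_intros semidecidable_decidable computable_intros assms assms[THEN computable_comp])

lemma semidecidable_projection_certificate [semidecidable_intros]:
  assumes "computable n" "computable rs" "computable qs" "computable hs"
  shows "semidecidable (\<lambda>x. projection_certificate (n x) (rs x) (qs x) (hs x))"
  unfolding projection_certificate_def
  by (intro semidecidable_intros semidecidable_All_less semidecidable_decidable computable_intros
      assms assms[THEN computable_comp])

lemma semidecidable_quotient_certificate [semidecidable_intros]:
  assumes "computable n" "computable gss" "computable ls" "computable rs" "computable hs" "computable dss"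
  shows "semidecidable (\<lambda>x. quotient_certificate (n x) (gss x) (ls x) (rs x) (hs x) (dss x))"
proof -
  have step: "semidecidable (\<lambda>p. extension_step (f p) (g p) (h p) (k p))"
    if "computable f" "computable g" "computable h" "computable k" for f g h k
    using semidecidable_comp[OF semidecidable_extension_step
        computable_Pair[OF computable_Pair[OF that(1,2)] computable_Pair[OF that(3,4)]]] by simp
  show ?thesis
    unfolding quotient_certificate_def
    by (intro semidecidable_intros step semidecidable_decidable computable_intros assms assms[THEN computable_comp])
qed

section \<open>Real cones generated by integer vectors\<close>

abbreviation real_vec :: "int vec \<Rightarrow> real vec" where
  "real_vec \<equiv> map_vec real_of_int"

lemma real_vec_add: "v \<in> carrier_vec n \<Longrightarrow> w \<in> carrier_vec n \<Longrightarrow> real_vec (v + w) = real_vec v + real_vec w"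
  by (intro eq_vecI) auto

lemma real_vec_smult: "real_vec (k \<cdot>\<^sub>v v) = real_of_int k \<cdot>\<^sub>v real_vec v"
  by (intro eq_vecI) auto

lemma real_vec_uminus: "real_vec (- v) = - real_vec v"
  by (intro eq_vecI) auto

lemma real_vec_zero: "real_vec (0\<^sub>v n) = 0\<^sub>v n"
  by (intro eq_vecI) auto

lemma real_vec_scalar_prod:
  "u \<in> carrier_vec n \<Longrightarrow> v \<in> carrier_vec n \<Longrightarrow> real_vec u \<bullet> real_vec v = real_of_int (u \<bullet> v)"
  by (simp add: scalar_prod_def)

lemma real_vec_mult:
  assumes "P \<in> carrier_mat m n" and "v \<in> carrier_vec n"
  shows "map_mat real_of_int P *\<^sub>v real_vec v = real_vec (P *\<^sub>v v)"
proof (rule eq_vecI)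
  fix i assume "i < dim_vec (real_vec (P *\<^sub>v v))"
  then have i: "i < m" using assms by simp
  have "row (map_mat real_of_int P) i = real_vec (row P i)" using i assms by (intro eq_vecI) auto
  then show "(map_mat real_of_int P *\<^sub>v real_vec v) $ i = real_vec (P *\<^sub>v v) $ i"
    using i assms real_vec_scalar_prod[of "row P i" n v] by auto
qed (use assms in simp)

lemma real_vec_cone_span:
  assumes "v \<in> cone_span n A"
  shows "real_vec v \<in> cone_span n (real_vec ` A)"
  using assms
proof induction
  case zero
  then show ?case by (simp add: real_vec_zero cone_span.zero)
next
  case (add v a r)
  have "real_vec (v + r \<cdot>\<^sub>v a) = real_vec v + real_of_int r \<cdot>\<^sub>v real_vec a"
    using add(3) cone_span_carrier[OF add(1)] by (simp add: real_vec_add[of _ n] real_vec_smult)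
  then show ?case using add by (auto intro!: cone_span.add)
qed

text \<open>Coefficient vectors are traded for the inductive \<open>cone_span\<close>, so that the
  lemmas shared by integer and real cones become available.\<close>

lemma generated_cone_eq:
  assumes vs: "set vs \<subseteq> carrier_vec n"
  shows "generated_cone n vs = cone_span n (real_vec ` set vs)"
proof
  let ?M = "map_mat real_of_int (mat_of_cols n vs)"
  have M: "?M \<in> carrier_mat n (length vs)" by simp
  have col: "col ?M k = real_vec (vs ! k)" if "k < length vs" for k
  proof -
    have "vs ! k \<in> carrier_vec n" using that vs nth_mem by blast
    then show ?thesis using that by (intro eq_vecI) auto
  qed
  show "generated_cone n vs \<subseteq> cone_span n (real_vec ` set vs)"
  proof
    fix x assume "x \<in> generated_cone n vs"
    then obtain c where c: "c \<in> carrier_vec (length vs)" "\<forall>i<length vs. 0 \<le> c $ i" "x = ?M *\<^sub>v c"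
      by (auto simp: generated_cone_def)
    have "?M *\<^sub>v c \<in> cone_span n (real_vec ` set vs)"
    proof (rule mult_mat_vec_induct[OF M c(1)])
      show "0\<^sub>v n \<in> cone_span n (real_vec ` set vs)" by (rule cone_span.zero)
    next
      fix x k assume x: "x \<in> cone_span n (real_vec ` set vs)" and k: "k < length vs"
      have "real_vec (vs ! k) \<in> carrier_vec n" using k vs nth_mem by fastforce
      then show "x + c $ k \<cdot>\<^sub>v col ?M k \<in> cone_span n (real_vec ` set vs)"
        unfolding col[OF k] using k c(2) by (intro cone_span.add[OF x]) auto
    qed
    then show "x \<in> cone_span n (real_vec ` set vs)" using c(3) by simp
  qed
  show "cone_span n (real_vec ` set vs) \<subseteq> generated_cone n vs"
  proof
    fix x assume "x \<in> cone_span n (real_vec ` set vs)"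
    then have "\<exists>c\<in>carrier_vec (length vs). (\<forall>i<length vs. 0 \<le> c $ i) \<and> x = ?M *\<^sub>v c"
    proof induction
      case zero
      show ?case by (intro bexI[of _ "0\<^sub>v (length vs)"]) (auto simp: mult_mat_zero_vec[OF M])
    next
      case (add v a r)
      then obtain c where c: "c \<in> carrier_vec (length vs)" "\<forall>i<length vs. 0 \<le> c $ i" "v = ?M *\<^sub>v c" by blast
      obtain k where k: "k < length vs" "a = real_vec (vs ! k)" using add(2) by (auto simp: in_set_conv_nth)
      then have "v + r \<cdot>\<^sub>v a = ?M *\<^sub>v (c + r \<cdot>\<^sub>v unit_vec (length vs) k)"
        using c(1,3) by (simp add: mult_add_distrib_mat_vec[OF M] mult_mat_vec_smult[OF M]
            mult_mat_unit_vec[OF M] col del: col_map_mat)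
      moreover have "\<forall>i<length vs. 0 \<le> (c + r \<cdot>\<^sub>v unit_vec (length vs) k) $ i"
        using c(1,2) add(4) by (simp add: unit_vec_def)
      ultimately show ?case using c(1) by (intro bexI[of _ "c + r \<cdot>\<^sub>v unit_vec (length vs) k"]) auto
    qed
    then show "x \<in> generated_cone n vs" by (auto simp: generated_cone_def)
  qed
qed

lemma scalar_prod_cone_span_eq_0:
  assumes "u \<in> carrier_vec n" and "\<And>a. a \<in> A \<Longrightarrow> a \<in> carrier_vec n \<Longrightarrow> u \<bullet> a = 0" and "v \<in> cone_span n A"
  shows "u \<bullet> v = 0"
  using assms(3)
proof induction
  case (add v a r)
  then show ?case
    using assms(1,2) cone_span_carrier[OF add(1)] by (simp add: scalar_prod_add_distrib[of _ n])
qed (use assms(1) in simp)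

section \<open>The fan described by a certificate\<close>

lemma cone_face_generated_cone:
  assumes ds: "set ds \<subseteq> carrier_vec m" and e: "set e = {d \<in> set ds. u \<bullet> real_vec d = 0}"
    and u: "u \<in> carrier_vec m" "\<And>d. d \<in> set ds \<Longrightarrow> 0 \<le> u \<bullet> real_vec d"
  shows "{x \<in> generated_cone m ds. u \<bullet> x = 0} = generated_cone m e"
proof -
  have "set e \<subseteq> carrier_vec m" using ds e by blast
  note eqs = generated_cone_eq[OF ds] generated_cone_eq[OF this]
  have img: "{a \<in> real_vec ` set ds. u \<bullet> a = 0} = real_vec ` set e" using e by blast
  show ?thesis
  proof (intro equalityI subsetI)
    fix x assume x: "x \<in> {x \<in> generated_cone m ds. u \<bullet> x = 0}"
    show "x \<in> generated_cone m e"
      unfolding eqs img[symmetric]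
    proof (rule cone_span_face[OF u(1)])
      show "x \<in> cone_span m (real_vec ` set ds)" using x eqs(1) by blast
      show "u \<bullet> x = 0" using x by blast
    qed (use u(2) in blast)
  next
    fix x assume x: "x \<in> generated_cone m e"
    then have "u \<bullet> x = 0"
      unfolding eqs by (rule scalar_prod_cone_span_eq_0[OF u(1), rotated]) (use e in blast)
    moreover have "cone_span m (real_vec ` set e) \<subseteq> cone_span m (real_vec ` set ds)"
      using e by (intro cone_span_mono) auto
    ultimately show "x \<in> {x \<in> generated_cone m ds. u \<bullet> x = 0}" using x unfolding eqs by blast
  qed
qed

text \<open>u is known to be nonnegative only on the face \<open>ds\<close>, not on all of B, so two
  forms are used in turn. Since w vanishes on d + y, it forces d and y into the cone over
  \<open>ds\<close>; there u vanishes on d + y and forces d into the smaller face.\<close>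

lemma lies_over_subset_face:
  assumes B: "set B \<subseteq> carrier_vec m" and w: "exposed_by m B ds w"
    and u: "u \<in> carrier_vec m" "\<And>d. d \<in> set ds \<Longrightarrow> 0 \<le> u \<bullet> real_vec d"
    and C: "set C \<subseteq> {d \<in> set ds. u \<bullet> real_vec d = 0}"
    and e: "set e \<subseteq> set B" "lies_over m B C e"
  shows "set e \<subseteq> {d \<in> set ds. u \<bullet> real_vec d = 0}"
proof
  fix d assume d: "d \<in> set e"
  note wc = exposed_byD(1)[OF w B] and ds = exposed_byD(2)[OF w B] and wB = exposed_byD(3)[OF w B]
  have wds: "w \<bullet> a = 0" if "a \<in> set ds" for a using wB[of a] that ds by blast
  have wnn: "0 \<le> w \<bullet> b" if "b \<in> set B" for b using wB[OF that] by linarith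
  have dc: "d \<in> carrier_vec m" "d \<in> set B" using d e(1) B by blast+
  obtain y where y: "y \<in> cone_span m (set B)" "vadd m d y \<in> cone_span m (set C)"
    using e(2) d unfolding lies_over_def by blast
  have yc: "y \<in> carrier_vec m" by (rule cone_span_carrier[OF y(1)])
  have dy: "d + y \<in> cone_span m (set C)" using y(2) dc yc by simp
  have "w \<bullet> (d + y) = 0"
    by (rule scalar_prod_cone_span_eq_0[OF wc _ dy]) (use C wds in blast)
  then have "w \<bullet> d + w \<bullet> y = 0" using wc dc yc by (simp add: scalar_prod_add_distrib[of _ m])
  moreover have "0 \<le> w \<bullet> d" using wnn dc(2) .
  moreover have "0 \<le> w \<bullet> y" by (rule scalar_prod_cone_span_nonneg[OF wc _ y(1)]) (use wnn in blast)
  ultimately have 0: "w \<bullet> d = 0" "w \<bullet> y = 0" by linarith+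
  have dds: "d \<in> set ds" using 0(1) wB[OF dc(2)] by linarith
  have "y \<in> cone_span m {b \<in> set B. w \<bullet> b = 0}"
    by (rule cone_span_face[OF wc _ y(1) 0(2)]) (use wnn in blast)
  moreover have "{b \<in> set B. w \<bullet> b = 0} \<subseteq> set ds" using wB by fastforce
  ultimately have "y \<in> cone_span m (set ds)" using cone_span_mono[of "{b \<in> set B. w \<bullet> b = 0}"] by blast
  then have "real_vec y \<in> cone_span m (real_vec ` set ds)" by (rule real_vec_cone_span)
  then have "0 \<le> u \<bullet> real_vec y"
    by (rule scalar_prod_cone_span_nonneg[OF u(1), rotated]) (use u(2) in blast)
  moreover have "0 \<le> u \<bullet> real_vec d" by (rule u(2)[OF dds])
  moreover have "u \<bullet> real_vec (d + y) = 0"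
    by (rule scalar_prod_cone_span_eq_0[OF u(1) _ real_vec_cone_span[OF dy]]) (use C in blast)
  moreover have "u \<bullet> real_vec (d + y) = u \<bullet> real_vec d + u \<bullet> real_vec y"
    using u(1) dc yc by (simp add: real_vec_add[of _ m] scalar_prod_add_distrib[of _ m])
  ultimately have "u \<bullet> real_vec d = 0" by linarith
  with dds show "d \<in> {d \<in> set ds. u \<bullet> real_vec d = 0}" by simp
qed

text \<open>There are infinitely many real forms u, but only the finite set of generators killed by
  u matters. By \<open>lies_over_subset_face\<close> the listed faces that grow towards this set
  never leave it, so one of them equals it.\<close>

lemma face_lattice_complete:
  assumes B: "set B \<subseteq> carrier_vec m" and w: "exposed_by m B ds w" and es: "face_lattice m B es"
    and u: "u \<in> carrier_vec m" "\<And>d. d \<in> set ds \<Longrightarrow> 0 \<le> u \<bullet> real_vec d"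
  shows "\<exists>e\<in>set es. set e = {d \<in> set ds. u \<bullet> real_vec d = 0}"
proof -
  let ?X = "{d \<in> set ds. u \<bullet> real_vec d = 0}"
  note ds = exposed_byD(2)[OF w B]
  have eB: "set e \<subseteq> set B" if "e \<in> set es" for e using es that unfolding face_lattice_def by blast
  have "\<exists>e\<in>set es. C \<subseteq> set e \<and> set e \<subseteq> ?X" if "finite C" "C \<subseteq> ?X" for C
    using that
  proof (induction rule: finite_induct)
    case empty
    obtain e where e: "e \<in> set es" "lies_over m B [] e" using es unfolding face_lattice_def by blast
    have "set e \<subseteq> ?X" by (rule lies_over_subset_face[OF B w u _ eB[OF e(1)] e(2)]) simp_all
    then show ?case using e(1) by blast
  next
    case (insert b C)
    then obtain e where e: "e \<in> set es" "C \<subseteq> set e" "set e \<subseteq> ?X" by blast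
    have "b \<in> set B" using insert(4) ds by blast
    then obtain e' where e': "e' \<in> set es" "b \<in> set e'" "\<forall>d\<in>set e. d \<in> set e'" "lies_over m B (b # e) e'"
      using es e(1) unfolding face_lattice_def by blast
    have "set e' \<subseteq> ?X"
      by (rule lies_over_subset_face[OF B w u _ eB[OF e'(1)] e'(4)]) (use insert(4) e(3) in auto)
    then show ?case using e' e(2) by blast
  qed
  from this[of ?X] show ?thesis by auto
qed

lemma real_vec_scalar_prod_nonneg_cone:
  assumes "u \<in> carrier_vec m" and "set ds \<subseteq> carrier_vec m" and "\<And>d. d \<in> set ds \<Longrightarrow> 0 \<le> u \<bullet> d"
    and "x \<in> generated_cone m ds"
  shows "0 \<le> real_vec u \<bullet> x"
  using assms(4) unfolding generated_cone_eq[OF assms(2)]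
proof (rule scalar_prod_cone_span_nonneg[rotated 2])
  fix a assume "a \<in> real_vec ` set ds"
  then obtain d where "d \<in> set ds" "a = real_vec d" by blast
  then show "0 \<le> real_vec u \<bullet> a"
    using assms(1-3) real_vec_scalar_prod[of u m d] by auto
qed (use assms(1) in simp)

text \<open>On generators in \<open>ds\<close> off the hyperplane of u, the form K u + w is positive
  since K exceeds all values of w in absolute terms. On the hyperplane it agrees with w, and the
  generators there belong to C, where w vanishes on \<open>es\<close> and is positive
  elsewhere.\<close>

lemma intersection_is_face:
  assumes B: "set B \<subseteq> carrier_vec m" and C: "set C \<subseteq> carrier_vec m"
    and u: "separated_by m B C u" and ds: "set ds \<subseteq> set B" and es: "exposed_by m C es w"
  shows "cone_face m (generated_cone m ds \<inter> generated_cone m es) (generated_cone m ds)"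
proof -
  have uc: "u \<in> carrier_vec m" using u carrier_vec_dim_vec[of u] unfolding separated_by_def by metis
  note wc = exposed_byD(1)[OF es C] and esC = exposed_byD(2)[OF es C] and wC = exposed_byD(3)[OF es C]
  have dsc: "set ds \<subseteq> carrier_vec m" using ds B by blast
  have esc: "set es \<subseteq> carrier_vec m" using esC C by blast
  have uB: "0 < u \<bullet> b \<or> u \<bullet> b = 0 \<and> b \<in> set C" if b: "b \<in> set B" for b
  proof -
    have "b \<in> carrier_vec m" using b B by blast
    moreover have "0 < dot m u b \<or> dot m u b = 0 \<and> b \<in> set C" using u b unfolding separated_by_def by blast
    ultimately show ?thesis by (simp only: dot_eq[OF uc])
  qed
  have uC: "u \<bullet> c \<le> 0" if c: "c \<in> set C" for c
  proof -
    have "c \<in> carrier_vec m" using c C by blast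
    moreover have "dot m u c \<le> 0" using u c unfolding separated_by_def by fastforce
    ultimately show ?thesis by (simp only: dot_eq[OF uc])
  qed
  \<comment> \<open>for large \<open>K\<close>, the form \<open>K u + w\<close> exposes the intersection\<close>
  define K where "K = (\<Sum>d\<in>set ds. \<bar>w \<bullet> d\<bar>) + 1"
  have K: "\<bar>w \<bullet> d\<bar> < K" if "d \<in> set ds" for d
    using member_le_sum[OF that, of "\<lambda>d. \<bar>w \<bullet> d\<bar>"] by (simp add: K_def)
  have K0: "0 < K" unfolding K_def by (simp add: sum_nonneg add_nonneg_pos)
  define v where "v = K \<cdot>\<^sub>v u + w"
  have vc: "v \<in> carrier_vec m" using uc wc by (simp add: v_def)
  have v: "0 < v \<bullet> d \<or> v \<bullet> d = 0 \<and> d \<in> set es \<and> u \<bullet> d = 0" if d: "d \<in> set ds" for d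
  proof -
    have dc: "d \<in> carrier_vec m" "d \<in> set B" using d dsc ds by blast+
    have eq: "v \<bullet> d = K * (u \<bullet> d) + w \<bullet> d"
      using uc wc dc by (simp add: v_def add_scalar_prod_distrib[of _ m])
    from uB[OF dc(2)] show ?thesis
    proof
      assume "0 < u \<bullet> d"
      then have "K * 1 \<le> K * (u \<bullet> d)" using K0 by (intro mult_left_mono) auto
      then show ?thesis using eq K[OF d] by linarith
    next
      assume "u \<bullet> d = 0 \<and> d \<in> set C"
      then show ?thesis using eq wC[of d] by auto
    qed
  qed
  show ?thesis
    unfolding cone_face_def
  proof (intro bexI[of _ "real_vec v"] conjI ballI)
    show "real_vec v \<in> carrier_vec m" using vc by simp
    show "0 \<le> real_vec v \<bullet> x" if "x \<in> generated_cone m ds" for x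
    proof (rule real_vec_scalar_prod_nonneg_cone[OF vc dsc _ that])
      fix d assume "d \<in> set ds"
      from v[OF this] show "0 \<le> v \<bullet> d" by linarith
    qed
    have vr: "real_vec v \<bullet> real_vec d = real_of_int (v \<bullet> d)" if "d \<in> set ds" for d
      using that vc dsc by (intro real_vec_scalar_prod) auto
    have "x \<in> generated_cone m es" if x: "x \<in> generated_cone m ds" "real_vec v \<bullet> x = 0" for x
    proof -
      have "x \<in> cone_span m {a \<in> real_vec ` set ds. real_vec v \<bullet> a = 0}"
      proof (rule cone_span_face)
        show "x \<in> cone_span m (real_vec ` set ds)" using x(1) generated_cone_eq[OF dsc] by simp
        fix a assume "a \<in> real_vec ` set ds"
        then obtain d where d: "d \<in> set ds" "a = real_vec d" by blast
        from v[OF d(1)] show "0 \<le> real_vec v \<bullet> a" unfolding d(2) vr[OF d(1)] by linarith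
      next
        show "real_vec v \<bullet> x = 0" by (rule x(2))
      qed (use vc in simp)
      moreover have "{a \<in> real_vec ` set ds. real_vec v \<bullet> a = 0} \<subseteq> real_vec ` set es"
      proof
        fix a assume "a \<in> {a \<in> real_vec ` set ds. real_vec v \<bullet> a = 0}"
        then obtain d where d: "d \<in> set ds" "a = real_vec d" "real_vec v \<bullet> real_vec d = 0" by blast
        then have "d \<in> set es" using v[OF d(1)] vr[OF d(1)] by auto
        then show "a \<in> real_vec ` set es" using d(2) by blast
      qed
      ultimately show ?thesis
        using cone_span_mono[of "{a \<in> real_vec ` set ds. real_vec v \<bullet> a = 0}"]
        unfolding generated_cone_eq[OF esc] by blast
    qed
    moreover have "real_vec v \<bullet> x = 0" if x: "x \<in> generated_cone m ds" "x \<in> generated_cone m es" for x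
    proof -
      have xc: "x \<in> carrier_vec m" using x(1) cone_span_carrier unfolding generated_cone_eq[OF dsc] by blast
      have "0 \<le> real_vec u \<bullet> x"
      proof (rule real_vec_scalar_prod_nonneg_cone[OF uc dsc _ x(1)])
        fix d assume "d \<in> set ds"
        then have "d \<in> set B" using ds by blast
        from uB[OF this] show "0 \<le> u \<bullet> d" by linarith
      qed
      moreover have "0 \<le> real_vec (- u) \<bullet> x"
      proof (rule real_vec_scalar_prod_nonneg_cone[OF _ esc _ x(2)])
        fix d assume d: "d \<in> set es"
        have "- u \<bullet> d = - (u \<bullet> d)" using esc uc d by (intro scalar_prod_uminus_left) auto
        moreover have "u \<bullet> d \<le> 0" using uC d esC by blast
        ultimately show "0 \<le> - u \<bullet> d" by linarith
      qed (use uc in simp)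
      ultimately have 0: "real_vec u \<bullet> x = 0"
        using uc xc by (simp add: real_vec_uminus)
      have "real_vec w \<bullet> x = 0"
      proof (rule scalar_prod_cone_span_eq_0)
        show "x \<in> cone_span m (real_vec ` set es)" using x(2) generated_cone_eq[OF esc] by simp
        fix a assume "a \<in> real_vec ` set es"
        then obtain d where d: "d \<in> set es" "a = real_vec d" by blast
        then have "w \<bullet> d = 0" "d \<in> carrier_vec m" using wC[of d] esC esc by blast+
        then show "real_vec w \<bullet> a = 0" using d(2) wc by (simp add: real_vec_scalar_prod[of _ m])
      qed (use wc in simp)
      then show ?thesis
        using 0 uc wc xc by (simp add: v_def real_vec_add[of _ m] real_vec_smult add_scalar_prod_distrib[of _ m])
    qed
    ultimately show "generated_cone m ds \<inter> generated_cone m es = {x \<in> generated_cone m ds. real_vec v \<bullet> x = 0}"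
      by blast
  qed
qed

section \<open>Lines in cones and strict convexity\<close>

lemma subspaceD:
  assumes "VectorSpace.subspace class_ring W (module_vec TYPE(real) n)"
  shows "W \<subseteq> carrier_vec n" and "0\<^sub>v n \<in> W" and "\<And>x. x \<in> W \<Longrightarrow> - x \<in> W"
proof -
  have sub: "submodule class_ring W (module_vec TYPE(real) n)"
    using assms unfolding subspace_def by blast
  show W: "W \<subseteq> carrier_vec n" using submodule.subset[OF sub] by (simp add: module_vec_simps)
  show "0\<^sub>v n \<in> W" using submodule.zero_closed[OF sub] by (simp add: module_vec_simps)
  fix x assume x: "x \<in> W"
  have "(- 1) \<cdot>\<^sub>v x \<in> W"
    using submodule.smult_closed[OF sub _ x, of "- 1"] by (simp add: module_vec_simps class_ring_simps)
  moreover have "(- 1) \<cdot>\<^sub>v x = - x" by (intro eq_vecI) auto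
  ultimately show "- x \<in> W" by simp
qed

text \<open>Makes strict convexity of the target cones usable: if such a cone contains x and - x, it
  contains this line, hence x = 0.\<close>

lemma subspace_line:
  assumes x: "x \<in> carrier_vec n"
  shows "VectorSpace.subspace class_ring {r \<cdot>\<^sub>v x |r :: real. True} (module_vec TYPE(real) n)"
  unfolding subspace_def
proof
  show "vectorspace class_ring (module_vec TYPE(real) n)" by (rule vec_vs)
  show "submodule class_ring {r \<cdot>\<^sub>v x |r. True} (module_vec TYPE(real) n)"
  proof (rule submodule.intro)
    show "module class_ring (module_vec TYPE(real) n)" by (rule vec_module)
  next
    fix v w assume "v \<in> {r \<cdot>\<^sub>v x |r. True}" "w \<in> {r \<cdot>\<^sub>v x |r. True}"
    then obtain r s where "v = r \<cdot>\<^sub>v x" "w = s \<cdot>\<^sub>v x" by blast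
    then have "v + w = (r + s) \<cdot>\<^sub>v x" by (simp add: add_smult_distrib_vec)
    then show "v \<oplus>\<^bsub>module_vec TYPE(real) n\<^esub> w \<in> {r \<cdot>\<^sub>v x |r. True}"
      by (auto simp: module_vec_simps)
  next
    have "0\<^sub>v n = 0 \<cdot>\<^sub>v x" using x by (intro eq_vecI) auto
    then show "\<zero>\<^bsub>module_vec TYPE(real) n\<^esub> \<in> {r \<cdot>\<^sub>v x |r. True}"
      by (auto simp: module_vec_simps)
  next
    fix c v assume "v \<in> {r \<cdot>\<^sub>v x |r. True}"
    then obtain r where "v = r \<cdot>\<^sub>v x" by blast
    then have "c \<cdot>\<^sub>v v = (c * r) \<cdot>\<^sub>v x" by (simp add: smult_smult_assoc)
    then show "c \<odot>\<^bsub>module_vec TYPE(real) n\<^esub> v \<in> {r \<cdot>\<^sub>v x |r. True}"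
      by (auto simp: module_vec_simps)
  qed (use x in \<open>auto simp: module_vec_simps\<close>)
qed

lemma strictly_convex_generated_cone:
  assumes ds: "set ds \<subseteq> carrier_vec m" and u: "u \<in> carrier_vec m"
    and pos: "\<And>d. d \<in> set ds \<Longrightarrow> d = 0\<^sub>v m \<or> 0 < u \<bullet> d"
  shows "strictly_convex m (generated_cone m ds)"
  unfolding strictly_convex_def
proof (intro allI impI, elim conjE)
  fix W assume sub: "VectorSpace.subspace class_ring W (module_vec TYPE(real) m)"
    and W: "W \<subseteq> generated_cone m ds"
  have nn: "0 \<le> u \<bullet> d" if "d \<in> set ds" for d using pos[OF that] u by auto
  have "w = 0\<^sub>v m" if w: "w \<in> W" for w
  proof -
    have wc: "w \<in> carrier_vec m" using w subspaceD(1)[OF sub] by blast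
    have "0 \<le> real_vec u \<bullet> w"
      by (rule real_vec_scalar_prod_nonneg_cone[OF u ds nn]) (use w W in auto)
    moreover have "0 \<le> real_vec u \<bullet> - w"
      by (rule real_vec_scalar_prod_nonneg_cone[OF u ds nn]) (use subspaceD(3)[OF sub w] W in auto)
    moreover have "real_vec u \<bullet> - w = - (real_vec u \<bullet> w)" using u wc by simp
    ultimately have 0: "real_vec u \<bullet> w = 0" by linarith
    have ur: "real_vec u \<bullet> real_vec d = real_of_int (u \<bullet> d)" if "d \<in> set ds" for d
      using that u ds by (intro real_vec_scalar_prod) auto
    have wcone: "w \<in> cone_span m (real_vec ` set ds)" using w W generated_cone_eq[OF ds] by blast
    have uc': "real_vec u \<in> carrier_vec m" using u by simp
    have "w \<in> cone_span m {a \<in> real_vec ` set ds. real_vec u \<bullet> a = 0}"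
    proof (rule cone_span_face[OF uc' _ wcone 0])
      fix a assume "a \<in> real_vec ` set ds"
      then obtain d where d: "d \<in> set ds" "a = real_vec d" by blast
      show "0 \<le> real_vec u \<bullet> a" unfolding d(2) ur[OF d(1)] using nn[OF d(1)] by simp
    qed
    moreover have "{a \<in> real_vec ` set ds. real_vec u \<bullet> a = 0} \<subseteq> {0\<^sub>v m}"
    proof
      fix a assume "a \<in> {a \<in> real_vec ` set ds. real_vec u \<bullet> a = 0}"
      then obtain d where d: "d \<in> set ds" "a = real_vec d" "real_vec u \<bullet> real_vec d = 0" by blast
      then have "u \<bullet> d = 0" using ur[OF d(1)] by linarith
      then have "d = 0\<^sub>v m" using pos[OF d(1)] by auto
      then show "a \<in> {0\<^sub>v m}" using d(2) real_vec_zero by simp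
    qed
    ultimately have w0: "w \<in> cone_span m {0\<^sub>v m}" using cone_span_mono by blast
    have "x = 0\<^sub>v m" if "x \<in> cone_span m {0\<^sub>v m}" for x :: "real vec"
      using that by induction (auto intro!: eq_vecI)
    then show ?thesis using w0 .
  qed
  then show "W = {0\<^sub>v m}" using subspaceD(2)[OF sub] by blast
qed

lemma fan_certificateD:
  assumes cert: "fan_certificate m Bs dss" and "ds \<in> set dss"
  shows "set ds \<subseteq> carrier_vec m"
    and "\<exists>B\<in>set Bs. set B \<subseteq> carrier_vec m \<and> (\<exists>w. exposed_by m B ds w)"
proof -
  obtain B w where B: "B \<in> set Bs" "exposed_by m B ds w"
    using assms unfolding fan_certificate_def by blast
  moreover have "set B \<subseteq> carrier_vec m"
    using cert B(1) vectors_iff unfolding fan_certificate_def by blast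
  ultimately show "\<exists>B\<in>set Bs. set B \<subseteq> carrier_vec m \<and> (\<exists>w. exposed_by m B ds w)" by blast
  have "set ds \<subseteq> set B" using B(2) unfolding exposed_by_def by blast
  then show "set ds \<subseteq> carrier_vec m" using \<open>set B \<subseteq> carrier_vec m\<close> by blast
qed

lemma fan_certificate_fan:
  assumes cert: "fan_certificate m Bs dss"
  shows "fan m (generated_cone m ` set dss)"
  unfolding fan_def quasifan_def
proof (intro conjI ballI allI impI)
  show "cone_system m (generated_cone m ` set dss)"
    using fan_certificateD(1)[OF cert] unfolding cone_system_def by blast
next
  fix \<sigma> \<tau> assume "\<sigma> \<in> generated_cone m ` set dss" and face: "cone_face m \<tau> \<sigma>"
  then obtain ds where ds: "ds \<in> set dss" "\<sigma> = generated_cone m ds" by blast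
  note dsc = fan_certificateD(1)[OF cert ds(1)]
  obtain B w where B: "B \<in> set Bs" "set B \<subseteq> carrier_vec m" "exposed_by m B ds w"
    using fan_certificateD(2)[OF cert ds(1)] by blast
  obtain es where es: "\<forall>e\<in>set es. e \<in> set dss" "face_lattice m B es"
    using cert B(1) unfolding fan_certificate_def by blast
  obtain u where u: "u \<in> carrier_vec m" "\<forall>x\<in>\<sigma>. 0 \<le> u \<bullet> x" "\<tau> = {x \<in> \<sigma>. u \<bullet> x = 0}"
    using face unfolding cone_face_def by blast
  have ud: "0 \<le> u \<bullet> real_vec d" if "d \<in> set ds" for d
  proof -
    have "real_vec d \<in> carrier_vec m" using that dsc by auto
    then have "real_vec d \<in> \<sigma>"
      unfolding ds(2) generated_cone_eq[OF dsc] using that by (intro cone_span_gen) auto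
    then show ?thesis using u(2) by blast
  qed
  obtain e where e: "e \<in> set es" "set e = {d \<in> set ds. u \<bullet> real_vec d = 0}"
    using face_lattice_complete[OF B(2,3) es(2) u(1) ud] by blast
  have "\<tau> = generated_cone m e"
    unfolding u(3) ds(2) by (rule cone_face_generated_cone[OF dsc e(2) u(1) ud])
  then show "\<tau> \<in> generated_cone m ` set dss" using e(1) es(1) by blast
next
  fix \<sigma> \<sigma>' assume "\<sigma> \<in> generated_cone m ` set dss" "\<sigma>' \<in> generated_cone m ` set dss"
  then obtain ds es where ds: "ds \<in> set dss" "\<sigma> = generated_cone m ds"
    and es: "es \<in> set dss" "\<sigma>' = generated_cone m es" by blast
  obtain B w where B: "B \<in> set Bs" "set B \<subseteq> carrier_vec m" "exposed_by m B ds w"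
    using fan_certificateD(2)[OF cert ds(1)] by blast
  obtain C w' where C: "C \<in> set Bs" "set C \<subseteq> carrier_vec m" "exposed_by m C es w'"
    using fan_certificateD(2)[OF cert es(1)] by blast
  obtain u where u: "separated_by m B C u"
    using cert B(1) C(1) unfolding fan_certificate_def by blast
  have "set ds \<subseteq> set B" using B(3) unfolding exposed_by_def by blast
  from intersection_is_face[OF B(2) C(2) u this C(3)]
  show "cone_face m (\<sigma> \<inter> \<sigma>') \<sigma>" unfolding ds(2) es(2) .
next
  fix \<sigma> assume "\<sigma> \<in> generated_cone m ` set dss"
  then obtain ds where ds: "ds \<in> set dss" "\<sigma> = generated_cone m ds" by blast
  obtain B w where B: "B \<in> set Bs" "set B \<subseteq> carrier_vec m" "exposed_by m B ds w"
    using fan_certificateD(2)[OF cert ds(1)] by blast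
  obtain u where u: "dim_vec u = m" "\<forall>b\<in>set B. b = 0\<^sub>v m \<or> 0 < dot m u b"
    using cert B(1) unfolding fan_certificate_def by blast
  have uc: "u \<in> carrier_vec m" using u(1) carrier_vec_dim_vec[of u] by metis
  show "strictly_convex m \<sigma>"
    unfolding ds(2)
  proof (rule strictly_convex_generated_cone[OF fan_certificateD(1)[OF cert ds(1)] uc])
    fix d assume "d \<in> set ds"
    then have d: "d \<in> set B" using B(3) unfolding exposed_by_def by blast
    then have "d \<in> carrier_vec m" using B(2) by blast
    moreover have "d = 0\<^sub>v m \<or> 0 < dot m u d" using u(2) d by blast
    ultimately show "d = 0\<^sub>v m \<or> 0 < u \<bullet> d" by (simp only: dot_eq[OF uc])
  qed
qed

lemma fan_certificate_cover:
  assumes cert: "fan_certificate m Bs dss" and B: "B \<in> set Bs"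
  shows "\<exists>ds\<in>set dss. generated_cone m ds = generated_cone m B"
proof -
  have Bc: "set B \<subseteq> carrier_vec m"
    using cert B vectors_iff unfolding fan_certificate_def by blast
  obtain es where es: "\<forall>e\<in>set es. e \<in> set dss" "face_lattice m B es"
    using cert B unfolding fan_certificate_def by blast
  have dot0: "dot m (0\<^sub>v m) b = 0" if "b \<in> set B" for b
    using that Bc by (subst dot_eq) auto
  \<comment> \<open>The form 0 exposes the whole cone, and with u = 0 the completeness of the face
    list yields the cone itself.\<close>
  have w: "exposed_by m B B (0\<^sub>v m)"
    unfolding exposed_by_def using dot0 by simp
  have z: "0\<^sub>v m \<bullet> real_vec b = 0" if "b \<in> set B" for b
    using that Bc by auto
  obtain e where e: "e \<in> set es" "set e = {d \<in> set B. 0\<^sub>v m \<bullet> real_vec d = 0}"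
    using face_lattice_complete[OF Bc w es(2), of "0\<^sub>v m"] z by auto
  then have "set e = set B" using z by blast
  then have "generated_cone m e = generated_cone m B"
    using Bc by (simp add: generated_cone_eq)
  then show ?thesis using e(1) es(1) by blast
qed

section \<open>Certificates describe quotient fans\<close>

lemma projection_certificateD:
  assumes cert: "projection_certificate n rs qs hs"
  defines "m \<equiv> length rs"
  defines "P \<equiv> mat_of_rows n rs" and "Q \<equiv> mat_of_cols n qs"
  shows "P \<in> carrier_mat m n" and "Q \<in> carrier_mat n m" and "set rs \<subseteq> carrier_vec n" and "set hs \<subseteq> carrier_vec n"
    and "P * Q = 1\<^sub>m m"
    and "\<And>h. h \<in> group_span n (set hs) \<Longrightarrow> P *\<^sub>v h = 0\<^sub>v m"
    and "\<And>x. x \<in> carrier_vec n \<Longrightarrow> \<exists>h\<in>group_span n (set hs). x = h + Q *\<^sub>v (P *\<^sub>v x)"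
proof -
  have len: "length qs = m" using cert unfolding projection_certificate_def m_def by blast
  have rs: "set rs \<subseteq> carrier_vec n" and qs: "set qs \<subseteq> carrier_vec n" and hs: "set hs \<subseteq> carrier_vec n"
    using cert vectors_iff unfolding projection_certificate_def by blast+
  show "set rs \<subseteq> carrier_vec n" "set hs \<subseteq> carrier_vec n" by fact+
  show P: "P \<in> carrier_mat m n" and Q: "Q \<in> carrier_mat n m"
    using len by (auto simp: P_def Q_def m_def)
  have rowP: "row P i = rs ! i" "rs ! i \<in> carrier_vec n" if "i < m" for i
  proof -
    show "rs ! i \<in> carrier_vec n" using that rs nth_mem unfolding m_def by blast
    then show "row P i = rs ! i" using that by (simp add: P_def m_def)
  qed
  have colQ: "col Q j = qs ! j" "qs ! j \<in> carrier_vec n" if "j < m" for j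
  proof -
    show "qs ! j \<in> carrier_vec n" using that qs nth_mem len by blast
    then show "col Q j = qs ! j" using that len by (simp add: Q_def)
  qed
  show PQ: "P * Q = 1\<^sub>m m"
  proof (rule eq_matI)
    fix i j assume "i < dim_row (1\<^sub>m m :: int mat)" "j < dim_col (1\<^sub>m m :: int mat)"
    then have ij: "i < m" "j < m" by auto
    have "dot n (nth0 rs i) (nth0 qs j) = (if i = j then 1 else 0)"
      using cert ij unfolding projection_certificate_def m_def by blast
    then have "rs ! i \<bullet> qs ! j = (if i = j then 1 else 0)"
      using ij len rowP[OF ij(1)] colQ[OF ij(2)] by (simp add: nth_default_def m_def)
    then show "(P * Q) $$ (i, j) = 1\<^sub>m m $$ (i, j)"
      using ij P Q rowP[OF ij(1)] colQ[OF ij(2)] by simp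
  qed (use P Q in auto)
  have Ph: "P *\<^sub>v h = 0\<^sub>v m" if h: "h \<in> set hs" for h
  proof (rule eq_vecI)
    fix i assume "i < dim_vec (0\<^sub>v m :: int vec)"
    then have i: "i < m" by simp
    have hc: "h \<in> carrier_vec n" using h hs by blast
    have "rs ! i \<in> set rs" using i by (simp add: m_def)
    then have "dot n (rs ! i) h = 0" using cert h unfolding projection_certificate_def by blast
    then have "rs ! i \<bullet> h = 0" using rowP(2)[OF i] hc by simp
    then show "(P *\<^sub>v h) $ i = 0\<^sub>v m $ i" using i P rowP(1)[OF i] by simp
  qed (use P in simp)
  show Pg: "P *\<^sub>v h = 0\<^sub>v m" if "h \<in> group_span n (set hs)" for h
    by (rule mult_group_span_eq_0[OF P _ that]) (use Ph in blast)
  have span: "\<exists>h\<in>group_span n (set hs). \<exists>t\<in>carrier_vec m. x = h + Q *\<^sub>v t"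
    if "x \<in> group_span n (set (hs @ qs))" for x
    using that
  proof (induction rule: group_span_induct)
    case zero
    show ?case
      by (rule bexI[OF _ cone_span.zero], rule bexI[of _ "0\<^sub>v m"]) (auto simp: mult_mat_zero_vec[OF Q])
  next
    case (add x a k)
    then obtain h t where ht: "h \<in> group_span n (set hs)" "t \<in> carrier_vec m" "x = h + Q *\<^sub>v t" by blast
    have hc: "h \<in> carrier_vec n" by (rule cone_span_carrier[OF ht(1)])
    have Qt: "Q *\<^sub>v t \<in> carrier_vec n" using Q ht(2) by simp
    from add(2) consider "a \<in> set hs" | "a \<in> set qs" by auto
    then show ?case
    proof cases
      case 1
      have "k \<cdot>\<^sub>v a \<in> group_span n (set hs)"
        using 1 add(3) by (intro group_span_smult cone_span_gen) auto
      then have "h + k \<cdot>\<^sub>v a \<in> group_span n (set hs)" by (rule cone_span_plus[OF ht(1)])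
      moreover have "(h + w) + c = (h + c) + w" if "w \<in> carrier_vec n" "c \<in> carrier_vec n" for w c
        using hc that by (intro eq_vecI) auto
      then have "x + k \<cdot>\<^sub>v a = (h + k \<cdot>\<^sub>v a) + Q *\<^sub>v t"
        unfolding ht(3) using Qt add(3) by simp
      ultimately show ?thesis using ht(2) by blast
    next
      case 2
      then obtain j where j: "j < m" "a = qs ! j" using len by (auto simp: in_set_conv_nth)
      have "Q *\<^sub>v (t + k \<cdot>\<^sub>v unit_vec m j) = Q *\<^sub>v t + k \<cdot>\<^sub>v a"
        using j ht(2) colQ[OF j(1)]
        by (simp add: mult_add_distrib_mat_vec[OF Q] mult_mat_vec_smult[OF Q] mult_mat_unit_vec[OF Q])
      moreover have "(h + Q *\<^sub>v t) + k \<cdot>\<^sub>v a = h + (Q *\<^sub>v t + k \<cdot>\<^sub>v a)"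
        by (rule assoc_add_vec[OF hc Qt]) (use add(3) in simp)
      ultimately have "x + k \<cdot>\<^sub>v a = h + Q *\<^sub>v (t + k \<cdot>\<^sub>v unit_vec m j)"
        unfolding ht(3) by simp
      moreover have "t + k \<cdot>\<^sub>v unit_vec m j \<in> carrier_vec m" using ht(2) by simp
      ultimately show ?thesis using ht(1) by blast
    qed
  qed
  show "\<exists>h\<in>group_span n (set hs). x = h + Q *\<^sub>v (P *\<^sub>v x)" if x: "x \<in> carrier_vec n" for x
  proof -
    \<comment> \<open>The identity matrix is inserted so that \<open>mult_mat_vec_induct\<close>
      expands x into unit vectors.\<close>
    have "1\<^sub>m n *\<^sub>v x \<in> group_span n (set (hs @ qs))"
    proof (rule mult_mat_vec_induct[OF one_carrier_mat x])
      show "0\<^sub>v n \<in> group_span n (set (hs @ qs))" by (rule cone_span.zero)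
    next
      fix y j assume y: "y \<in> group_span n (set (hs @ qs))" and j: "j < n"
      have "unit_vec n j \<in> group_span n (set (hs @ qs))"
        using cert j unfolding projection_certificate_def by blast
      then have "x $ j \<cdot>\<^sub>v unit_vec n j \<in> group_span n (set (hs @ qs))" by (rule group_span_smult)
      from cone_span_plus[OF y this]
      show "y + x $ j \<cdot>\<^sub>v col (1\<^sub>m n) j \<in> group_span n (set (hs @ qs))"
        using j by simp
    qed
    then have "x \<in> group_span n (set (hs @ qs))" using x by simp
    from span[OF this] obtain h t where ht: "h \<in> group_span n (set hs)" "t \<in> carrier_vec m" "x = h + Q *\<^sub>v t"
      by blast
    have hc: "h \<in> carrier_vec n" by (rule cone_span_carrier[OF ht(1)])
    \<comment> \<open>P kills h and undoes Q, which identifies the coefficients t as P x.\<close>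
    have "P *\<^sub>v x = P *\<^sub>v h + P *\<^sub>v (Q *\<^sub>v t)"
      unfolding ht(3) using hc ht(2) Q by (intro mult_add_distrib_mat_vec[OF P]) auto
    also have "P *\<^sub>v (Q *\<^sub>v t) = t" using assoc_mult_mat_vec[OF P Q ht(2)] PQ ht(2) by simp
    also have "P *\<^sub>v h = 0\<^sub>v m" by (rule Pg[OF ht(1)])
    finally have "P *\<^sub>v x = t" using ht(2) by simp
    then show ?thesis using ht by blast
  qed
qed

lemma projection_certificate_quotient_projection:
  assumes cert: "projection_certificate n rs qs hs"
  shows "quotient_projection n (group_span n (set hs)) (length rs) (mat_of_rows n rs)"
    and "primitive_sublattice n (group_span n (set hs))"
proof -
  let ?P = "mat_of_rows n rs" and ?Q = "mat_of_cols n qs" and ?m = "length rs"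
  note D = projection_certificateD[OF cert]
  have ker: "mat_kernel ?P = group_span n (set hs)"
  proof
    show "mat_kernel ?P \<subseteq> group_span n (set hs)"
    proof
      fix x assume "x \<in> mat_kernel ?P"
      then have x: "x \<in> carrier_vec n" "?P *\<^sub>v x = 0\<^sub>v ?m" using mat_kernelD[OF D(1)] by blast+
      obtain h where h: "h \<in> group_span n (set hs)" "x = h + ?Q *\<^sub>v (?P *\<^sub>v x)" using D(7)[OF x(1)] by blast
      have "x = h"
        using h(2) cone_span_carrier[OF h(1)] unfolding x(2) mult_mat_zero_vec[OF D(2)] by simp
      then show "x \<in> group_span n (set hs)" using h(1) by simp
    qed
    show "group_span n (set hs) \<subseteq> mat_kernel ?P"
      using D(6) cone_span_carrier by (intro subsetI mat_kernelI[OF D(1)]) auto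
  qed
  have "?P *\<^sub>v (?Q *\<^sub>v y) = y" if "y \<in> carrier_vec ?m" for y
    using assoc_mult_mat_vec[OF D(1,2) that] D(5) that by simp
  then have "y \<in> (\<lambda>v. ?P *\<^sub>v v) ` carrier_vec n" if "y \<in> carrier_vec ?m" for y
    using that D(2) by (intro image_eqI[of _ _ "?Q *\<^sub>v y"]) auto
  then have "(\<lambda>v. ?P *\<^sub>v v) ` carrier_vec n = carrier_vec ?m"
    by (auto intro!: mult_mat_vec_carrier[OF D(1)])
  then show "quotient_projection n (group_span n (set hs)) ?m ?P"
    unfolding quotient_projection_def lattice_hom_def using D(1) ker by blast
  show "primitive_sublattice n (group_span n (set hs))"
    unfolding primitive_sublattice_def
  proof (intro conjI allI ballI impI)
    show "sublattice n (group_span n (set hs))"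
      unfolding sublattice_iff
      using cone_span_carrier cone_span.zero cone_span_plus group_span_uminus by blast
  next
    fix k :: int and v :: "int vec"
    assume v: "v \<in> carrier_vec n" "k \<noteq> 0" "k \<cdot>\<^sub>v v \<in> group_span n (set hs)"
    have "k \<cdot>\<^sub>v (?P *\<^sub>v v) = 0\<^sub>v ?m"
      using D(6)[OF v(3)] mult_mat_vec_smult[OF D(1) v(1), of k] by simp
    then have comp: "(k \<cdot>\<^sub>v (?P *\<^sub>v v)) $ i = 0\<^sub>v ?m $ i" for i by simp
    have "k * (?P *\<^sub>v v) $ i = 0" if "i < ?m" for i using comp[of i] that by simp
    then have "?P *\<^sub>v v = 0\<^sub>v ?m" using v(2) by (intro eq_vecI) auto
    then have "v \<in> mat_kernel ?P" using v(1) by (intro mat_kernelI[OF D(1)])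
    then show "v \<in> group_span n (set hs)" using ker by simp
  qed
qed

section \<open>Cones and enlargement steps under lattice homomorphisms\<close>

lemma real_ext_real_vec:
  "F \<in> carrier_mat k n \<Longrightarrow> v \<in> carrier_vec n \<Longrightarrow> real_ext F (real_vec v) = real_vec (F *\<^sub>v v)"
  unfolding real_ext_def by (rule real_vec_mult)

lemma real_ext_generated_cone:
  assumes F: "F \<in> carrier_mat k n" and gs: "set gs \<subseteq> carrier_vec n" and ts: "set ts \<subseteq> carrier_vec k"
    and gt: "\<And>g. g \<in> set gs \<Longrightarrow> real_vec (F *\<^sub>v g) \<in> generated_cone k ts"
  shows "real_ext F ` generated_cone n gs \<subseteq> generated_cone k ts"
proof
  fix y assume "y \<in> real_ext F ` generated_cone n gs"
  then obtain x where x: "x \<in> cone_span n (real_vec ` set gs)" "y = map_mat real_of_int F *\<^sub>v x"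
    unfolding real_ext_def generated_cone_eq[OF gs] by blast
  have "map_mat real_of_int F \<in> carrier_mat k n" using F by simp
  from cone_span_mult[OF this x(1)]
  have "y \<in> cone_span k ((\<lambda>a. map_mat real_of_int F *\<^sub>v a) ` real_vec ` set gs)" unfolding x(2) .
  moreover have "(\<lambda>a. map_mat real_of_int F *\<^sub>v a) ` real_vec ` set gs \<subseteq> generated_cone k ts"
    using gt gs real_vec_mult[OF F] by fastforce
  ultimately show "y \<in> generated_cone k ts"
    unfolding generated_cone_eq[OF ts] using cone_span_least by blast
qed

text \<open>Steps create no new vectors apart from \<open>ls\<close> and its negatives. With X the
  carrier this keeps all systems well-formed; with X the finite set of all available generators it
  bounds the enlargement.\<close>

lemma extension_steps_subset:
  assumes "(extension_step n ls)\<^sup>*\<^sup>* gss A"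
    and ls: "\<And>l. l \<in> set ls \<Longrightarrow> l \<in> X \<and> - l \<in> X" and gss: "\<And>gs. gs \<in> set gss \<Longrightarrow> set gs \<subseteq> X"
  shows "\<forall>C\<in>set A. set C \<subseteq> X"
  using assms(1)
proof induction
  case (step A B)
  show ?case
  proof (intro ballI subsetI)
    fix D b assume D: "D \<in> set B" "b \<in> set D"
    obtain i where i: "i < length B" "D = B ! i" using D(1) by (auto simp: in_set_conv_nth)
    then have C: "A ! i \<in> set A" using step(2) by (simp add: extension_step_def list_all2_conv_all_nth)
    have "b \<in> set (A ! i) \<or> b \<in> set ls \<or> - b \<in> set ls \<or> (\<exists>E\<in>set A. b \<in> set E)"
      using step(2) i D(2) unfolding extension_step_def list_all2_conv_all_nth by metis
    then consider "\<exists>E\<in>set A. b \<in> set E" | "b \<in> set ls" | "- b \<in> set ls" using C by blast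
    then show "b \<in> X"
    proof cases
      case 3
      then show ?thesis using ls[of "- b"] by simp
    qed (use step(3) ls in blast)+
  qed
qed (use gss in blast)

lemma extension_steps_carrier:
  assumes "(extension_step n ls)\<^sup>*\<^sup>* gss A" and "set ls \<subseteq> carrier_vec n" and "\<forall>gs\<in>set gss. set gs \<subseteq> carrier_vec n"
  shows "\<forall>C\<in>set A. set C \<subseteq> carrier_vec n"
  by (rule extension_steps_subset[OF assms(1)]) (use assms(2,3) in auto)

lemma extension_steps_mono:
  assumes "(extension_step n ls)\<^sup>*\<^sup>* gss A"
  shows "list_all2 (\<lambda>C D. set C \<subseteq> set D) gss A"
  using assms
proof induction
  case base
  show ?case by (rule list_all2_refl) simp
next
  case (step A B)
  have "list_all2 (\<lambda>C D. set C \<subseteq> set D) A B"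
    using step(2) unfolding extension_step_def by (rule list_all2_mono) blast
  with step(3) show ?case by (rule list_all2_trans[rotated]) blast
qed

text \<open>The cones \<tau> i are chosen once, for the original system, and remain valid after each
  step. If b and y are sent into \<tau> j and b + y into \<tau> i, the form that exposes the face
  \<tau> j \<inter> \<tau> i of \<tau> j vanishes on the image of b + y. It is nonnegative on both
  summands, so it vanishes on the image of b.\<close>

lemma extension_steps_map:
  assumes steps: "(extension_step n ls)\<^sup>*\<^sup>* gss A"
    and ls: "set ls \<subseteq> carrier_vec n" and gss: "\<forall>gs\<in>set gss. set gs \<subseteq> carrier_vec n"
    and F: "F \<in> carrier_mat k n" and Fl: "\<forall>l\<in>set ls. F *\<^sub>v l = 0\<^sub>v k"
    and D': "fan k D'" and \<tau>: "\<And>i. i < length gss \<Longrightarrow> \<tau> i \<in> D' \<and> (\<forall>g\<in>set (gss ! i). real_vec (F *\<^sub>v g) \<in> \<tau> i)"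
  shows "length A = length gss \<and> (\<forall>i<length gss. \<forall>a\<in>set (A ! i). real_vec (F *\<^sub>v a) \<in> \<tau> i)"
  using steps
proof induction
  case (step A B)
  have lenA: "length A = length gss" using step(3) by blast
  then have lenB: "length B = length gss" using step(2) unfolding extension_step_def by (simp add: list_all2_lengthD)
  have Ac: "\<forall>C\<in>set A. set C \<subseteq> carrier_vec n" by (rule extension_steps_carrier[OF step(1) ls gss])
  have ts: "\<exists>ts. set ts \<subseteq> carrier_vec k \<and> \<tau> i = generated_cone k ts" if "i < length gss" for i
    using \<tau>[OF that] D' unfolding fan_def quasifan_def cone_system_def by blast
  have plus: "x + y \<in> \<tau> i" if "i < length gss" "x \<in> \<tau> i" "y \<in> \<tau> i" for i x y
    using ts[OF that(1)] that(2,3) generated_cone_eq cone_span_plus by metis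
  have smult: "r \<cdot>\<^sub>v x \<in> \<tau> i" if "i < length gss" "x \<in> \<tau> i" "0 \<le> r" for i x r
    using ts[OF that(1)] that(2,3) generated_cone_eq cone_span_smult by metis
  have zero0: "0\<^sub>v k \<in> \<tau> i" if "i < length gss" for i
    using ts[OF that(1)] generated_cone_eq cone_span.zero by metis
  have span: "real_vec (F *\<^sub>v x) \<in> \<tau> i" if i: "i < length gss" and x: "x \<in> cone_span n (set (A ! i))" for i x
    using x
  proof induction
    case zero
    then show ?case using zero0[OF i] by (simp add: mult_mat_zero_vec[OF F] real_vec_zero)
  next
    case (add v a r)
    have vc: "v \<in> carrier_vec n" by (rule cone_span_carrier[OF add(1)])
    have "F *\<^sub>v (v + r \<cdot>\<^sub>v a) = F *\<^sub>v v + r \<cdot>\<^sub>v (F *\<^sub>v a)"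
      using F vc add(3) by (simp add: mult_add_distrib_mat_vec[OF F] mult_mat_vec_smult[OF F])
    then have "real_vec (F *\<^sub>v (v + r \<cdot>\<^sub>v a)) = real_vec (F *\<^sub>v v) + real_of_int r \<cdot>\<^sub>v real_vec (F *\<^sub>v a)"
      using F vc add(3) by (simp add: real_vec_add[of _ k] real_vec_smult)
    moreover have "real_vec (F *\<^sub>v a) \<in> \<tau> i" using step(3) i add(2) by blast
    ultimately show ?case using plus[OF i add(5)] smult[OF i] add(4) by simp
  qed
  have "real_vec (F *\<^sub>v b) \<in> \<tau> i" if i: "i < length gss" and b: "b \<in> set (B ! i)" for i b
  proof -
    have "b \<in> set (A ! i) \<or> b \<in> set ls \<or> - b \<in> set ls \<or>
        (\<exists>E\<in>set A. b \<in> set E \<and> (\<exists>y. y \<in> cone_span n (set E) \<and> vadd n b y \<in> cone_span n (set (A ! i))))"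
      using step(2) i b lenA unfolding extension_step_def list_all2_conv_all_nth by metis
    then consider "b \<in> set (A ! i)" | "b \<in> set ls" | "- b \<in> set ls" |
      E y where "E \<in> set A" "b \<in> set E" "y \<in> cone_span n (set E)" "vadd n b y \<in> cone_span n (set (A ! i))"
      by blast
    then show ?thesis
    proof cases
      case 1
      then show ?thesis using step(3) i by blast
    next
      case 2
      then show ?thesis using Fl zero0[OF i] by (simp add: real_vec_zero)
    next
      case 3
      then have "- b \<in> carrier_vec n" using ls by blast
      then have bc: "b \<in> carrier_vec n" by simp
      have "F *\<^sub>v b = (- 1) \<cdot>\<^sub>v (F *\<^sub>v (- b))" using F bc by (intro eq_vecI) auto
      also have "\<dots> = 0\<^sub>v k" using Fl 3 by auto
      finally show ?thesis using zero0[OF i] by (simp add: real_vec_zero)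
    next
      case 4
      obtain j where j: "j < length gss" "E = A ! j" using 4(1) lenA by (auto simp: in_set_conv_nth)
      have bc: "b \<in> carrier_vec n" using 4(1,2) Ac by blast
      have yc: "y \<in> carrier_vec n" by (rule cone_span_carrier[OF 4(3)])
      let ?b = "real_vec (F *\<^sub>v b)" and ?y = "real_vec (F *\<^sub>v y)"
      have carr: "?b \<in> carrier_vec k" "?y \<in> carrier_vec k" using F bc yc by auto
      have "F *\<^sub>v (b + y) = F *\<^sub>v b + F *\<^sub>v y" by (rule mult_add_distrib_mat_vec[OF F bc yc])
      then have sum: "real_vec (F *\<^sub>v (b + y)) = ?b + ?y" using F bc yc by (simp add: real_vec_add[of _ k])
      have bj: "?b \<in> \<tau> j" using step(3) j 4(2) by blast
      have yj: "?y \<in> \<tau> j" by (rule span[OF j(1)]) (use 4(3) j(2) in simp)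
      have xi: "?b + ?y \<in> \<tau> i" using span[OF i 4(4)] bc yc sum by simp
      have xj: "?b + ?y \<in> \<tau> j" by (rule plus[OF j(1) bj yj])
      have "cone_face k (\<tau> j \<inter> \<tau> i) (\<tau> j)"
        using D' \<tau>[OF i] \<tau>[OF j(1)] unfolding fan_def quasifan_def by blast
      then obtain u where u: "u \<in> carrier_vec k" "\<forall>x\<in>\<tau> j. 0 \<le> u \<bullet> x" "\<tau> j \<inter> \<tau> i = {x \<in> \<tau> j. u \<bullet> x = 0}"
        unfolding cone_face_def by blast
      have "u \<bullet> (?b + ?y) = 0" using xi xj u(3) by blast
      moreover have "u \<bullet> (?b + ?y) = u \<bullet> ?b + u \<bullet> ?y" by (rule scalar_prod_add_distrib[OF u(1) carr])
      moreover have "0 \<le> u \<bullet> ?b" "0 \<le> u \<bullet> ?y" using u(2) bj yj by blast+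
      ultimately have "u \<bullet> ?b = 0" by linarith
      then show ?thesis using bj u(3) by blast
    qed
  qed
  then show ?case using lenB by blast
qed (use \<tau> in blast)

lemma quotient_certificate_sound:
  assumes cert: "quotient_certificate n gss ls rs hs dss"
    and ls: "set ls \<subseteq> carrier_vec n" and gss: "\<forall>gs\<in>set gss. set gs \<subseteq> carrier_vec n"
    and L: "L = group_span n (set ls)" "primitive_sublattice n L"
  shows "quotient_fan n (generated_cone n ` set gss) L (group_span n (set hs)) (length rs) (mat_of_rows n rs)
      (generated_cone (length rs) ` set dss)"
    and "set hs \<subseteq> carrier_vec n" and "\<forall>ds\<in>set dss. set ds \<subseteq> carrier_vec (length rs)"
    and "set rs \<subseteq> carrier_vec n"
proof -
  let ?P = "mat_of_rows n rs" and ?m = "length rs" and ?D = "generated_cone (length rs) ` set dss"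
  obtain A vs qs Bs where steps: "(extension_step n ls)\<^sup>*\<^sup>* gss A" and proj: "projection_certificate n rs qs hs"
    and rl: "\<forall>r\<in>set rs. \<forall>l\<in>set ls. dot n r l = 0"
    and vs: "\<forall>v\<in>set vs. v \<in> set ls \<or> (\<exists>C\<in>set A. v \<in> cone_span n (set C) \<and> - v \<in> cone_span n (set C))"
    and hs: "\<forall>h\<in>set hs. \<exists>k::int. 0 < k \<and> k \<cdot>\<^sub>v h \<in> group_span n (set vs)"
    and AB: "list_all2 (\<lambda>C B. (\<forall>c\<in>set C. apply_rows n rs c \<in> set B) \<and>
        (\<forall>b\<in>set B. \<exists>c\<in>set C. b = apply_rows n rs c)) A Bs"
    and fan: "fan_certificate ?m Bs dss"
    using cert unfolding quotient_certificate_def by blast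
  let ?Q = "mat_of_cols n qs"
  note D = projection_certificateD[OF proj]
  show hsc: "set hs \<subseteq> carrier_vec n" and rsc: "set rs \<subseteq> carrier_vec n" by (rule D)+
  show dssc: "\<forall>ds\<in>set dss. set ds \<subseteq> carrier_vec ?m" using fan_certificateD(1)[OF fan] by blast
  have Ac: "set (A ! i) \<subseteq> carrier_vec n" if "i < length A" for i
    using extension_steps_carrier[OF steps ls gss] that by simp
  have mono: "length A = length gss" "\<And>i. i < length gss \<Longrightarrow> set (gss ! i) \<subseteq> set (A ! i)"
    using extension_steps_mono[OF steps] by (auto simp: list_all2_conv_all_nth)
  have lenB: "length Bs = length gss" using list_all2_lengthD[OF AB] mono(1) by simp
  have B1: "?P *\<^sub>v c \<in> set (Bs ! i)" if "i < length gss" "c \<in> set (A ! i)" for i c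
  proof -
    have "apply_rows n rs c \<in> set (Bs ! i)"
      using AB that mono(1) unfolding list_all2_conv_all_nth by metis
    moreover have "c \<in> carrier_vec n" using that Ac mono(1) by auto
    ultimately show ?thesis using apply_rows_eq[OF rsc] by simp
  qed
  have B2: "\<exists>c\<in>set (A ! i). b = ?P *\<^sub>v c" if i: "i < length gss" and b: "b \<in> set (Bs ! i)" for i b
  proof -
    obtain c where c: "c \<in> set (A ! i)" "b = apply_rows n rs c"
      using AB i b mono(1) unfolding list_all2_conv_all_nth by metis
    then have "c \<in> carrier_vec n" using i Ac mono(1) by auto
    then show ?thesis using c apply_rows_eq[OF rsc] by auto
  qed
  have LhL: "L \<subseteq> group_span n (set hs)"
  proof
    fix x assume x: "x \<in> L"
    have Pl: "?P *\<^sub>v l = 0\<^sub>v ?m" if l: "l \<in> set ls" for l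
    proof (rule eq_vecI)
      fix i assume "i < dim_vec (0\<^sub>v ?m :: int vec)"
      then have i: "i < ?m" by simp
      then have r: "rs ! i \<in> set rs" by simp
      then have "rs ! i \<in> carrier_vec n" "l \<in> carrier_vec n" using rsc ls l by blast+
      moreover have "dot n (rs ! i) l = 0" using rl r l by blast
      ultimately show "(?P *\<^sub>v l) $ i = 0\<^sub>v ?m $ i" using i by simp
    qed simp
    have "?P *\<^sub>v x = 0\<^sub>v ?m"
      by (rule mult_group_span_eq_0[OF D(1) _ x[unfolded L(1)]]) (rule Pl)
    moreover have "x \<in> carrier_vec n" using x cone_span_carrier unfolding L(1) by blast
    ultimately have "x \<in> mat_kernel ?P" by (intro mat_kernelI[OF D(1)])
    then show "x \<in> group_span n (set hs)"
      using projection_certificate_quotient_projection(1)[OF proj] unfolding quotient_projection_def by blast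
  qed
  have SD: "map_of_systems n (generated_cone n ` set gss) ?m ?D ?P"
    unfolding map_of_systems_def lattice_hom_def
  proof (intro conjI ballI D(1))
    fix \<sigma> assume "\<sigma> \<in> generated_cone n ` set gss"
    then obtain i where i: "i < length gss" "\<sigma> = generated_cone n (gss ! i)" by (auto simp: in_set_conv_nth)
    have Bi: "Bs ! i \<in> set Bs" using i(1) lenB by simp
    have Bic: "set (Bs ! i) \<subseteq> carrier_vec ?m"
      using fan Bi vectors_iff unfolding fan_certificate_def by blast
    have "real_ext ?P ` \<sigma> \<subseteq> generated_cone ?m (Bs ! i)"
      unfolding i(2)
    proof (rule real_ext_generated_cone[OF D(1) _ Bic])
      show "set (gss ! i) \<subseteq> carrier_vec n" using gss i(1) by simp
      fix g assume "g \<in> set (gss ! i)"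
      then have "?P *\<^sub>v g \<in> set (Bs ! i)" using B1[OF i(1)] mono(2)[OF i(1)] by blast
      moreover from this have "real_vec (?P *\<^sub>v g) \<in> carrier_vec ?m" using Bic by fastforce
      ultimately show "real_vec (?P *\<^sub>v g) \<in> generated_cone ?m (Bs ! i)"
        unfolding generated_cone_eq[OF Bic] by (intro cone_span_gen) auto
    qed
    then show "\<exists>\<tau>\<in>?D. real_ext ?P ` \<sigma> \<subseteq> \<tau>" using fan_certificate_cover[OF fan Bi] by auto
  qed
  have univ: "\<exists>F'. map_of_systems ?m ?D k D' F' \<and> F = F' * ?P"
    if D': "fan k D'" and SF: "map_of_systems n (generated_cone n ` set gss) k D' F"
      and FL: "\<forall>v\<in>L. F *\<^sub>v v = 0\<^sub>v k" for k D' F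
  proof -
    have F: "F \<in> carrier_mat k n" using SF unfolding map_of_systems_def lattice_hom_def by blast
    have "l \<in> L" if "l \<in> set ls" for l
      unfolding L(1) using that ls by (intro cone_span_gen) auto
    then have Fl: "\<forall>l\<in>set ls. F *\<^sub>v l = 0\<^sub>v k" using FL by blast
    have "\<exists>\<tau>\<in>D'. \<forall>g\<in>set (gss ! i). real_vec (F *\<^sub>v g) \<in> \<tau>" if i: "i < length gss" for i
    proof -
      obtain \<tau> where \<tau>: "\<tau> \<in> D'" "real_ext F ` generated_cone n (gss ! i) \<subseteq> \<tau>"
        using SF i unfolding map_of_systems_def by force
      have gc: "set (gss ! i) \<subseteq> carrier_vec n" using gss i by simp
      have "real_vec (F *\<^sub>v g) \<in> \<tau>" if g: "g \<in> set (gss ! i)" for g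
      proof -
        have "real_vec g \<in> carrier_vec n" using g gc by auto
        then have "real_vec g \<in> generated_cone n (gss ! i)"
          unfolding generated_cone_eq[OF gc] using g by (intro cone_span_gen) auto
        then have "real_ext F (real_vec g) \<in> \<tau>" using \<tau>(2) by blast
        then show ?thesis using real_ext_real_vec[OF F, of g] g gc by auto
      qed
      then show ?thesis using \<tau>(1) by blast
    qed
    then obtain \<tau> where \<tau>: "\<And>i. i < length gss \<Longrightarrow> \<tau> i \<in> D' \<and> (\<forall>g\<in>set (gss ! i). real_vec (F *\<^sub>v g) \<in> \<tau> i)"
      by metis
    have FA: "real_vec (F *\<^sub>v a) \<in> \<tau> i" if "i < length gss" "a \<in> set (A ! i)" for i a
      using extension_steps_map[OF steps ls gss F Fl D' \<tau>] that by blast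
    have ts: "\<exists>ts. set ts \<subseteq> carrier_vec k \<and> \<tau> i = generated_cone k ts" if "i < length gss" for i
      using \<tau>[OF that] D' unfolding fan_def quasifan_def cone_system_def by blast
    have Fspan: "real_vec (F *\<^sub>v x) \<in> \<tau> i" if i: "i < length gss" and x: "x \<in> cone_span n (set (A ! i))" for i x
    proof -
      obtain ts where ts: "set ts \<subseteq> carrier_vec k" "\<tau> i = generated_cone k ts" using ts[OF i] by blast
      have "F *\<^sub>v x \<in> cone_span k ((\<lambda>a. F *\<^sub>v a) ` set (A ! i))" by (rule cone_span_mult[OF F x])
      then have "real_vec (F *\<^sub>v x) \<in> cone_span k (real_vec ` (\<lambda>a. F *\<^sub>v a) ` set (A ! i))"
        by (rule real_vec_cone_span)
      moreover have "real_vec ` (\<lambda>a. F *\<^sub>v a) ` set (A ! i) \<subseteq> \<tau> i" using FA[OF i] by blast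
      ultimately show ?thesis
        unfolding ts(2) generated_cone_eq[OF ts(1)] using cone_span_least by blast
    qed
    have Fv: "F *\<^sub>v v = 0\<^sub>v k" if v: "v \<in> set vs" for v
    proof (cases "v \<in> set ls")
      case False
      then obtain i where i: "i < length gss" "v \<in> cone_span n (set (A ! i))" "- v \<in> cone_span n (set (A ! i))"
        using vs v mono(1) by (metis in_set_conv_nth)
      have vc: "v \<in> carrier_vec n" by (rule cone_span_carrier[OF i(2)])
      let ?x = "real_vec (F *\<^sub>v v)"
      have "F *\<^sub>v (- v) = - (F *\<^sub>v v)" using F vc by (intro eq_vecI) auto
      then have x: "?x \<in> \<tau> i" "- ?x \<in> \<tau> i"
        using Fspan[OF i(1,2)] Fspan[OF i(1,3)] by (simp_all add: real_vec_uminus)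
      have xc: "?x \<in> carrier_vec k" using F vc by simp
      have "{r \<cdot>\<^sub>v ?x |r. True} \<subseteq> \<tau> i"
      proof
        fix y assume "y \<in> {r \<cdot>\<^sub>v ?x |r. True}"
        then obtain r where y: "y = r \<cdot>\<^sub>v ?x" by blast
        have smult: "s \<cdot>\<^sub>v z \<in> \<tau> i" if "z \<in> \<tau> i" "0 \<le> s" for s z
          using ts[OF i(1)] that generated_cone_eq cone_span_smult by metis
        have "r \<cdot>\<^sub>v ?x = (- r) \<cdot>\<^sub>v (- ?x)" by auto
        then show "y \<in> \<tau> i" unfolding y using smult[OF x(1), of r] smult[OF x(2), of "- r"] by (cases "0 \<le> r") auto
      qed
      moreover have "strictly_convex k (\<tau> i)" using D' \<tau>[OF i(1)] unfolding fan_def by blast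
      ultimately have line: "{r \<cdot>\<^sub>v ?x |r. True} = {0\<^sub>v k}"
        using subspace_line[OF xc] unfolding strictly_convex_def by blast
      have "1 \<cdot>\<^sub>v ?x \<in> {r \<cdot>\<^sub>v ?x |r. True}" by blast
      then have x0: "?x = 0\<^sub>v k" unfolding line by simp
      show ?thesis
      proof (rule eq_vecI)
        fix j assume "j < dim_vec (0\<^sub>v k :: int vec)"
        then have j: "j < k" by simp
        then have "real_of_int ((F *\<^sub>v v) $ j) = 0" using arg_cong[OF x0, of "\<lambda>w. w $ j"] F by simp
        then show "(F *\<^sub>v v) $ j = 0\<^sub>v k $ j" using j by simp
      qed (use F in simp)
    qed (use Fl in blast)
    have Fh: "F *\<^sub>v h = 0\<^sub>v k" if h: "h \<in> set hs" for h
    proof -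
      obtain c where c: "0 < c" "c \<cdot>\<^sub>v h \<in> group_span n (set vs)" using hs h by blast
      have hc: "h \<in> carrier_vec n" using h hsc by blast
      have "F *\<^sub>v (c \<cdot>\<^sub>v h) = 0\<^sub>v k"
        by (rule mult_group_span_eq_0[OF F _ c(2)]) (use Fv in blast)
      then have eq: "c \<cdot>\<^sub>v (F *\<^sub>v h) = 0\<^sub>v k" using mult_mat_vec_smult[OF F hc] by simp
      show ?thesis
      proof (rule eq_vecI)
        fix j assume "j < dim_vec (0\<^sub>v k :: int vec)"
        then have j: "j < k" by simp
        then have "c * (F *\<^sub>v h) $ j = 0" using arg_cong[OF eq, of "\<lambda>w. w $ j"] F by simp
        then show "(F *\<^sub>v h) $ j = 0\<^sub>v k $ j" using j c(1) by simp
      qed (use F in simp)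
    qed
    \<comment> \<open>Q is a section of P, and every x differs from Q (P x) by an element of the
      span of \<open>hs\<close>, which F kills. So F after Q is the factorization of F through
      P.\<close>
    define F' where "F' = F * ?Q"
    have F': "F' \<in> carrier_mat k ?m" using F D(2) by (simp add: F'_def)
    have factor: "F' *\<^sub>v (?P *\<^sub>v x) = F *\<^sub>v x" if x: "x \<in> carrier_vec n" for x
    proof -
      obtain h where h: "h \<in> group_span n (set hs)" "x = h + ?Q *\<^sub>v (?P *\<^sub>v x)" using D(7)[OF x] by blast
      have hc: "h \<in> carrier_vec n" by (rule cone_span_carrier[OF h(1)])
      have Px: "?P *\<^sub>v x \<in> carrier_vec ?m" by (rule mult_mat_vec_carrier[OF D(1) x])
      then have QPx: "?Q *\<^sub>v (?P *\<^sub>v x) \<in> carrier_vec n" by (rule mult_mat_vec_carrier[OF D(2)])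
      have "F *\<^sub>v x = F *\<^sub>v h + F *\<^sub>v (?Q *\<^sub>v (?P *\<^sub>v x))"
        using mult_add_distrib_mat_vec[OF F hc QPx] h(2) by simp
      also have "F *\<^sub>v h = 0\<^sub>v k" by (rule mult_group_span_eq_0[OF F _ h(1)]) (use Fh in blast)
      also have "F *\<^sub>v (?Q *\<^sub>v (?P *\<^sub>v x)) = F' *\<^sub>v (?P *\<^sub>v x)"
        unfolding F'_def by (rule assoc_mult_mat_vec[OF F D(2) Px, symmetric])
      finally show ?thesis using F' Px by simp
    qed
    have "F = F' * ?P"
    proof (rule eq_matI)
      fix i j assume "i < dim_row (F' * ?P)" "j < dim_col (F' * ?P)"
      then have ij: "i < k" "j < n" using F' D(1) by auto
      have "F *\<^sub>v unit_vec n j = (F' * ?P) *\<^sub>v unit_vec n j"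
        using factor[of "unit_vec n j"] assoc_mult_mat_vec[OF F' D(1), of "unit_vec n j"] by simp
      then have "col F j = col (F' * ?P) j"
        using mult_mat_unit_vec[OF F ij(2)] mult_mat_unit_vec[OF mult_carrier_mat[OF F' D(1)] ij(2)] by simp
      from arg_cong[OF this, of "\<lambda>w. w $ i"] show "F $$ (i, j) = (F' * ?P) $$ (i, j)"
        using ij F F' D(1) by simp
    qed (use F F' in auto)
    moreover have "map_of_systems ?m ?D k D' F'"
      unfolding map_of_systems_def lattice_hom_def
    proof (intro conjI ballI F')
      fix \<sigma> assume "\<sigma> \<in> ?D"
      then obtain ds where ds: "ds \<in> set dss" "\<sigma> = generated_cone ?m ds" by blast
      obtain B w where B: "B \<in> set Bs" "exposed_by ?m B ds w" using fan_certificateD(2)[OF fan ds(1)] by blast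
      then obtain i where i: "i < length gss" "B = Bs ! i" using lenB by (auto simp: in_set_conv_nth)
      obtain ts where ts: "set ts \<subseteq> carrier_vec k" "\<tau> i = generated_cone k ts" using ts[OF i(1)] by blast
      \<comment> \<open>The generators of the face are projections of vectors of the enlarged cone
        \<open>A ! i\<close>, and F sends all of these into \<tau> i.\<close>
      have "real_ext F' ` \<sigma> \<subseteq> \<tau> i"
        unfolding ds(2) ts(2)
      proof (rule real_ext_generated_cone[OF F' _ ts(1)])
        show "set ds \<subseteq> carrier_vec ?m" using dssc ds(1) by blast
        fix d assume "d \<in> set ds"
        then have "d \<in> set (Bs ! i)" using B(2) i(2) unfolding exposed_by_def by blast
        then obtain c where c: "c \<in> set (A ! i)" "d = ?P *\<^sub>v c" using B2[OF i(1)] by blast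
        have "c \<in> carrier_vec n" using c(1) Ac i(1) mono(1) by auto
        then have "F' *\<^sub>v d = F *\<^sub>v c" using factor c(2) by simp
        then show "real_vec (F' *\<^sub>v d) \<in> generated_cone k ts" using FA[OF i(1) c(1)] ts(2) by simp
      qed
      then show "\<exists>\<tau>\<in>D'. real_ext F' ` \<sigma> \<subseteq> \<tau>" using \<tau>[OF i(1)] by blast
    qed
    ultimately show ?thesis by blast
  qed
  show "quotient_fan n (generated_cone n ` set gss) L (group_span n (set hs)) ?m ?P ?D"
    unfolding quotient_fan_def
  proof (intro conjI allI impI)
    show "cone_system n (generated_cone n ` set gss)" using gss unfolding cone_system_def by blast
  qed (use L(2) projection_certificate_quotient_projection[OF proj] LhL fan_certificate_fan[OF fan] SD univ in blast)+
qed

section \<open>Existence of certificates\<close>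

lemma saturated_extension_exists:
  assumes ls: "set ls \<subseteq> carrier_vec n" and gss: "\<forall>gs\<in>set gss. set gs \<subseteq> carrier_vec n"
  shows "\<exists>A. (extension_step n ls)\<^sup>*\<^sup>* gss A \<and> (\<forall>C\<in>set A. \<forall>b. b \<in> set ls \<or> - b \<in> set ls \<or>
    (\<exists>E\<in>set A. b \<in> set E \<and> (\<exists>y. y \<in> cone_span n (set E) \<and> vadd n b y \<in> cone_span n (set C))) \<longrightarrow> b \<in> set C)"
proof -
  define G where "G = \<Union> (set ` set gss) \<union> set ls \<union> uminus ` set ls"
  have G: "finite G" by (simp add: G_def)
  have sub: "\<forall>C\<in>set A. set C \<subseteq> G" if "(extension_step n ls)\<^sup>*\<^sup>* gss A" for A
    by (rule extension_steps_subset[OF that]) (auto simp: G_def)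
  define f where "f A = (\<Sum>j<length A. card (set (A ! j)))" for A :: "int vec list list"
  have bound: "f A < Suc (length gss * card G)" if A: "(extension_step n ls)\<^sup>*\<^sup>* gss A" for A
  proof -
    have "length A = length gss" using list_all2_lengthD[OF extension_steps_mono[OF A]] by simp
    moreover have "f A \<le> (\<Sum>j<length A. card G)"
      unfolding f_def by (intro sum_mono card_mono[OF G]) (use sub[OF A] in simp)
    ultimately show ?thesis by simp
  qed
  \<comment> \<open>a reachable system with as many generators as possible is saturated\<close>
  obtain A where A: "(extension_step n ls)\<^sup>*\<^sup>* gss A"
    and max: "\<And>B. (extension_step n ls)\<^sup>*\<^sup>* gss B \<Longrightarrow> f B \<le> f A"
    using ex_has_greatest_nat[of "(extension_step n ls)\<^sup>*\<^sup>* gss" gss f] bound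
    by (metis less_imp_le_nat rtranclp.rtrancl_refl)
  have "b \<in> set C" if C: "C \<in> set A" and b: "b \<in> set ls \<or> - b \<in> set ls \<or>
    (\<exists>E\<in>set A. b \<in> set E \<and> (\<exists>y. y \<in> cone_span n (set E) \<and> vadd n b y \<in> cone_span n (set C)))" for C b
  proof (rule ccontr)
    assume nb: "b \<notin> set C"
    obtain j where j: "j < length A" "C = A ! j" using C by (auto simp: in_set_conv_nth)
    \<comment> \<open>A step may add a single generator to a single cone and keep all others, so the
      count grows by exactly one.\<close>
    let ?B = "A[j := b # C]"
    have "extension_step n ls A ?B"
      unfolding extension_step_def list_all2_conv_all_nth
      using b j by (auto simp: nth_list_update)
    with A have "(extension_step n ls)\<^sup>*\<^sup>* gss ?B" by (rule rtranclp.rtrancl_into_rtrancl)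
    from max[OF this] have le: "f ?B \<le> f A" .
    have "f ?B = (\<Sum>i<length A. card (set (A ! i)) + (if i = j then 1 else 0))"
      unfolding f_def using j nb by (intro sum.cong) (auto simp: nth_list_update)
    also have "\<dots> = f A + 1" using j by (simp add: f_def sum.distrib)
    finally show False using le by simp
  qed
  with A show ?thesis by blast
qed

text \<open>Summands of a lineal vector are lineal. Over the integers a coefficient r \<noteq> 0 is
  at least 1, so - a is obtained from - (v + r a) by adding v and r - 1 copies of a, without
  dividing by r.\<close>

lemma cone_span_lineality:
  fixes x :: "int vec"
  assumes "x \<in> cone_span n A" and "- x \<in> cone_span n A"
  shows "x \<in> cone_span n {a \<in> A. - a \<in> cone_span n A}"
  using assms
proof induction
  case (add v a r)
  have v: "v \<in> carrier_vec n" by (rule cone_span_carrier[OF add(1)])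
  have ra: "r \<cdot>\<^sub>v a \<in> cone_span n A" by (intro cone_span_smult cone_span_gen add)
  have "- (v + r \<cdot>\<^sub>v a) + r \<cdot>\<^sub>v a \<in> cone_span n A" by (rule cone_span_plus[OF add(6) ra])
  also have "- (v + r \<cdot>\<^sub>v a) + r \<cdot>\<^sub>v a = - v" using v add(3) by (intro eq_vecI) auto
  finally have IH: "v \<in> cone_span n {a \<in> A. - a \<in> cone_span n A}" by (rule add(5))
  show ?case
  proof (cases "r = 0")
    case True
    then have "v + r \<cdot>\<^sub>v a = v" using v add(3) by (intro eq_vecI) auto
    then show ?thesis using IH by simp
  next
    case False
    then have "0 \<le> r - 1" using add(4) by simp
    then have "- (v + r \<cdot>\<^sub>v a) + (v + (r - 1) \<cdot>\<^sub>v a) \<in> cone_span n A"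
      by (intro cone_span_plus cone_span_smult cone_span_gen add)
    also have "- (v + r \<cdot>\<^sub>v a) + (v + (r - 1) \<cdot>\<^sub>v a) = - a"
      using v add(3) by (intro eq_vecI) (auto simp: algebra_simps)
    finally show ?thesis using IH add by (intro cone_span.add) auto
  qed
qed (rule cone_span.zero)

lemma projection_certificate_exists:
  assumes vs: "set vs \<subseteq> carrier_vec n"
  shows "\<exists>rs qs hs. projection_certificate n rs qs hs \<and> (\<forall>v\<in>set vs. mat_of_rows n rs *\<^sub>v v = 0\<^sub>v (length rs)) \<and>
    (\<forall>x\<in>carrier_vec n. mat_of_rows n rs *\<^sub>v x = 0\<^sub>v (length rs) \<longrightarrow> (\<exists>k>0. k \<cdot>\<^sub>v x \<in> group_span n (set vs)))"
proof -
  obtain m P Q where P: "P \<in> carrier_mat m n" and Q: "Q \<in> carrier_mat n m" and PQ: "P * Q = 1\<^sub>m m"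
    and Pv: "\<forall>v\<in>set vs. P *\<^sub>v v = 0\<^sub>v m"
    and ker: "\<forall>x\<in>carrier_vec n. P *\<^sub>v x = 0\<^sub>v m \<longrightarrow> (\<exists>k>0. k \<cdot>\<^sub>v x \<in> group_span n (set vs))"
    using saturation_projection[OF vs] by metis
  \<comment> \<open>The components of the unit vectors in the kernel of P along the image of Q.
    Together with the columns of Q they give back the unit vectors, as the last clause of the
    certificate demands.\<close>
  define h where "h j = unit_vec n j - Q *\<^sub>v (P *\<^sub>v unit_vec n j)" for j
  have hc: "h j \<in> carrier_vec n" for j using P Q by (simp add: h_def)
  have Ph: "P *\<^sub>v h j = 0\<^sub>v m" for j
  proof -
    have e: "P *\<^sub>v unit_vec n j \<in> carrier_vec m" using P by simp
    have "P *\<^sub>v h j = P *\<^sub>v unit_vec n j - P *\<^sub>v (Q *\<^sub>v (P *\<^sub>v unit_vec n j))"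
      unfolding h_def using Q e by (intro mult_minus_distrib_mat_vec[OF P]) auto
    also have "P *\<^sub>v (Q *\<^sub>v (P *\<^sub>v unit_vec n j)) = P *\<^sub>v unit_vec n j"
      using assoc_mult_mat_vec[OF P Q e] PQ e by simp
    finally show ?thesis using e by simp
  qed
  let ?rs = "rows P" and ?qs = "cols Q" and ?hs = "map h [0..<n]"
  have rs: "set ?rs \<subseteq> carrier_vec n" and qs: "set ?qs \<subseteq> carrier_vec n" and len: "length ?rs = m" "length ?qs = m"
    using P Q rows_carrier[of P] cols_dim[of Q] by auto
  have PP: "mat_of_rows n ?rs = P" using P by (auto simp: mat_of_rows_rows)
  have "projection_certificate n ?rs ?qs ?hs"
    unfolding projection_certificate_def len vectors_iff
  proof (intro conjI allI impI ballI)
    show "set ?hs \<subseteq> carrier_vec n" using hc by auto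
  next
    fix i j assume ij: "i < m" "j < m"
    have r: "row P i \<in> carrier_vec n" "col Q j \<in> carrier_vec n" using P Q ij by auto
    have "nth0 ?rs i = row P i" "nth0 ?qs j = col Q j" using ij P Q by (auto simp: nth_default_def)
    then have "dot n (nth0 ?rs i) (nth0 ?qs j) = (P * Q) $$ (i, j)" using ij P Q r by simp
    then show "dot n (nth0 ?rs i) (nth0 ?qs j) = (if i = j then 1 else 0)" using PQ ij by simp
  next
    fix r x assume r: "r \<in> set ?rs" and x: "x \<in> set ?hs"
    obtain i where i: "i < m" "r = row P i" using r P by (auto simp: rows_def)
    obtain j where j: "x = h j" using x by auto
    have "(P *\<^sub>v x) $ i = 0" using Ph i(1) unfolding j by simp
    then have "r \<bullet> x = 0" using i P by simp
    moreover have "r \<in> carrier_vec n" "x \<in> carrier_vec n" using r rs hc j by auto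
    ultimately show "dot n r x = 0" by simp
  next
    fix j assume j: "j < n"
    let ?t = "P *\<^sub>v unit_vec n j"
    have t: "?t \<in> carrier_vec m" using P by simp
    have "Q *\<^sub>v ?t \<in> group_span n (set (?hs @ ?qs))"
    proof (rule mult_mat_vec_induct[OF Q t])
      show "0\<^sub>v n \<in> group_span n (set (?hs @ ?qs))" by (rule cone_span.zero)
    next
      fix y k assume y: "y \<in> group_span n (set (?hs @ ?qs))" and k: "k < m"
      have "col Q k \<in> set ?qs" using k Q by (auto simp: cols_def)
      moreover have "col Q k \<in> carrier_vec n" using k Q by simp
      ultimately have "?t $ k \<cdot>\<^sub>v col Q k \<in> group_span n (set (?hs @ ?qs))"
        by (intro group_span_smult cone_span_gen) simp_all
      from cone_span_plus[OF y this]
      show "y + ?t $ k \<cdot>\<^sub>v col Q k \<in> group_span n (set (?hs @ ?qs))" .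
    qed
    moreover have "h j \<in> group_span n (set (?hs @ ?qs))"
      using j by (intro cone_span_gen hc) simp
    ultimately have "h j + Q *\<^sub>v ?t \<in> group_span n (set (?hs @ ?qs))" by (intro cone_span_plus)
    also have "h j + Q *\<^sub>v ?t = unit_vec n j" unfolding h_def using Q by (intro eq_vecI) auto
    finally show "unit_vec n j \<in> group_span n (set (?hs @ ?qs))" .
  qed (use rs qs in blast)+
  then show ?thesis using Pv ker PP len(1) by metis
qed

text \<open>The generators of \<open>B\<close> on the smallest face of the cone over \<open>B\<close> that contains \<open>X\<close>.\<close>

definition hull_face :: "nat \<Rightarrow> int vec list \<Rightarrow> int vec set \<Rightarrow> int vec list" where
  "hull_face m B X = filter (\<lambda>d. \<exists>y. y \<in> cone_span m (set B) \<and> vadd m d y \<in> cone_span m X) B"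

text \<open>Strict Farkas is applied to B together with the negatives of X. Nonnegativity on both X
  and - X makes u vanish on X. It vanishes on b in B exactly when - b is y - x with y in the cone
  over B and x in the cone over X, that is, when b + y is in the cone over X.\<close>

lemma exposed_by_hull_face:
  assumes B: "set B \<subseteq> carrier_vec m" and X: "X \<subseteq> set B"
  shows "\<exists>u. exposed_by m B (hull_face m B X) u"
proof -
  have "finite (set B \<union> uminus ` X)" using finite_subset[OF X] by simp
  moreover have "set B \<union> uminus ` X \<subseteq> carrier_vec m" using B X by auto
  ultimately obtain u where u: "u \<in> carrier_vec m"
    "\<forall>a\<in>set B \<union> uminus ` X. u \<bullet> a > 0 \<or> (u \<bullet> a = 0 \<and> - a \<in> cone_span m (set B \<union> uminus ` X))"
    using farkas_strict by metis
  have nn: "0 \<le> u \<bullet> b" if "b \<in> set B" for b using u(2) that by force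
  have uX: "u \<bullet> x = 0" if x: "x \<in> X" for x
  proof -
    have "x \<in> carrier_vec m" using x X B by blast
    then have "u \<bullet> - x = - (u \<bullet> x)" using u(1) by simp
    moreover have "0 \<le> u \<bullet> - x" using u(2) x by force
    moreover have "0 \<le> u \<bullet> x" using nn x X by blast
    ultimately show ?thesis by linarith
  qed
  have "exposed_by m B (hull_face m B X) u"
    unfolding exposed_by_def
  proof (intro conjI ballI)
    show "dim_vec u = m" using u(1) by simp
    show "d \<in> set B" if "d \<in> set (hull_face m B X)" for d using that by (simp add: hull_face_def)
  next
    fix b assume b: "b \<in> set B"
    have bc: "b \<in> carrier_vec m" using b B by blast
    have "u \<bullet> b > 0 \<or> (u \<bullet> b = 0 \<and> - b \<in> cone_span m (set B \<union> uminus ` X))" using u(2) b by blast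
    then show "0 < dot m u b \<and> b \<notin> set (hull_face m B X) \<or> dot m u b = 0 \<and> b \<in> set (hull_face m B X)"
    proof
      assume pos: "0 < u \<bullet> b"
      have "b \<notin> set (hull_face m B X)"
      proof
        assume "b \<in> set (hull_face m B X)"
        then obtain y where y: "y \<in> cone_span m (set B)" "vadd m b y \<in> cone_span m X"
          by (auto simp: hull_face_def)
        have yc: "y \<in> carrier_vec m" by (rule cone_span_carrier[OF y(1)])
        have bX: "b + y \<in> cone_span m X" using y(2) bc yc by simp
        have "u \<bullet> (b + y) = 0" by (rule scalar_prod_cone_span_eq_0[OF u(1) _ bX]) (rule uX)
        then have "u \<bullet> b + u \<bullet> y = 0" using scalar_prod_add_distrib[OF u(1) bc yc] by simp
        moreover have "0 \<le> u \<bullet> y" by (rule scalar_prod_cone_span_nonneg[OF u(1) _ y(1)]) (use nn in blast)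
        ultimately show False using pos by linarith
      qed
      then show ?thesis using pos u(1) bc by simp
    next
      assume b0: "u \<bullet> b = 0 \<and> - b \<in> cone_span m (set B \<union> uminus ` X)"
      then obtain y x where yx: "y \<in> cone_span m (set B)" "x \<in> cone_span m (uminus ` X)" "- b = y + x"
        using cone_span_union by metis
      have c: "y \<in> carrier_vec m" "x \<in> carrier_vec m" using cone_span_carrier yx by blast+
      have "- x \<in> cone_span m (uminus ` uminus ` X)" by (rule cone_span_uminus[OF yx(2)])
      then have "- x \<in> cone_span m X" by (simp add: image_image)
      moreover have "b + y = - x"
      proof -
        have "b = - (y + x)" using yx(3) by (metis uminus_uminus_vec)
        then show ?thesis using c by (intro eq_vecI) auto
      qed
      ultimately have "vadd m b y \<in> cone_span m X" using bc c by simp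
      then have "b \<in> set (hull_face m B X)" using b yx(1) by (auto simp: hull_face_def)
      then show ?thesis using b0 u(1) bc by simp
    qed
  qed
  then show ?thesis ..
qed

lemma face_lattice_hull_faces:
  assumes B: "set B \<subseteq> carrier_vec m" and es: "set es = hull_face m B ` Pow (set B)"
  shows "face_lattice m B es"
  unfolding face_lattice_def
proof (intro conjI ballI)
  show "d \<in> set B" if "e \<in> set es" "d \<in> set e" for e d
    using that es by (auto simp: hull_face_def)
  show "\<exists>e\<in>set es. lies_over m B [] e"
    using es by (intro bexI[of _ "hull_face m B {}"]) (auto simp: lies_over_def hull_face_def)
next
  fix e b assume e: "e \<in> set es" and b: "b \<in> set B"
  have eB: "set e \<subseteq> set B" using e es by (auto simp: hull_face_def)
  let ?e = "hull_face m B (set (b # e))"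
  have self: "d \<in> set ?e" if d: "d \<in> set (b # e)" for d
  proof -
    have dB: "d \<in> set B" using d b eB by auto
    then have dc: "d \<in> carrier_vec m" using B by blast
    have "vadd m d (0\<^sub>v m) = d" using dc by simp
    then have "vadd m d (0\<^sub>v m) \<in> cone_span m (set (b # e))" using cone_span_gen[OF d dc] by simp
    then show ?thesis
      unfolding hull_face_def set_filter using dB cone_span.zero[of m "set B"] by blast
  qed
  show "\<exists>e'\<in>set es. b \<in> set e' \<and> (\<forall>d\<in>set e. d \<in> set e') \<and> lies_over m B (b # e) e'"
  proof (intro bexI[of _ ?e] conjI ballI)
    show "lies_over m B (b # e) ?e" unfolding lies_over_def hull_face_def by simp
    show "?e \<in> set es" unfolding es using b eB by auto
  qed (use self in auto)
qed

lemma quotient_certificate_exists: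
  assumes ls: "set ls \<subseteq> carrier_vec n" and gss: "\<forall>gs\<in>set gss. set gs \<subseteq> carrier_vec n"
  shows "\<exists>rs hs dss. quotient_certificate n gss ls rs hs dss"
proof -
  obtain A where steps: "(extension_step n ls)\<^sup>*\<^sup>* gss A"
    and sat: "\<And>C b. C \<in> set A \<Longrightarrow> b \<in> set ls \<or> - b \<in> set ls \<or>
      (\<exists>E\<in>set A. b \<in> set E \<and> (\<exists>y. y \<in> cone_span n (set E) \<and> vadd n b y \<in> cone_span n (set C))) \<Longrightarrow> b \<in> set C"
    using saturated_extension_exists[OF ls gss] by blast
  have Ac: "set C \<subseteq> carrier_vec n" if "C \<in> set A" for C
    using extension_steps_carrier[OF steps ls gss] that by blast
  have sat_face: "b \<in> set C"
    if "C \<in> set A" "E \<in> set A" "b \<in> set E" "y \<in> cone_span n (set E)" "b + y \<in> cone_span n (set C)" for C E b y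
  proof (rule sat[OF that(1)])
    have "b \<in> carrier_vec n" using that(2,3) Ac by blast
    then have "vadd n b y \<in> cone_span n (set C)" using that(5) cone_span_carrier[OF that(4)] by simp
    then show "b \<in> set ls \<or> - b \<in> set ls \<or>
      (\<exists>E\<in>set A. b \<in> set E \<and> (\<exists>y. y \<in> cone_span n (set E) \<and> vadd n b y \<in> cone_span n (set C)))"
      using that(2,3,4) by blast
  qed
  define V where "V = set ls \<union> (\<Union>C\<in>set A. {v \<in> set C. - v \<in> cone_span n (set C)})"
  have "finite V" unfolding V_def by simp
  then obtain vs where vs: "set vs = V" using finite_list by blast
  have Vc: "V \<subseteq> carrier_vec n" using ls Ac unfolding V_def by blast
  \<comment> \<open>The case y = - v of saturation, since v + y = 0 lies in every cone.\<close>
  have lineal: "v \<in> set C" if "C \<in> set A" "E \<in> set A" "v \<in> set E" "- v \<in> cone_span n (set E)" for C E v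
  proof (rule sat_face[OF that])
    have "v \<in> carrier_vec n" using that(2,3) Ac by blast
    then show "v + - v \<in> cone_span n (set C)" using cone_span.zero by simp
  qed
  have V: "v \<in> cone_span n (set C) \<and> - v \<in> cone_span n (set C)" if v: "v \<in> V" and C: "C \<in> set A" for v C
  proof -
    have vc: "v \<in> carrier_vec n" using v Vc by blast
    consider "v \<in> set ls" | E where "E \<in> set A" "v \<in> set E" "- v \<in> cone_span n (set E)"
      using v unfolding V_def by blast
    then show ?thesis
    proof cases
      case 1
      have "- (- v) \<in> set ls" using 1 by simp
      then have "v \<in> set C" "- v \<in> set C" using sat[OF C] 1 by blast+
      then show ?thesis using vc by (intro conjI cone_span_gen) auto
    next
      case 2
      have "- v \<in> cone_span n {a \<in> set E. - a \<in> cone_span n (set E)}"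
        using cone_span_gen[OF 2(2) vc] by (intro cone_span_lineality 2(3)) simp
      moreover have "{a \<in> set E. - a \<in> cone_span n (set E)} \<subseteq> set C" using lineal[OF C 2(1)] by blast
      ultimately have "- v \<in> cone_span n (set C)" using cone_span_mono by blast
      moreover have "v \<in> cone_span n (set C)" using lineal[OF C 2] vc by (rule cone_span_gen)
      ultimately show ?thesis by blast
    qed
  qed
  have span_V: "group_span n V \<subseteq> cone_span n (set C)" if "C \<in> set A" for C
    by (rule cone_span_least) (use V[OF _ that] in blast)
  obtain rs qs hs where proj: "projection_certificate n rs qs hs"
    and Pv: "\<And>v. v \<in> V \<Longrightarrow> mat_of_rows n rs *\<^sub>v v = 0\<^sub>v (length rs)"
    and ker: "\<And>x. x \<in> carrier_vec n \<Longrightarrow> mat_of_rows n rs *\<^sub>v x = 0\<^sub>v (length rs) \<Longrightarrow> \<exists>k>0. k \<cdot>\<^sub>v x \<in> group_span n V"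
    using projection_certificate_exists[of vs n] Vc unfolding vs by blast
  define m where "m = length rs"
  define P where "P = mat_of_rows n rs"
  note D = projection_certificateD[OF proj, folded m_def P_def]
  have P: "P \<in> carrier_mat m n" by (rule D(1))
  \<comment> \<open>a relation between the projected cones lifts to one between the cones of \<open>A\<close>\<close>
  have sep: "a \<in> set C2"
    if C: "C1 \<in> set A" "C2 \<in> set A" and a: "a \<in> set C1" and x: "x \<in> cone_span n (set C1)"
      and y: "y \<in> cone_span n (set C2)" and eq: "P *\<^sub>v a + P *\<^sub>v x = P *\<^sub>v y" for C1 C2 a x y
  proof -
    have ac: "a \<in> carrier_vec n" using a C(1) Ac by blast
    have xc: "x \<in> carrier_vec n" and yc: "y \<in> carrier_vec n" using cone_span_carrier x y by blast+
    have "P *\<^sub>v (a + x - y) = P *\<^sub>v (a + x) - P *\<^sub>v y"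
      using ac xc yc by (intro mult_minus_distrib_mat_vec[OF P]) auto
    also have "\<dots> = 0\<^sub>v m" using mult_add_distrib_mat_vec[OF P ac xc] eq P yc by simp
    finally obtain k where k: "0 < k" "k \<cdot>\<^sub>v (a + x - y) \<in> group_span n V"
      using ker[of "a + x - y"] ac xc yc unfolding P_def m_def by auto
    have z: "k \<cdot>\<^sub>v (a + x - y) \<in> cone_span n (set C2)" using k(2) span_V[OF C(2)] by blast
    \<comment> \<open>Adding k y leaves k a + k x in the cone over C2. All but one of the k copies
      of a are then counted with k x in the cone over C1, which is the form that saturation asks
      for.\<close>
    have "k \<cdot>\<^sub>v (a + x - y) + k \<cdot>\<^sub>v y \<in> cone_span n (set C2)"
      using k(1) by (intro cone_span_plus[OF z] cone_span_smult[OF y]) simp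
    also have "k \<cdot>\<^sub>v (a + x - y) + k \<cdot>\<^sub>v y = a + ((k - 1) \<cdot>\<^sub>v a + k \<cdot>\<^sub>v x)"
      using ac xc yc by (intro eq_vecI) (auto simp: algebra_simps)
    finally have "a + ((k - 1) \<cdot>\<^sub>v a + k \<cdot>\<^sub>v x) \<in> cone_span n (set C2)" .
    moreover have "(k - 1) \<cdot>\<^sub>v a + k \<cdot>\<^sub>v x \<in> cone_span n (set C1)"
      using k(1) a ac by (intro cone_span_plus cone_span_smult x cone_span_gen) auto
    ultimately show ?thesis using sat_face[OF C(2,1) a] by blast
  qed
  define pr where "pr C = map (apply_rows n rs) C" for C
  have pr: "set (pr C) = (\<lambda>c. P *\<^sub>v c) ` set C" if "C \<in> set A" for C
  proof -
    have "apply_rows n rs c = P *\<^sub>v c" if "c \<in> set C" for c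
      unfolding P_def using that \<open>C \<in> set A\<close> Ac by (intro apply_rows_eq D(3)) blast
    then show ?thesis by (auto simp: pr_def)
  qed
  have prc: "set (pr C) \<subseteq> carrier_vec m" if "C \<in> set A" for C
    unfolding pr[OF that] using Ac[OF that] P by auto
  have lift: "\<exists>x\<in>cone_span n (set C). w = P *\<^sub>v x" if "C \<in> set A" "w \<in> cone_span m (set (pr C))" for C w
    by (rule cone_span_image[OF P Ac[OF that(1)]]) (use that pr in simp)
  define Bs where "Bs = map pr A"
  define faces where "faces = (\<Union>B\<in>set Bs. hull_face m B ` Pow (set B))"
  have "finite faces" by (simp add: faces_def)
  then obtain dss where dss: "set dss = faces" using finite_list by blast
  have "fan_certificate m Bs dss"
    unfolding fan_certificate_def
  proof (intro conjI ballI)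
    fix B assume "B \<in> set Bs"
    then obtain C where C: "C \<in> set A" "B = pr C" by (auto simp: Bs_def)
    show "vectors m B" unfolding vectors_iff C(2) by (rule prc[OF C(1)])
    obtain u where u: "u \<in> carrier_vec m"
      "\<forall>b\<in>set B. u \<bullet> b > 0 \<or> (u \<bullet> b = 0 \<and> - b \<in> cone_span m (set B))"
      using farkas_strict[of "set B" m] prc[OF C(1)] C(2) by auto
    have "b = 0\<^sub>v m \<or> 0 < dot m u b" if b: "b \<in> set B" for b
    proof (cases "u \<bullet> b > 0")
      case True
      then show ?thesis using u(1) b prc[OF C(1)] C(2) by (subst dot_eq) auto
    next
      case False
      \<comment> \<open>The relation for - b lifts and shows that - a is in the enlarged cone for a
        preimage a of b. So a belongs to V, which P kills, and b = 0.\<close>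
      then have "- b \<in> cone_span m (set B)" using u(2) b by blast
      then obtain x where x: "x \<in> cone_span n (set C)" "- b = P *\<^sub>v x" using lift[OF C(1)] C(2) by blast
      obtain a where a: "a \<in> set C" "b = P *\<^sub>v a" using b pr[OF C(1)] C(2) by auto
      have ac: "a \<in> carrier_vec n" using a(1) Ac C(1) by blast
      have xc: "x \<in> carrier_vec n" by (rule cone_span_carrier[OF x(1)])
      have "P *\<^sub>v (a + x) = b + - b" using mult_add_distrib_mat_vec[OF P ac xc] a(2) x(2) by simp
      also have "\<dots> = 0\<^sub>v m" using a(2) P ac by simp
      finally obtain k where k: "0 < k" "k \<cdot>\<^sub>v (a + x) \<in> group_span n V"
        using ker[of "a + x"] ac xc unfolding P_def m_def by auto
      have z: "- (k \<cdot>\<^sub>v (a + x)) \<in> cone_span n (set C)"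
        using group_span_uminus[OF k(2)] span_V[OF C(1)] by blast
      have "- (k \<cdot>\<^sub>v (a + x)) + ((k - 1) \<cdot>\<^sub>v a + k \<cdot>\<^sub>v x) \<in> cone_span n (set C)"
        using k(1) a(1) ac by (intro cone_span_plus[OF z] cone_span_plus cone_span_smult x(1) cone_span_gen) auto
      also have "- (k \<cdot>\<^sub>v (a + x)) + ((k - 1) \<cdot>\<^sub>v a + k \<cdot>\<^sub>v x) = - a"
        using ac xc by (intro eq_vecI) (auto simp: algebra_simps)
      finally have "a \<in> V" using a(1) C(1) unfolding V_def by blast
      then show ?thesis using Pv a(2) unfolding P_def m_def by blast
    qed
    then show "\<exists>u. dim_vec u = m \<and> (\<forall>b\<in>set B. b = 0\<^sub>v m \<or> 0 < dot m u b)"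
      using u(1) by (intro exI[of _ u]) auto
    have "finite (hull_face m B ` Pow (set B))" by simp
    then obtain es where es: "set es = hull_face m B ` Pow (set B)" using finite_list by blast
    then have "\<forall>e\<in>set es. e \<in> set dss" unfolding dss faces_def using \<open>B \<in> set Bs\<close> by blast
    moreover have "face_lattice m B es" using face_lattice_hull_faces[OF _ es] prc[OF C(1)] C(2) by simp
    ultimately show "\<exists>es. (\<forall>e\<in>set es. e \<in> set dss) \<and> face_lattice m B es" by blast
  next
    fix ds assume "ds \<in> set dss"
    then obtain B X where B: "B \<in> set Bs" "X \<subseteq> set B" "ds = hull_face m B X" unfolding dss faces_def by blast
    then have "set B \<subseteq> carrier_vec m" using prc unfolding Bs_def by auto
    from exposed_by_hull_face[OF this B(2)] show "\<exists>B\<in>set Bs. \<exists>u. exposed_by m B ds u" using B(1,3) by blast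
  next
    fix B1 B2 assume "B1 \<in> set Bs" "B2 \<in> set Bs"
    then obtain C1 C2 where C: "C1 \<in> set A" "C2 \<in> set A" and B: "B1 = pr C1" "B2 = pr C2" by (auto simp: Bs_def)
    have B1c: "set B1 \<subseteq> carrier_vec m" and B2c: "set B2 \<subseteq> carrier_vec m" using prc C B by auto
    \<comment> \<open>Where a form from strict Farkas for B1 and - B2 vanishes on a generator, the
      negative of that vector is in the cone over both sets. By \<open>split\<close> this is a
      relation between the projected cones, and \<open>sep\<close> turns it into membership in the
      other list.\<close>
    let ?G = "set B1 \<union> uminus ` set B2"
    have "?G \<subseteq> carrier_vec m" using B1c B2c by auto
    then obtain u where u: "u \<in> carrier_vec m" "\<forall>a\<in>?G. u \<bullet> a > 0 \<or> (u \<bullet> a = 0 \<and> - a \<in> cone_span m ?G)"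
      using farkas_strict[of ?G m] by auto
    have split: "\<exists>x\<in>cone_span n (set C1). \<exists>y\<in>cone_span n (set C2). w = P *\<^sub>v x - P *\<^sub>v y"
      if w: "w \<in> cone_span m ?G" for w
    proof -
      obtain x' y' where xy: "x' \<in> cone_span m (set B1)" "y' \<in> cone_span m (uminus ` set B2)" "w = x' + y'"
        using cone_span_union[OF w] by blast
      have "- y' \<in> cone_span m (set B2)"
        using cone_span_uminus[OF xy(2)] by (simp add: image_image)
      then obtain y where y: "y \<in> cone_span n (set C2)" "- y' = P *\<^sub>v y" using lift[OF C(2)] B(2) by blast
      obtain x where x: "x \<in> cone_span n (set C1)" "x' = P *\<^sub>v x" using lift[OF C(1)] B(1) xy(1) by blast
      have "x' \<in> carrier_vec m" "y' \<in> carrier_vec m" using cone_span_carrier xy(1,2) by blast+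
      then have "w = x' - (- y')" unfolding xy(3) by (intro eq_vecI) auto
      then show ?thesis using x y by auto
    qed
    have "separated_by m B1 B2 u"
      unfolding separated_by_def
    proof (intro conjI ballI)
      show "dim_vec u = m" using u(1) by simp
    next
      fix b assume b: "b \<in> set B1"
      have bc: "b \<in> carrier_vec m" using b B1c by blast
      consider "u \<bullet> b > 0" | "u \<bullet> b = 0" "- b \<in> cone_span m ?G" using u(2) b by blast
      then show "0 < dot m u b \<or> dot m u b = 0 \<and> b \<in> set B2"
      proof cases
        case 2
        obtain x y where xy: "x \<in> cone_span n (set C1)" "y \<in> cone_span n (set C2)" "- b = P *\<^sub>v x - P *\<^sub>v y"
          using split[OF 2(2)] by blast
        obtain a where a: "a \<in> set C1" "b = P *\<^sub>v a" using b pr[OF C(1)] B(1) by auto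
        have c: "P *\<^sub>v x \<in> carrier_vec m" "P *\<^sub>v y \<in> carrier_vec m"
          using P cone_span_carrier[OF xy(1)] cone_span_carrier[OF xy(2)] by auto
        have "b = - (P *\<^sub>v x - P *\<^sub>v y)" using xy(3) by (metis uminus_uminus_vec)
        then have "P *\<^sub>v a + P *\<^sub>v x = P *\<^sub>v y" unfolding a(2) using c by (intro eq_vecI) auto
        from sep[OF C a(1) xy(1,2) this] have "b \<in> set B2" using a(2) pr[OF C(2)] B(2) by auto
        then show ?thesis using 2 u(1) bc by simp
      qed (use u(1) bc in simp)
    next
      fix b assume b: "b \<in> set B2"
      have bc: "b \<in> carrier_vec m" using b B2c by blast
      have ub: "u \<bullet> - b = - (u \<bullet> b)" using u(1) bc by simp
      have "- b \<in> ?G" using b by blast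
      then consider "u \<bullet> - b > 0" | "u \<bullet> - b = 0" "- (- b) \<in> cone_span m ?G" using u(2) by blast
      then show "dot m u b < 0 \<or> dot m u b = 0 \<and> b \<in> set B1"
      proof cases
        case 2
        have "b \<in> cone_span m ?G" using 2(2) by simp
        then obtain x y where xy: "x \<in> cone_span n (set C1)" "y \<in> cone_span n (set C2)" "b = P *\<^sub>v x - P *\<^sub>v y"
          using split by blast
        obtain a where a: "a \<in> set C2" "b = P *\<^sub>v a" using b pr[OF C(2)] B(2) by auto
        have c: "P *\<^sub>v x \<in> carrier_vec m" "P *\<^sub>v y \<in> carrier_vec m"
          using P cone_span_carrier[OF xy(1)] cone_span_carrier[OF xy(2)] by auto
        have "b + P *\<^sub>v y = P *\<^sub>v x" unfolding xy(3) using c by (intro eq_vecI) auto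
        then have "P *\<^sub>v a + P *\<^sub>v y = P *\<^sub>v x" using a(2) by simp
        from sep[OF C(2,1) a(1) xy(2,1) this] have "b \<in> set B1" using a(2) pr[OF C(1)] B(1) by auto
        then show ?thesis using 2 u(1) bc ub by simp
      qed (use u(1) bc ub in simp)
    qed
    then show "\<exists>u. separated_by m B1 B2 u" ..
  qed
  moreover have "list_all2 (\<lambda>C B. (\<forall>c\<in>set C. apply_rows n rs c \<in> set B) \<and>
      (\<forall>b\<in>set B. \<exists>c\<in>set C. b = apply_rows n rs c)) A Bs"
    unfolding Bs_def pr_def list_all2_conv_all_nth by auto
  moreover have "\<exists>k::int. 0 < k \<and> k \<cdot>\<^sub>v h \<in> group_span n (set vs)" if h: "h \<in> set hs" for h
  proof -
    have hc: "h \<in> carrier_vec n" using h D(4) by blast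
    then have "h \<in> group_span n (set hs)" using h by (intro cone_span_gen) auto
    from D(6)[OF this] show ?thesis using ker[OF hc] unfolding vs P_def m_def by blast
  qed
  moreover have "v \<in> set ls \<or> (\<exists>C\<in>set A. v \<in> cone_span n (set C) \<and> - v \<in> cone_span n (set C))"
    if v: "v \<in> set vs" for v
  proof (cases "v \<in> set ls")
    case False
    then obtain C where C: "C \<in> set A" using v unfolding vs V_def by blast
    have "v \<in> V" using v vs by simp
    from V[OF this C] C show ?thesis by blast
  qed blast
  moreover have "dot n r l = 0" if r: "r \<in> set rs" and l: "l \<in> set ls" for r l
  proof -
    obtain i where i: "i < m" "r = rs ! i" using r by (auto simp: in_set_conv_nth m_def)
    have c: "r \<in> carrier_vec n" "l \<in> carrier_vec n" using r l D(3) ls by blast+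
    have "P *\<^sub>v l = 0\<^sub>v m" using Pv[of l] l unfolding P_def m_def V_def by blast
    from arg_cong[OF this, of "\<lambda>w. w $ i"] have "r \<bullet> l = 0"
      using i c unfolding P_def m_def by simp
    then show ?thesis using c by simp
  qed
  ultimately have "quotient_certificate n gss ls rs hs dss"
    unfolding quotient_certificate_def using steps proj unfolding m_def by blast
  then show ?thesis by blast
qed

section \<open>The algorithm\<close>

lemma quotient_certificate_selection:
  "\<exists>F. computable F \<and> (\<forall>n gss ls. set ls \<subseteq> carrier_vec n \<longrightarrow> (\<forall>gs\<in>set gss. set gs \<subseteq> carrier_vec n) \<longrightarrow>
    (case F (n, gss, ls) of (rs, hs, dss) \<Rightarrow> quotient_certificate n gss ls rs hs dss))"
proof -
  \<comment> \<open>malformed inputs accept any output, so that the search is total\<close>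
  define R :: "nat \<times> int vec list list \<times> int vec list \<Rightarrow> int vec list \<times> int vec list \<times> int vec list list \<Rightarrow> bool"
    where "R x y \<longleftrightarrow> quotient_certificate (fst x) (fst (snd x)) (snd (snd x)) (fst y) (fst (snd y)) (snd (snd y)) \<or>
      (\<exists>v\<in>set (snd (snd x)). dim_vec v \<noteq> fst x) \<or> (\<exists>gs\<in>set (fst (snd x)). \<exists>v\<in>set gs. dim_vec v \<noteq> fst x)" for x y
  have "semidecidable (\<lambda>p. R (fst p) (snd p))"
    unfolding R_def
    by (intro semidecidable_intros decidable_semidecidable[OF decidable_not] computable_intros)
  moreover have "\<exists>y. R x y" for x
  proof (cases "set (snd (snd x)) \<subseteq> carrier_vec (fst x) \<and> (\<forall>gs\<in>set (fst (snd x)). set gs \<subseteq> carrier_vec (fst x))")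
    case True
    then obtain rs hs dss where "quotient_certificate (fst x) (fst (snd x)) (snd (snd x)) rs hs dss"
      using quotient_certificate_exists by blast
    then have "R x (rs, hs, dss)" by (simp add: R_def)
    then show ?thesis ..
  next
    case False
    then have "(\<exists>v\<in>set (snd (snd x)). dim_vec v \<noteq> fst x) \<or> (\<exists>gs\<in>set (fst (snd x)). \<exists>v\<in>set gs. dim_vec v \<noteq> fst x)"
      unfolding carrier_vec_def by blast
    then show ?thesis unfolding R_def by blast
  qed
  ultimately have "\<exists>F. computable F \<and> (\<forall>x. R x (F x))" by (rule computable_selection)
  then obtain F where F: "computable F" "\<And>x. R x (F x)" by blast
  show ?thesis
  proof (rule exI[of _ F], intro conjI allI impI)
    show "computable F" by (rule F(1))
  next
    fix n :: nat and gss :: "int vec list list" and ls :: "int vec list"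
    assume "set ls \<subseteq> carrier_vec n" and "\<forall>gs\<in>set gss. set gs \<subseteq> carrier_vec n"
    then have "\<not> (\<exists>v\<in>set ls. dim_vec v \<noteq> n)" "\<not> (\<exists>gs\<in>set gss. \<exists>v\<in>set gs. dim_vec v \<noteq> n)"
      unfolding carrier_vec_def by blast+
    moreover have "R (n, gss, ls) (F (n, gss, ls))" by (rule F(2))
    ultimately show "case F (n, gss, ls) of (rs, hs, dss) \<Rightarrow> quotient_certificate n gss ls rs hs dss"
      unfolding R_def case_prod_beta fst_conv snd_conv by blast
  qed
qed

lemma encode_vecs_eq: "encode_vecs vs = enc vs"
  by (simp add: encode_vecs_def encode_vec_def[abs_def] enc_list_def enc_vec_def[abs_def] enc_int_def)

lemma encode_cones_eq: "encode_cones gss = enc gss"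
  by (simp add: encode_cones_def encode_vecs_eq[abs_def] enc_list_def[of gss])

lemma quotient_fan_exists:
  assumes S: "cone_system n S" and L: "primitive_sublattice n L"
  shows "\<exists>Lh m P D. quotient_fan n S L Lh m P D"
proof -
  have fin: "finite S" and "\<forall>\<sigma>\<in>S. \<exists>vs. set vs \<subseteq> carrier_vec n \<and> \<sigma> = generated_cone n vs"
    using S unfolding cone_system_def by blast+
  then obtain g where g: "\<And>\<sigma>. \<sigma> \<in> S \<Longrightarrow> set (g \<sigma>) \<subseteq> carrier_vec n \<and> \<sigma> = generated_cone n (g \<sigma>)" by metis
  obtain ss where ss: "set ss = S" using finite_list[OF fin] by blast
  have gss: "\<forall>gs\<in>set (map g ss). set gs \<subseteq> carrier_vec n" using g ss by auto
  have "generated_cone n ` set (map g ss) = (\<lambda>\<sigma>. generated_cone n (g \<sigma>)) ` S"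
    using ss by (simp add: image_image)
  also have "\<dots> = (\<lambda>\<sigma>. \<sigma>) ` S" by (rule image_cong) (use g in auto)
  finally have Seq: "generated_cone n ` set (map g ss) = S" by simp
  obtain ls where ls: "set ls \<subseteq> carrier_vec n" "L = group_span n (set ls)"
    using sublattice_finitely_generated L unfolding primitive_sublattice_def by blast
  obtain rs hs dss where "quotient_certificate n (map g ss) ls rs hs dss"
    using quotient_certificate_exists[OF ls(1) gss] by blast
  from quotient_certificate_sound(1)[OF this ls(1) gss ls(2) L] show ?thesis unfolding Seq by blast
qed

lemma quotient_fans_computable: "\<exists>f. recursive 3 f \<and> computes_quotient_fans f"
proof -
  obtain F where F: "computable F"
    and cert: "\<And>n gss ls. set ls \<subseteq> carrier_vec n \<Longrightarrow> (\<forall>gs\<in>set gss. set gs \<subseteq> carrier_vec n) \<Longrightarrow>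
      (case F (n, gss, ls) of (rs, hs, dss) \<Rightarrow> quotient_certificate n gss ls rs hs dss)"
    using quotient_certificate_selection by (elim exE conjE) metis
  \<comment> \<open>The output components have different types, so each is coded on its own before
    they form a list of numbers, in the layout of \<open>encode_output\<close>; the rank m is the
    number of rows of the projection.\<close>
  define out where "out x = (let y = F x in
    [length (fst y), enc (fst y), enc (fst (snd y)), enc (snd (snd y))])" for x
  define f where "f xs = enc (out (dec (xs ! 0), dec (xs ! 1), dec (xs ! 2)))" for xs
  have "computable out"
    unfolding out_def Let_def by (intro computable_intros computable_comp[OF F])
  then have out: "recursive 1 (\<lambda>xs. enc (out (dec (xs ! 0))))" unfolding computable_def .
  have "recursive 3 (\<lambda>xs. prod_encode (xs ! 0, prod_encode (xs ! 1, xs ! 2)))"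
    by (intro recursive_comp2[OF recursive_prod_encode] recursive_nth)
  from recursive_comp1[where f = "\<lambda>k. enc (out (dec k))", OF out this]
  have rec: "recursive 3 f" by (simp add: f_def[abs_def] dec_prod_encode)
  have "computes_quotient_fans f"
    unfolding computes_quotient_fans_def
  proof (intro allI impI)
    fix n S L gss ls
    assume S: "cone_system n S" and L: "primitive_sublattice n L"
      and pS: "presents_system n gss S" and pL: "presents_sublattice n ls L"
    have gss: "\<forall>gs\<in>set gss. set gs \<subseteq> carrier_vec n" "S = generated_cone n ` set gss"
      using pS unfolding presents_system_def by blast+
    have ls: "set ls \<subseteq> carrier_vec n" "L = group_span n (set ls)"
      using pL generated_sublattice_eq unfolding presents_sublattice_def by blast+
    obtain rs hs dss where y: "F (n, gss, ls) = (rs, hs, dss)" by (metis prod_cases3)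
    have c: "quotient_certificate n gss ls rs hs dss" using cert[OF ls(1) gss(1)] y by simp
    note sound = quotient_certificate_sound[OF c ls(1) gss(1) ls(2) L]
    let ?P = "mat_of_rows n rs" and ?D = "generated_cone (length rs) ` set dss"
    have "quotient_fan n S L (group_span n (set hs)) (length rs) ?P ?D" using sound(1) gss(2) by simp
    moreover have "presents_sublattice n hs (group_span n (set hs))"
      unfolding presents_sublattice_def using sound(2) generated_sublattice_eq by blast
    moreover have "presents_system (length rs) dss ?D"
      unfolding presents_system_def using sound(3) by blast
    moreover have "f [n, encode_cones gss, encode_vecs ls] = encode_output (length rs) ?P hs dss"
      using sound(4) y
      by (simp add: f_def out_def encode_output_def encode_cones_eq encode_vecs_eq enc_list_def[of "[_, _, _, _]"])
    ultimately show "\<exists>m P Lh D hs dss. quotient_fan n S L Lh m P D \<and> presents_sublattice n hs Lh \<and>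
        presents_system m dss D \<and> f [n, encode_cones gss, encode_vecs ls] = encode_output m P hs dss"
      by blast
  qed
  with rec show ?thesis by blast
qed

theorem theorem2p3:
  shows "(\<exists>f. recursive 3 f \<and> computes_quotient_fans f) \<and>
    (\<forall>n S L. cone_system n S \<longrightarrow> primitive_sublattice n L \<longrightarrow>
       (\<exists>Lh m P D. quotient_fan n S L Lh m P D))"
  using quotient_fans_computable quotient_fan_exists by blast

end
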